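(* Suppose $p_{XY}$ has full support on $\mathcal{X}\times\mathcal{Y}$ and $(p_{XY},p_{Z|XY})$ is computable with asymptotic security. Then (the conditions of the characterization hold, so classes can be indexed consistently across $y$ as described in the context, and) \[R_S=H(W|Y),\] where $(X,Y,Z)\sim p_{XY}p_{Z|XY}$ and $W\in[k]$ is the random variable defined by $W=i$ iff $Z\in\mathcal{Z}_i^{(Y)}$.
   Context: Setup: $\mathcal{X},\mathcal{Y},\mathcal{Z}$ finite; Alice observes $X^n$, Bob observes $Y^n$, $(X_i,Y_i)$ i.i.d. $\sim p_{XY}$; target output p.m.f. $\prod_i p_{Z|XY}(z_i|x_i,y_i)$, giving $p_{X^nY^nZ^n}$. An $(n,2^{nR})$-code is a pair of stochastic maps $(p_{M|X^n},p_{\hat Z^n|MY^n})$, $M\in\{1,\dots,2^{nR}\}$. $\|p-q\|_1=\frac12\sum|p-q|$. Rate $R$ is achievable if there is a sequence of rate-$R$ codes such that for every $\epsilon>0$ there is a large enough $n$ with $\|p_{X^nY^n\hat Z^n}-p_{X^nY^nZ^n}\|_1\le\epsilon$ and $I(M;X^n|Y^n,\hat Z^n)\le n\epsilon$; $R_S$ is the infimum of achievable rates, and computability with asymptotic security means $R_S<\infty$. For $y\in\mathcal{Y}$ let $\mathcal{Z}^{(y)}=\{z:\exists x,\ p_{Z|XY}(z|x,y)>0\}$; partition $\mathcal{Z}^{(y)}$ into the classes $\mathcal{Z}_1^{(y)},\dots,\mathcal{Z}_{k(y)}^{(y)}$ of the equivalence relation "$z\equiv_y z'$ iff the columns $(p_{Z|XY}(z|x,y))_x$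 and $(p_{Z|XY}(z'|x,y))_x$ are positive scalar multiples"; each class has an associated probability vector $\vec\alpha_i^{(y)}$ on $\mathcal{X}$ with $p_{Z|XY}(z|x,y)=\vec\alpha_i^{(y)}(x)\vec\gamma_i^{(y)}(z)$ for $z\in\mathcal{Z}_i^{(y)}$. Under the hypotheses, $k(y)=k$ for all $y$ and the classes can be indexed so that $\vec\alpha_i^{(y)}$ does not depend on $y$; $W$ is defined with this indexing. *)

theory Defs
  imports Complex_Main
begin

definition is_joint_pmf :: "('x::finite \<Rightarrow> 'y::finite \<Rightarrow> real) \<Rightarrow> bool" where
  "is_joint_pmf p \<longleftrightarrow> (\<forall>x y. p x y \<ge> 0) \<and> (\<Sum>x\<in>UNIV. \<Sum>y\<in>UNIV. p x y) = 1"

definition is_channel :: "('x \<Rightarrow> 'y \<Rightarrow> 'z::finite \<Rightarrow> real) \<Rightarrow> bool" where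
  "is_channel q \<longleftrightarrow> (\<forall>x y z. q x y z \<ge> 0) \<and> (\<forall>x y. (\<Sum>z\<in>UNIV. q x y z) = 1)"

definition seqs :: "nat \<Rightarrow> 'a list set" where
  "seqs n = {xs. length xs = n}"

definition msgs :: "nat \<Rightarrow> real \<Rightarrow> nat set" where
  "msgs n R = {1..nat \<lfloor>2 powr (real n * R)\<rfloor>}"

definition src_n :: "('x \<Rightarrow> 'y \<Rightarrow> real) \<Rightarrow> nat \<Rightarrow> 'x list \<Rightarrow> 'y list \<Rightarrow> real" where
  "src_n p n xs ys = (\<Prod>i<n. p (xs ! i) (ys ! i))"

definition target_n :: "('x \<Rightarrow> 'y \<Rightarrow> real) \<Rightarrow> ('x \<Rightarrow> 'y \<Rightarrow> 'z \<Rightarrow> real) \<Rightarrow> nat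
    \<Rightarrow> 'x list \<Rightarrow> 'y list \<Rightarrow> 'z list \<Rightarrow> real" where
  "target_n p q n xs ys zs = src_n p n xs ys * (\<Prod>i<n. q (xs ! i) (ys ! i) (zs ! i))"

text \<open>An (n, 2^{nR}) code: stochastic encoder enc xs m = p(m|x^n) and stochastic
  decoder dec m ys zs = p(zhat^n | m, y^n).\<close>
definition is_code :: "nat \<Rightarrow> real \<Rightarrow> ('x list \<Rightarrow> nat \<Rightarrow> real)
    \<Rightarrow> (nat \<Rightarrow> 'y list \<Rightarrow> 'z list \<Rightarrow> real) \<Rightarrow> bool" where
  "is_code n R enc dec \<longleftrightarrow>
     (\<forall>xs\<in>seqs n. \<forall>m\<in>msgs n R. enc xs m \<ge> 0) \<and>
     (\<forall>xs\<in>seqs n. (\<Sum>m\<in>msgs n R. enc xs m) = 1) \<and>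
     (\<forall>m\<in>msgs n R. \<forall>ys\<in>seqs n. \<forall>zs\<in>seqs n. dec m ys zs \<ge> 0) \<and>
     (\<forall>m\<in>msgs n R. \<forall>ys\<in>seqs n. (\<Sum>zs\<in>seqs n. dec m ys zs) = 1)"

definition code_joint :: "('x \<Rightarrow> 'y \<Rightarrow> real) \<Rightarrow> nat \<Rightarrow> ('x list \<Rightarrow> nat \<Rightarrow> real)
    \<Rightarrow> (nat \<Rightarrow> 'y list \<Rightarrow> 'z list \<Rightarrow> real) \<Rightarrow> nat \<Rightarrow> 'x list \<Rightarrow> 'y list \<Rightarrow> 'z list \<Rightarrow> real" where
  "code_joint p n enc dec m xs ys zs = src_n p n xs ys * enc xs m * dec m ys zs"

definition code_out :: "('x \<Rightarrow> 'y \<Rightarrow> real) \<Rightarrow> nat \<Rightarrow> real \<Rightarrow> ('x list \<Rightarrow> nat \<Rightarrow> real)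
    \<Rightarrow> (nat \<Rightarrow> 'y list \<Rightarrow> 'z list \<Rightarrow> real) \<Rightarrow> 'x list \<Rightarrow> 'y list \<Rightarrow> 'z list \<Rightarrow> real" where
  "code_out p n R enc dec xs ys zs = (\<Sum>m\<in>msgs n R. code_joint p n enc dec m xs ys zs)"

definition tv_dist :: "'a set \<Rightarrow> ('a \<Rightarrow> real) \<Rightarrow> ('a \<Rightarrow> real) \<Rightarrow> real" where
  "tv_dist S P Q = (1/2) * (\<Sum>a\<in>S. \<bar>P a - Q a\<bar>)"

definition cond_mi :: "('a \<times> 'b \<times> 'c) set \<Rightarrow> ('a \<times> 'b \<times> 'c \<Rightarrow> real) \<Rightarrow> real" where
  "cond_mi S P =
    (let Pc  = (\<lambda>c. \<Sum>t\<in>S. if snd (snd t) = c then P t else 0);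
         Pac = (\<lambda>a c. \<Sum>t\<in>S. if fst t = a \<and> snd (snd t) = c then P t else 0);
         Pbc = (\<lambda>b c. \<Sum>t\<in>S. if fst (snd t) = b \<and> snd (snd t) = c then P t else 0)
     in (\<Sum>t\<in>S. case t of (a, b, c) \<Rightarrow>
           if P (a, b, c) > 0
           then P (a, b, c) * log 2 (P (a, b, c) * Pc c / (Pac a c * Pbc b c))
           else 0))"

definition code_leak :: "('x::finite \<Rightarrow> 'y::finite \<Rightarrow> real) \<Rightarrow> nat \<Rightarrow> real \<Rightarrow> ('x list \<Rightarrow> nat \<Rightarrow> real)
    \<Rightarrow> (nat \<Rightarrow> 'y list \<Rightarrow> 'z::finite list \<Rightarrow> real) \<Rightarrow> real" where
  "code_leak p n R enc dec =
     cond_mi (msgs n R \<times> seqs n \<times> (seqs n \<times> seqs n))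
       (\<lambda>(m, xs, ys, zs). code_joint p n enc dec m xs ys zs)"

definition achievable :: "('x::finite \<Rightarrow> 'y::finite \<Rightarrow> real) \<Rightarrow> ('x \<Rightarrow> 'y \<Rightarrow> 'z::finite \<Rightarrow> real)
    \<Rightarrow> real \<Rightarrow> bool" where
  "achievable p q R \<longleftrightarrow>
     (\<exists>(enc :: nat \<Rightarrow> 'x list \<Rightarrow> nat \<Rightarrow> real) (dec :: nat \<Rightarrow> nat \<Rightarrow> 'y list \<Rightarrow> 'z list \<Rightarrow> real).
        (\<forall>n. is_code n R (enc n) (dec n)) \<and>
        (\<forall>\<epsilon>>0. \<forall>\<^sub>F n in sequentially.
            tv_dist (seqs n \<times> seqs n \<times> seqs n)
              (\<lambda>(xs, ys, zs). code_out p n R (enc n) (dec n) xs ys zs)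
              (\<lambda>(xs, ys, zs). target_n p q n xs ys zs) \<le> \<epsilon> \<and>
            code_leak p n R (enc n) (dec n) \<le> real n * \<epsilon>))"

definition secure_rate :: "('x::finite \<Rightarrow> 'y::finite \<Rightarrow> real) \<Rightarrow> ('x \<Rightarrow> 'y \<Rightarrow> 'z::finite \<Rightarrow> real) \<Rightarrow> real" where
  "secure_rate p q = Inf {R. achievable p q R}"

text \<open>Computability with asymptotic security: R_S < infinity, i.e. some rate is achievable.\<close>
definition securely_computable :: "('x::finite \<Rightarrow> 'y::finite \<Rightarrow> real) \<Rightarrow> ('x \<Rightarrow> 'y \<Rightarrow> 'z::finite \<Rightarrow> real) \<Rightarrow> bool" where
  "securely_computable p q \<longleftrightarrow> (\<exists>R. achievable p q R)"

definition Zsupp :: "('x \<Rightarrow> 'y \<Rightarrow> 'z \<Rightarrow> real) \<Rightarrow> 'y \<Rightarrow> 'z set" where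
  "Zsupp q y = {z. \<exists>x. q x y z > 0}"

definition col_equiv :: "('x \<Rightarrow> 'y \<Rightarrow> 'z \<Rightarrow> real) \<Rightarrow> 'y \<Rightarrow> 'z \<Rightarrow> 'z \<Rightarrow> bool" where
  "col_equiv q y z z' \<longleftrightarrow> (\<exists>c>0. \<forall>x. q x y z = c * q x y z')"

definition consistent_classes :: "('x::finite \<Rightarrow> 'y \<Rightarrow> 'z \<Rightarrow> real) \<Rightarrow> nat \<Rightarrow> ('y \<Rightarrow> nat \<Rightarrow> 'z set)
    \<Rightarrow> (nat \<Rightarrow> 'x \<Rightarrow> real) \<Rightarrow> bool" where
  "consistent_classes q k cls \<alpha> \<longleftrightarrow>
     (\<forall>y. \<forall>i<k. \<exists>z\<in>Zsupp q y. cls y i = {z'\<in>Zsupp q y. col_equiv q y z z'}) \<and>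
     (\<forall>y. (\<Union>i<k. cls y i) = Zsupp q y) \<and>
     (\<forall>y. \<forall>i<k. \<forall>j<k. i \<noteq> j \<longrightarrow> cls y i \<noteq> cls y j) \<and>
     (\<forall>i<k. (\<forall>x. \<alpha> i x \<ge> 0) \<and> (\<Sum>x\<in>UNIV. \<alpha> i x) = 1) \<and>
     (\<forall>y. \<forall>i<k. \<forall>z\<in>cls y i. \<exists>g>0. \<forall>x. q x y z = \<alpha> i x * g)"

definition cond_entropy_W :: "('x::finite \<Rightarrow> 'y::finite \<Rightarrow> real) \<Rightarrow> ('x \<Rightarrow> 'y \<Rightarrow> 'z::finite \<Rightarrow> real)
    \<Rightarrow> nat \<Rightarrow> ('y \<Rightarrow> nat \<Rightarrow> 'z set) \<Rightarrow> real" where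
  "cond_entropy_W p q k cls =
     (\<Sum>y\<in>UNIV. \<Sum>i<k.
        let pwy = (\<Sum>x\<in>UNIV. \<Sum>z\<in>cls y i. p x y * q x y z);
            py = (\<Sum>x\<in>UNIV. p x y)
        in if pwy > 0 then - pwy * log 2 (pwy / py) else 0)"

end

theory Submission
  imports Defs
begin

text \<open>Take one coordinate of a secure code and let \<open>U\<close> be the message with Bob's other
  observations. Then \<open>U - X - Y\<close>, \<open>Z - (U,Y) - X\<close>, and, by subadditivity and continuity of entropy,
  small leakage makes \<open>I(U;X|Y,Z)\<close> small on average. Full support of the source then forces the
  likelihood vector of \<open>U\<close> to be nearly proportional to the column of \<open>(Y,Z)\<close>: \<open>U\<close> determines the
  class \<open>W\<close> of the output, whatever \<open>y\<close> is. Consequently the classes and their conditional laws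
  given \<open>x\<close> do not depend on \<open>y\<close>, and the message determines almost all of the class sequence,
  so the rate is at least \<open>H(W|Y)\<close>.

  Conversely, Alice can then generate \<open>W\<close> from \<open>X\<close> alone. She sends a bin index of \<open>W\<^sup>n\<close> at any rate
  above \<open>H(W|Y)\<close>; Bob decodes \<open>W\<^sup>n\<close> with the help of \<open>Y\<^sup>n\<close> and samples \<open>Z\<close> from \<open>(W,Y)\<close>. As the output
  reveals \<open>W\<^sup>n\<close>, the message leaks almost nothing.\<close>

subsection \<open>Sums over sequences\<close>

text \<open>Why full support is decisive: the posterior of \<open>X\<close> given
  \<open>(U,Y)\<close> is proportional to \<open>p x y * v u x\<close>, the one given
  \<open>(Y,Z)\<close> to \<open>p x y * q x y z\<close>. When the two nearly agree, the positive
  factor \<open>p x y\<close> cancels, and what remains, \<open>v u\<close> parallel to a column, no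
  longer mentions the source. Moreover every \<open>y\<close> can occur with every \<open>u\<close>,
  so one label per \<open>u\<close> must serve all \<open>y\<close> at once.

  At finite length nothing vanishes exactly, so each step carries an explicit error. The leakage is
  H(X^n|Y^n,Z^n) - H(X^n|M,Y^n). The second entropy is at most the sum of the H(X_i|U_i,Y_i), where
  (U_i,Y_i) is just (M,Y^n); the first is known to be additive only for the i.i.d. target, whence a
  continuity bound on blocks and another on letters. Distinct columns are a fixed distance apart,
  and this gap turns a small average deviation into few wrong labels.

  The class laws at two values of \<open>y\<close> come out exactly equal because they are fixed
  numbers, independent of the code, whose difference is below every error level.\<close>

lemma finite_seqs [simp]: "finite (seqs n :: 'a::finite list set)"
  using finite_lists_length_eq[of "UNIV :: 'a set" n] by (simp add: seqs_def)

lemma length_seqs: "xs \<in> seqs n \<Longrightarrow> length xs = n"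
  by (simp add: seqs_def)

lemma card_seqs: "card (seqs n :: 'a::finite list set) = card (UNIV :: 'a set) ^ n"
  using card_lists_length_eq[of "UNIV :: 'a set" n] by (simp add: seqs_def)

lemma seqs_0 [simp]: "seqs 0 = {[]}"
  by (auto simp: seqs_def)

lemma sum_seqs_Suc:
  "(\<Sum>xs\<in>seqs (Suc n). f xs) = (\<Sum>a\<in>(UNIV::'a::finite set). \<Sum>xs\<in>seqs n. f (a # xs))"
proof -
  have "seqs (Suc n) = (\<lambda>(a, xs). a # xs) ` (UNIV \<times> seqs n :: ('a \<times> 'a list) set)"
    by (auto simp: seqs_def image_iff length_Suc_conv)
  moreover have "inj_on (\<lambda>(a, xs). a # xs) (UNIV \<times> seqs n :: ('a \<times> 'a list) set)"
    by (auto simp: inj_on_def)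
  ultimately show ?thesis
    by (simp add: sum.reindex sum.cartesian_product case_prod_unfold)
qed

section \<open>Splitting one coordinate off a sequence\<close>

definition ins :: "nat \<Rightarrow> 'a \<Rightarrow> 'a list \<Rightarrow> 'a list" where
  "ins i a xs = take i xs @ a # drop i xs"

definition del :: "nat \<Rightarrow> 'a list \<Rightarrow> 'a list" where
  "del i xs = take i xs @ drop (Suc i) xs"

lemma ins_0 [simp]: "ins 0 a xs = a # xs"
  by (simp add: ins_def)

lemma ins_Suc_Cons [simp]: "ins (Suc i) a (b # xs) = b # ins i a xs"
  by (simp add: ins_def)

lemma ins_in_seqs [simp]: "i \<le> n \<Longrightarrow> xs \<in> seqs n \<Longrightarrow> ins i a xs \<in> seqs (Suc n)"
  by (simp add: ins_def seqs_def)

lemma del_in_seqs [simp]: "i \<le> n \<Longrightarrow> xs \<in> seqs (Suc n) \<Longrightarrow> del i xs \<in> seqs n"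
  by (simp add: del_def seqs_def)

lemma nth_ins [simp]: "i \<le> n \<Longrightarrow> xs \<in> seqs n \<Longrightarrow> ins i a xs ! i = a"
  by (simp add: ins_def seqs_def nth_append)

lemma del_ins [simp]: "i \<le> n \<Longrightarrow> xs \<in> seqs n \<Longrightarrow> del i (ins i a xs) = xs"
  by (simp add: ins_def del_def seqs_def)

lemma ins_del: "i \<le> n \<Longrightarrow> xs \<in> seqs (Suc n) \<Longrightarrow> ins i (xs ! i) (del i xs) = xs"
  by (simp add: ins_def del_def seqs_def min_def id_take_nth_drop[symmetric])

lemma sum_seqs_ins:
  "i \<le> n \<Longrightarrow> (\<Sum>xs\<in>seqs (Suc n). f xs) = (\<Sum>a\<in>(UNIV::'a::finite set). \<Sum>xs\<in>seqs n. f (ins i a xs))"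
proof (induction i arbitrary: n f)
  case 0
  then show ?case by (simp add: sum_seqs_Suc)
next
  case (Suc i)
  then obtain k where n: "n = Suc k" "i \<le> k" by (cases n) auto
  have "(\<Sum>xs\<in>seqs (Suc n). f xs) = (\<Sum>b\<in>UNIV. \<Sum>xs\<in>seqs (Suc k). f (b # xs))"
    unfolding n by (rule sum_seqs_Suc)
  also have "\<dots> = (\<Sum>b\<in>UNIV. \<Sum>a\<in>UNIV. \<Sum>xs\<in>seqs k. f (b # ins i a xs))"
    using Suc.IH[OF n(2)] by simp
  also have "\<dots> = (\<Sum>a\<in>UNIV. \<Sum>b\<in>UNIV. \<Sum>xs\<in>seqs k. f (b # ins i a xs))"
    by (rule sum.swap)
  also have "\<dots> = (\<Sum>a\<in>UNIV. \<Sum>xs\<in>seqs n. f (ins (Suc i) a xs))"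
    by (simp add: n sum_seqs_Suc)
  finally show ?case .
qed

text \<open>Lets facts on i.i.d. sequences over one alphabet be applied to product alphabets: a word
  of pairs is a pair of words of the same length.\<close>

lemma sum_seqs_pair:
  "(\<Sum>ts\<in>(seqs n :: ('a::finite \<times> 'b::finite) list set). f (map fst ts) (map snd ts))
     = (\<Sum>xs\<in>seqs n. \<Sum>ys\<in>seqs n. f xs ys)"
proof (induction n arbitrary: f)
  case (Suc n)
  have "(\<Sum>ts\<in>(seqs (Suc n) :: ('a \<times> 'b) list set). f (map fst ts) (map snd ts))
      = (\<Sum>a\<in>UNIV. \<Sum>b\<in>UNIV. \<Sum>xs\<in>seqs n. \<Sum>ys\<in>seqs n. f (a # xs) (b # ys))"
    using Suc.IH[of "\<lambda>xs ys. f (x # xs) (y # ys)" for x y]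
    by (simp add: sum_seqs_Suc UNIV_Times_UNIV[symmetric] sum.cartesian_product'
        del: UNIV_Times_UNIV)
  also have "\<dots> = (\<Sum>a\<in>UNIV. \<Sum>xs\<in>seqs n. \<Sum>b\<in>UNIV. \<Sum>ys\<in>seqs n. f (a # xs) (b # ys))"
    by (rule sum.cong[OF refl], rule sum.swap)
  finally show ?case by (simp add: sum_seqs_Suc)
qed simp

lemma sum_prod_seqs:
  fixes f :: "nat \<Rightarrow> 'a::finite \<Rightarrow> 'b::comm_semiring_1"
  shows "(\<Sum>xs\<in>seqs n. \<Prod>i<n. f i (xs ! i)) = (\<Prod>i<n. \<Sum>a\<in>UNIV. f i a)"
proof (induction n arbitrary: f)
  case (Suc n)
  show ?case
    by (simp add: sum_seqs_Suc prod.lessThan_Suc_shift sum_distrib_left[symmetric]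
        Suc.IH[of "\<lambda>i. f (Suc i)"] sum_distrib_right[symmetric]
        del: prod.lessThan_Suc)
qed simp

lemma src_n_Suc [simp]: "src_n p (Suc n) (x # xs) (y # ys) = p x y * src_n p n xs ys"
  by (simp add: src_n_def prod.lessThan_Suc_shift del: prod.lessThan_Suc)

lemma src_n_ins:
  "i \<le> n \<Longrightarrow> xs \<in> seqs n \<Longrightarrow> ys \<in> seqs n \<Longrightarrow>
    src_n p (Suc n) (ins i x xs) (ins i y ys) = p x y * src_n p n xs ys"
proof (induction i arbitrary: n xs ys)
  case (Suc i)
  then obtain k where "n = Suc k" by (cases n) auto
  with Suc.prems obtain x' xs' y' ys' where "xs = x' # xs'" "ys = y' # ys'"
    by (auto simp: seqs_def length_Suc_conv)
  with Suc \<open>n = Suc k\<close> show ?case by (simp add: seqs_def mult.left_commute)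
qed simp

lemma target_n_Suc [simp]:
  "target_n p q (Suc n) (x # xs) (y # ys) (z # zs) = p x y * q x y z * target_n p q n xs ys zs"
  by (simp add: target_n_def prod.lessThan_Suc_shift mult_ac del: prod.lessThan_Suc)

lemma target_n_ins:
  "i \<le> n \<Longrightarrow> xs \<in> seqs n \<Longrightarrow> ys \<in> seqs n \<Longrightarrow> zs \<in> seqs n \<Longrightarrow>
    target_n p q (Suc n) (ins i x xs) (ins i y ys) (ins i z zs) = p x y * q x y z * target_n p q n xs ys zs"
proof (induction i arbitrary: n xs ys zs)
  case (Suc i)
  then obtain k where "n = Suc k" by (cases n) auto
  with Suc.prems obtain x' xs' y' ys' z' zs' where "xs = x' # xs'" "ys = y' # ys'" "zs = z' # zs'"
    by (auto simp: seqs_def length_Suc_conv)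
  with Suc \<open>n = Suc k\<close> show ?case by (simp add: seqs_def mult_ac)
qed simp

section \<open>Moments of additive functionals of i.i.d. sequences\<close>

lemma expectation_sum_seqs:
  fixes Q \<phi> :: "'a::finite \<Rightarrow> real"
  assumes "(\<Sum>a\<in>UNIV. Q a) = 1"
  shows "(\<Sum>ts\<in>seqs n. (\<Prod>i<n. Q (ts ! i)) * (\<Sum>i<n. \<phi> (ts ! i))) = real n * (\<Sum>a\<in>UNIV. Q a * \<phi> a)"
proof (induction n)
  case (Suc n)
  have one: "(\<Sum>ts\<in>seqs n. \<Prod>i<n. Q (ts ! i)) = 1"
    using sum_prod_seqs[where n = n and f = "\<lambda>i. Q"] assms by simp
  have "(\<Sum>ts\<in>seqs (Suc n). (\<Prod>i<Suc n. Q (ts ! i)) * (\<Sum>i<Suc n. \<phi> (ts ! i)))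
      = (\<Sum>a\<in>UNIV. Q a * \<phi> a * (\<Sum>ts\<in>seqs n. \<Prod>i<n. Q (ts ! i))
         + Q a * (\<Sum>ts\<in>seqs n. (\<Prod>i<n. Q (ts ! i)) * (\<Sum>i<n. \<phi> (ts ! i))))"
    by (simp add: sum_seqs_Suc prod.lessThan_Suc_shift sum.lessThan_Suc_shift distrib_left
        sum.distrib sum_distrib_left mult_ac del: prod.lessThan_Suc sum.lessThan_Suc)
  also have "\<dots> = real (Suc n) * (\<Sum>a\<in>UNIV. Q a * \<phi> a)"
    unfolding Suc.IH one sum.distrib sum_distrib_right[symmetric] assms by (simp add: algebra_simps)
  finally show ?case .
qed simp

text \<open>The cross terms vanish because the mean is zero. It supplies the second moment for
  Chebyshev's inequality in \<open>atypical_bound\<close>.\<close>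

lemma variance_sum_seqs:
  fixes Q \<phi> :: "'a::finite \<Rightarrow> real"
  assumes "(\<Sum>a\<in>UNIV. Q a) = 1" "(\<Sum>a\<in>UNIV. Q a * \<phi> a) = 0"
  shows "(\<Sum>ts\<in>seqs n. (\<Prod>i<n. Q (ts ! i)) * (\<Sum>i<n. \<phi> (ts ! i))\<^sup>2) = real n * (\<Sum>a\<in>UNIV. Q a * (\<phi> a)\<^sup>2)"
proof (induction n)
  case (Suc n)
  have one: "(\<Sum>ts\<in>seqs n. \<Prod>i<n. Q (ts ! i)) = 1"
    using sum_prod_seqs[where n = n and f = "\<lambda>i. Q"] assms by simp
  define P T where "P ts = (\<Prod>i<n. Q (ts ! i))" and "T ts = (\<Sum>i<n. \<phi> (ts ! i))" for ts
  note IH = Suc.IH[folded P_def T_def] and one = one[folded P_def]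
  note mean = expectation_sum_seqs[OF assms(1), of n \<phi>, folded P_def T_def, unfolded assms(2)]
  have "(\<Sum>ts\<in>seqs (Suc n). (\<Prod>i<Suc n. Q (ts ! i)) * (\<Sum>i<Suc n. \<phi> (ts ! i))\<^sup>2)
      = (\<Sum>a\<in>UNIV. \<Sum>ts\<in>seqs n. Q a * P ts * (\<phi> a + T ts)\<^sup>2)"
    by (simp add: sum_seqs_Suc prod.lessThan_Suc_shift sum.lessThan_Suc_shift P_def T_def
        del: prod.lessThan_Suc sum.lessThan_Suc)
  also have "\<dots> = (\<Sum>a\<in>UNIV. Q a * (\<phi> a)\<^sup>2 * (\<Sum>ts\<in>seqs n. P ts)
         + 2 * Q a * \<phi> a * (\<Sum>ts\<in>seqs n. P ts * T ts) + Q a * (\<Sum>ts\<in>seqs n. P ts * (T ts)\<^sup>2))"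
    by (simp add: power2_sum distrib_left sum.distrib sum_distrib_left sum_distrib_right mult_ac)
  also have "\<dots> = real (Suc n) * (\<Sum>a\<in>UNIV. Q a * (\<phi> a)\<^sup>2)"
    unfolding IH one mean sum.distrib sum_distrib_right[symmetric] assms by (simp add: algebra_simps)
  finally show ?case .
qed simp

subsection \<open>Relative entropy bounds\<close>

text \<open>Pointwise it is ln t \<le> t - 1. The masses of \<open>a\<close> and \<open>b\<close>
  stay in the bound, so that unnormalised competitors are allowed. The last hypothesis is absolute
  continuity: the real-valued \<open>ln\<close> is not minus infinity at a zero of
  \<open>b\<close>.\<close>

lemma gibbs_inequality:
  fixes a b :: "'s \<Rightarrow> real"
  assumes "\<And>s. s \<in> S \<Longrightarrow> a s \<ge> 0" "\<And>s. s \<in> S \<Longrightarrow> b s \<ge> 0"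
    and "\<And>s. s \<in> S \<Longrightarrow> a s > 0 \<Longrightarrow> b s > 0"
  shows "(\<Sum>s\<in>S. a s * ln (b s)) \<le> (\<Sum>s\<in>S. a s * ln (a s)) + (\<Sum>s\<in>S. b s) - (\<Sum>s\<in>S. a s)"
proof -
  have "a s * ln (b s) \<le> a s * ln (a s) + b s - a s" if "s \<in> S" for s
  proof (cases "a s > 0")
    case True
    then have b: "b s > 0" using assms(3) that by blast
    have "a s * ln (b s / a s) \<le> a s * (b s / a s - 1)"
      using True b by (intro mult_left_mono ln_le_minus_one) auto
    then show ?thesis using True b by (simp add: ln_div algebra_simps)
  next
    case False
    then have "a s = 0" using assms(1)[OF that] by linarith
    then show ?thesis using assms(2) that by simp
  qed
  then have "(\<Sum>s\<in>S. a s * ln (b s)) \<le> (\<Sum>s\<in>S. a s * ln (a s) + b s - a s)"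
    by (rule sum_mono)
  then show ?thesis by (simp add: sum.distrib sum_subtractf)
qed

text \<open>A Fannes-type continuity bound, by comparing \<open>a\<close> with the smoothed \<open>b + \<tau>\<close>.\<close>

lemma entropy_continuity:
  fixes a b :: "'s \<Rightarrow> real"
  assumes "\<And>s. s \<in> S \<Longrightarrow> a s \<ge> 0" "\<And>s. s \<in> S \<Longrightarrow> 0 \<le> b s \<and> b s \<le> 1"
    and "(\<Sum>s\<in>S. a s) = (\<Sum>s\<in>S. b s)" and "0 < \<tau>" "\<tau> \<le> 1 / 2"
  shows "(\<Sum>s\<in>S. b s * ln (b s)) \<le> (\<Sum>s\<in>S. a s * ln (a s))
           + (\<Sum>s\<in>S. \<bar>a s - b s\<bar>) * ln (1 / \<tau>) + real (card S) * \<tau>"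
proof -
  have "(\<Sum>s\<in>S. a s * ln (b s + \<tau>)) \<le> (\<Sum>s\<in>S. a s * ln (a s)) + (\<Sum>s\<in>S. b s + \<tau>) - (\<Sum>s\<in>S. a s)"
    using assms by (intro gibbs_inequality) (auto intro: add_nonneg_pos add_nonneg_nonneg)
  then have 1: "(\<Sum>s\<in>S. a s * ln (b s + \<tau>)) \<le> (\<Sum>s\<in>S. a s * ln (a s)) + real (card S) * \<tau>"
    using assms(3) by (simp add: sum.distrib)
  have "b s * ln (b s) \<le> a s * ln (b s + \<tau>) + \<bar>a s - b s\<bar> * ln (1 / \<tau>)" if s: "s \<in> S" for s
  proof -
    have b: "0 \<le> b s" "b s \<le> 1" using assms(2)[OF s] by auto
    have l1: "ln \<tau> \<le> ln (b s + \<tau>)" using b assms by simp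
    \<comment> \<open>From \<tau> \<le> 1 / 2 comes 2 \<le> 1 / \<tau>, so one constant bounds the
      smoothed logarithm from both sides.\<close>
    have "b s + \<tau> \<le> 2" using b assms by linarith
    also have "2 \<le> 1 / \<tau>" using assms by (simp add: field_simps)
    finally have "ln (b s + \<tau>) \<le> ln (1 / \<tau>)" using b assms by simp
    with l1 have abs: "\<bar>ln (b s + \<tau>)\<bar> \<le> ln (1 / \<tau>)" using assms by (simp add: ln_div abs_le_iff)
    have "b s * ln (b s) \<le> b s * ln (b s + \<tau>)"
      using b assms by (cases "b s = 0") (auto intro!: mult_left_mono)
    also have "\<dots> = a s * ln (b s + \<tau>) + (b s - a s) * ln (b s + \<tau>)"
      by (simp add: algebra_simps)
    also have "(b s - a s) * ln (b s + \<tau>) \<le> \<bar>b s - a s\<bar> * \<bar>ln (b s + \<tau>)\<bar>"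
      by (metis abs_ge_self abs_mult)
    also have "\<dots> \<le> \<bar>b s - a s\<bar> * ln (1 / \<tau>)"
      using abs by (rule mult_left_mono) simp
    finally show ?thesis by (simp add: abs_minus_commute)
  qed
  then have "(\<Sum>s\<in>S. b s * ln (b s)) \<le> (\<Sum>s\<in>S. a s * ln (b s + \<tau>) + \<bar>a s - b s\<bar> * ln (1 / \<tau>))"
    by (rule sum_mono)
  with 1 show ?thesis by (simp add: sum.distrib sum_distrib_right)
qed

text \<open>A linearised Pinsker inequality, through the Hellinger distance: it can be averaged over
  coordinates without any Jensen step.\<close>

lemma abs_diff_le_kl:
  fixes a b l :: real
  assumes "a \<ge> 0" "b \<ge> 0" "a > 0 \<Longrightarrow> b > 0" "l > 0"
  shows "\<bar>a - b\<bar> \<le> (a * ln (a / b) - a + b) / l + l * (a + b) / 2"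
proof -
  define s t where "s = sqrt a" and "t = sqrt b"
  have st: "s \<ge> 0" "t \<ge> 0" "a = s\<^sup>2" "b = t\<^sup>2" using assms by (auto simp: s_def t_def)
  \<comment> \<open>The squared Hellinger distance is at most the divergence: apply ln r \<le> r - 1
    to the ratio of the square roots.\<close>
  have "(s - t)\<^sup>2 \<le> a * ln (a / b) - a + b"
  proof (cases "a > 0")
    case True
    then have pos: "s > 0" "t > 0" using assms(3)[OF True] True by (simp_all add: s_def t_def)
    have "ln (t / s) \<le> t / s - 1" using pos by (intro ln_le_minus_one) auto
    then have "2 * s\<^sup>2 * ln (t / s) \<le> 2 * s\<^sup>2 * (t / s - 1)" using pos by (intro mult_left_mono) auto
    also have "\<dots> = 2 * s * t - 2 * s\<^sup>2" using pos by (simp add: field_simps power2_eq_square)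
    finally have "2 * s\<^sup>2 * ln (t / s) \<le> 2 * s * t - 2 * s\<^sup>2" .
    moreover have "a * ln (a / b) = - (2 * s\<^sup>2 * ln (t / s))"
      using pos by (simp add: st ln_div ln_realpow algebra_simps)
    ultimately show ?thesis by (simp add: st power2_diff)
  next
    case False
    then have "s = 0" "a = 0" using assms by (auto simp: s_def)
    then show ?thesis by (simp add: st)
  qed
  then have 1: "(s - t)\<^sup>2 / l \<le> (a * ln (a / b) - a + b) / l"
    using assms by (simp add: divide_right_mono)
  have "\<bar>a - b\<bar> = \<bar>s - t\<bar> * (s + t)"
  proof -
    have "a - b = (s - t) * (s + t)" by (simp add: st power2_eq_square algebra_simps)
    then show ?thesis using st by (simp add: abs_mult)
  qed
  also have "\<dots> \<le> (s - t)\<^sup>2 / l + l * (s + t)\<^sup>2 / 4"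
  proof -
    define d w where "d = \<bar>s - t\<bar>" and "w = s + t"
    \<comment> \<open>Weighted AM-GM for d times w. The weight \<open>l\<close> stays free, since
      its best value depends on a divergence that is controlled only on average.\<close>
    have "0 \<le> (2 * d - l * w)\<^sup>2" by simp
    then have "4 * l * (d * w) \<le> 4 * d\<^sup>2 + l\<^sup>2 * w\<^sup>2"
      by (simp add: power2_diff power_mult_distrib mult_ac)
    then have "4 * l * (d * w) / (4 * l) \<le> (4 * d\<^sup>2 + l\<^sup>2 * w\<^sup>2) / (4 * l)"
      using assms by (intro divide_right_mono) auto
    also have "4 * l * (d * w) / (4 * l) = d * w" using assms by simp
    also have "(4 * d\<^sup>2 + l\<^sup>2 * w\<^sup>2) / (4 * l) = d\<^sup>2 / l + l * w\<^sup>2 / 4"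
      using assms by (simp add: add_divide_distrib power2_eq_square)
    finally have "d * w \<le> d\<^sup>2 / l + l * w\<^sup>2 / 4" .
    moreover have "d\<^sup>2 = (s - t)\<^sup>2" by (simp add: d_def)
    ultimately show ?thesis by (simp add: d_def w_def)
  qed
  also have "l * (s + t)\<^sup>2 / 4 \<le> l * (a + b) / 2"
  proof -
    have "(s + t)\<^sup>2 \<le> 2 * (a + b)" using sum_squares_bound[of s t] by (simp add: st power2_sum)
    then have "l * (s + t)\<^sup>2 \<le> l * (2 * (a + b))" using assms by (intro mult_left_mono) auto
    also have "\<dots> = 2 * (l * (a + b))" by simp
    finally show ?thesis by linarith
  qed
  finally show ?thesis using 1 by linarith
qed

subsection \<open>Single-letter analysis\<close>

text \<open>For an output outside the support at \<open>y\<close>, division by zero gives the zero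
  vector. For a channel this is not in \<open>cols q\<close>, whose members sum to 1, and so acts as
  an extra label for impossible outputs.\<close>

definition col :: "('x::finite \<Rightarrow> 'y \<Rightarrow> 'z \<Rightarrow> real) \<Rightarrow> 'y \<Rightarrow> 'z \<Rightarrow> 'x \<Rightarrow> real" where
  "col q y z = (\<lambda>x. q x y z / (\<Sum>x'\<in>UNIV. q x' y z))"

text \<open>The class labels. Normalised columns, unlike sets of outputs, can be compared across
  different \<open>y\<close>; in the end they are the vectors \<open>\<alpha> i\<close> of
  \<open>consistent_classes\<close>.\<close>

definition cols :: "('x::finite \<Rightarrow> 'y \<Rightarrow> 'z \<Rightarrow> real) \<Rightarrow> ('x \<Rightarrow> real) set" where
  "cols q = {col q y z |y z. z \<in> Zsupp q y}"

lemma finite_cols [simp]: "finite (cols (q :: 'x::finite \<Rightarrow> 'y::finite \<Rightarrow> 'z::finite \<Rightarrow> real))"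
proof -
  have "cols q \<subseteq> (\<lambda>(y, z). col q y z) ` UNIV" by (auto simp: cols_def)
  then show ?thesis by (rule finite_subset) simp
qed

lemma exists_gap:
  fixes A :: "('x::finite \<Rightarrow> real) set"
  assumes "finite A"
  shows "\<exists>\<rho>>0. \<rho> \<le> 1 \<and> (\<forall>a\<in>A. \<forall>b\<in>A. a \<noteq> b \<longrightarrow> 2 * \<rho> \<le> (\<Sum>x\<in>UNIV. \<bar>a x - b x\<bar>))"
proof -
  \<comment> \<open>The extra element 2 keeps \<open>D\<close> nonempty when no two members of
    \<open>A\<close> differ, and makes \<rho> = Min D / 2 at most 1.\<close>
  define D where "D = insert 2 ((\<lambda>(a, b). \<Sum>x\<in>UNIV. \<bar>a x - b x\<bar>) ` {(a, b). a \<in> A \<and> b \<in> A \<and> a \<noteq> b})"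
  have fin: "finite D" unfolding D_def
    by (intro finite.insertI finite_imageI finite_subset[OF _ finite_cartesian_product[OF assms assms]]) auto
  have pos: "d > 0" if "d \<in> D" for d
  proof -
    have "0 < (\<Sum>x\<in>UNIV. \<bar>a x - b x\<bar>)" if ab: "a \<noteq> b" for a b :: "'x \<Rightarrow> real"
    proof -
      obtain x where "a x \<noteq> b x" using ab by (auto simp: fun_eq_iff)
      then show ?thesis by (intro sum_pos2[of _ x]) auto
    qed
    with that show ?thesis by (auto simp: D_def)
  qed
  have "Min D \<in> D" using fin by (intro Min_in) (auto simp: D_def)
  then have "Min D > 0" by (rule pos)
  moreover have "Min D \<le> 2" using fin by (intro Min_le) (auto simp: D_def)
  moreover have "Min D \<le> (\<Sum>x\<in>UNIV. \<bar>a x - b x\<bar>)" if "a \<in> A" "b \<in> A" "a \<noteq> b" for a b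
    using fin that by (intro Min_le) (auto simp: D_def)
  ultimately show ?thesis by (intro exI[of _ "Min D / 2"]) auto
qed

section \<open>Source, channel and class labels\<close>

locale source_channel =
  fixes p :: "'x::finite \<Rightarrow> 'y::finite \<Rightarrow> real"
    and q :: "'x \<Rightarrow> 'y \<Rightarrow> 'z::finite \<Rightarrow> real"
  assumes p_pos: "p x y > 0"
    and p_sum: "(\<Sum>x\<in>UNIV. \<Sum>y\<in>UNIV. p x y) = 1"
    and q_nonneg: "q x y z \<ge> 0"
    and q_sum: "(\<Sum>z\<in>UNIV. q x y z) = 1"
begin

lemma p_nonneg: "p x y \<ge> 0"
  using p_pos[of x y] by simp

lemma p_sum': "(\<Sum>y\<in>UNIV. \<Sum>x\<in>UNIV. p x y) = 1"
  using p_sum by (subst sum.swap)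

lemma p_le_1: "p x y \<le> 1"
proof -
  have "p x y \<le> (\<Sum>y\<in>UNIV. p x y)" by (intro member_le_sum) (auto simp: p_nonneg)
  also have "\<dots> \<le> (\<Sum>x\<in>UNIV. \<Sum>y\<in>UNIV. p x y)"
    by (intro member_le_sum[of x UNIV "\<lambda>x. \<Sum>y\<in>UNIV. p x y"]) (auto intro!: sum_nonneg p_nonneg)
  finally show ?thesis by (simp add: p_sum)
qed

definition margin :: "'y \<Rightarrow> 'z \<Rightarrow> real" where "margin y z = (\<Sum>x\<in>UNIV. p x y * q x y z)"

lemma margin_nonneg: "margin y z \<ge> 0"
  unfolding margin_def by (intro sum_nonneg mult_nonneg_nonneg p_nonneg q_nonneg)

lemma p_lower_bound: "\<exists>c>0. \<forall>x y. c \<le> p x y"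
proof -
  have "Min (range (\<lambda>(x, y). p x y)) \<in> range (\<lambda>(x, y). p x y)" by (intro Min_in) auto
  then have "Min (range (\<lambda>(x, y). p x y)) > 0" by (auto simp: p_pos)
  moreover have "Min (range (\<lambda>(x, y). p x y)) \<le> p x y" for x y
    by (intro Min_le) (auto intro: image_eqI[of _ _ "(x, y)"])
  ultimately show ?thesis by blast
qed

lemma colsum_pos: "z \<in> Zsupp q y \<Longrightarrow> (\<Sum>x\<in>UNIV. q x y z) > 0"
  by (auto simp: Zsupp_def q_nonneg intro: sum_pos2)

lemma not_in_Zsupp: "z \<notin> Zsupp q y \<Longrightarrow> q x y z = 0"
  using q_nonneg[of x y z] by (auto simp: Zsupp_def not_less intro: antisym)

lemma col_outside: "z \<notin> Zsupp q y \<Longrightarrow> col q y z = (\<lambda>x. 0)"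
  by (simp add: col_def not_in_Zsupp)

lemma col_nonneg: "col q y z x \<ge> 0"
  by (simp add: col_def q_nonneg sum_nonneg)

lemma col_sum: "z \<in> Zsupp q y \<Longrightarrow> (\<Sum>x\<in>UNIV. col q y z x) = 1"
  using colsum_pos[of z y] by (simp add: col_def sum_divide_distrib[symmetric])

lemma q_eq_col: "q x y z = col q y z x * (\<Sum>x\<in>UNIV. q x y z)"
  using colsum_pos[of z y] by (cases "z \<in> Zsupp q y") (auto simp: col_def not_in_Zsupp)

lemma col_cases: "col q y z \<in> insert (\<lambda>x. 0) (cols q)"
  by (cases "z \<in> Zsupp q y") (auto simp: col_outside cols_def)

lemma Zsupp_nonempty: "\<exists>z. q x y z > 0"
proof (rule ccontr)
  assume "\<nexists>z. q x y z > 0"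
  then have "(\<Sum>z\<in>UNIV. q x y z) \<le> 0" by (intro sum_nonpos) (auto simp: not_less)
  then show False by (simp add: q_sum)
qed

lemma cols_nonempty: "cols q \<noteq> {}"
  using Zsupp_nonempty by (fastforce simp: cols_def Zsupp_def)

end

text \<open>A single coordinate of a code: \<open>v u x\<close> and \<open>r u y z\<close> stand for \<open>p(u|x)\<close> and \<open>p(z|u,y)\<close>, so that
  \<open>U - X - Y\<close> and \<open>Z - (U,Y) - X\<close> hold by construction; \<open>kl\<close> is then \<open>I(U;X|Y,Z)\<close> in nats.\<close>

locale test_channel = source_channel p q
  for p :: "'x::finite \<Rightarrow> 'y::finite \<Rightarrow> real" and q :: "'x \<Rightarrow> 'y \<Rightarrow> 'z::finite \<Rightarrow> real" +
  fixes U :: "'u set" and v :: "'u \<Rightarrow> 'x \<Rightarrow> real" and r :: "'u \<Rightarrow> 'y \<Rightarrow> 'z \<Rightarrow> real"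
  assumes v_nonneg: "u \<in> U \<Longrightarrow> v u x \<ge> 0"
    and r_nonneg: "u \<in> U \<Longrightarrow> r u y z \<ge> 0"
    and v_sum: "(\<Sum>u\<in>U. v u x) = 1"
    and r_sum: "u \<in> U \<Longrightarrow> (\<Sum>z\<in>UNIV. r u y z) = 1"
begin

text \<open>Up to normalisation the law of U under a uniform \<open>x\<close>: the scale at which
  \<open>v u\<close> is compared with a column. It bounds \<open>t u y\<close>, the probability of
  \<open>(u, y)\<close>, for every \<open>y\<close>.\<close>

definition s :: "'u \<Rightarrow> real" where "s u = (\<Sum>x\<in>UNIV. v u x)"

definition t :: "'u \<Rightarrow> 'y \<Rightarrow> real" where "t u y = (\<Sum>x\<in>UNIV. p x y * v u x)"

definition P3 :: "'x \<Rightarrow> 'y \<Rightarrow> 'z \<Rightarrow> real" where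
  "P3 x y z = (\<Sum>u\<in>U. p x y * v u x * r u y z)"

definition P2 :: "'y \<Rightarrow> 'z \<Rightarrow> real" where "P2 y z = (\<Sum>x\<in>UNIV. P3 x y z)"

text \<open>Written as H(X|Y,Z) - H(X|U,Y), since \<open>Z\<close> tells nothing more about
  \<open>X\<close> once \<open>(U,Y)\<close> is known. The first sum is thus free of
  \<open>z\<close> and matches \<open>letter_posterior\<close>.\<close>

definition kl :: real where
  "kl = (\<Sum>y\<in>UNIV. \<Sum>u\<in>U. \<Sum>x\<in>UNIV. p x y * v u x * ln (p x y * v u x / t u y))
      - (\<Sum>y\<in>UNIV. \<Sum>z\<in>UNIV. \<Sum>x\<in>UNIV. P3 x y z * ln (P3 x y z))
      + (\<Sum>y\<in>UNIV. \<Sum>z\<in>UNIV. P2 y z * ln (P2 y z))"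

text \<open>The full L1 distance, without the factor 1/2 of \<open>tv_dist\<close>.\<close>

definition tv :: real where
  "tv = (\<Sum>y\<in>UNIV. \<Sum>z\<in>UNIV. \<Sum>x\<in>UNIV. \<bar>P3 x y z - p x y * q x y z\<bar>)"

text \<open>Weighted by \<open>s u\<close> instead of the true \<open>t u y\<close>, so that the
  same bound applies to \<open>u\<close> at every \<open>x\<close> and \<open>y\<close>; full
  support makes the two weights comparable. Being a sum over all \<open>y\<close>, it is not itself
  a probability.\<close>

definition err :: "('u \<Rightarrow> 'x \<Rightarrow> real) \<Rightarrow> real" where
  "err f = (\<Sum>y\<in>UNIV. \<Sum>z\<in>UNIV. \<Sum>u\<in>U. s u * r u y z * of_bool (col q y z \<noteq> f u))"

text \<open>How far the joint law of \<open>(u, x, y, z)\<close> is from the one in which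
  \<open>x\<close> is redrawn from the target posterior given \<open>(y, z)\<close>.\<close>

abbreviation dev :: "'u \<Rightarrow> 'x \<Rightarrow> 'y \<Rightarrow> 'z \<Rightarrow> real" where
  "dev u x y z \<equiv> \<bar>p x y * v u x * r u y z - t u y * r u y z * (p x y * q x y z / margin y z)\<bar>"

lemma s_nonneg: "u \<in> U \<Longrightarrow> s u \<ge> 0"
  unfolding s_def by (intro sum_nonneg v_nonneg)

lemma t_nonneg: "u \<in> U \<Longrightarrow> t u y \<ge> 0"
  unfolding t_def by (intro sum_nonneg mult_nonneg_nonneg p_nonneg v_nonneg)

lemma t_le_s: "u \<in> U \<Longrightarrow> t u y \<le> s u"
  unfolding t_def s_def by (intro sum_mono mult_left_le_one_le p_nonneg p_le_1 v_nonneg)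

lemma v_le_s: "u \<in> U \<Longrightarrow> v u x \<le> s u"
  unfolding s_def by (intro member_le_sum v_nonneg) auto

lemma P3_nonneg: "P3 x y z \<ge> 0"
  unfolding P3_def by (intro sum_nonneg mult_nonneg_nonneg p_nonneg v_nonneg r_nonneg)

lemma P2_nonneg: "P2 y z \<ge> 0"
  unfolding P2_def by (intro sum_nonneg P3_nonneg)

lemma P3_le_P2: "P3 x y z \<le> P2 y z"
  unfolding P2_def by (intro member_le_sum P3_nonneg) auto

lemma P2_eq: "P2 y z = (\<Sum>u\<in>U. t u y * r u y z)"
  unfolding P2_def P3_def t_def by (subst sum.swap) (simp add: sum_distrib_right)

lemma sum_P3: "(\<Sum>z\<in>UNIV. P3 x y z) = p x y"
proof -
  have "(\<Sum>z\<in>UNIV. P3 x y z) = (\<Sum>u\<in>U. p x y * v u x * (\<Sum>z\<in>UNIV. r u y z))"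
    unfolding P3_def by (subst sum.swap) (simp add: sum_distrib_left)
  also have "\<dots> = p x y * (\<Sum>u\<in>U. v u x)" by (simp add: r_sum sum_distrib_left)
  finally show ?thesis by (simp add: v_sum)
qed

lemma sum_P2: "(\<Sum>y\<in>UNIV. \<Sum>z\<in>UNIV. P2 y z) = 1"
proof -
  have "(\<Sum>z\<in>UNIV. P2 y z) = (\<Sum>x\<in>UNIV. p x y)" for y
    unfolding P2_def by (subst sum.swap) (simp add: sum_P3)
  then show ?thesis by (simp add: p_sum')
qed

lemma sum_joint: "(\<Sum>u\<in>U. \<Sum>x\<in>UNIV. p x y * v u x * r u y z) = P2 y z"
  unfolding P2_def P3_def by (rule sum.swap)

text \<open>Both families are laws of \<open>(u, x, y, z)\<close>: the true one, and the one in
  which \<open>x\<close> depends on \<open>u\<close> only through \<open>(y, z)\<close>. Their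
  divergence is \<open>kl\<close>; in the sum of \<open>abs_diff_le_kl\<close> the two masses 1
  cancel in the first term and add up to \<open>l\<close> in the second.\<close>

lemma kl_bound:
  assumes "l > 0"
  shows "(\<Sum>y\<in>UNIV. \<Sum>z\<in>UNIV. \<Sum>u\<in>U. \<Sum>x\<in>UNIV.
      \<bar>p x y * v u x * r u y z - t u y * r u y z * (P3 x y z / P2 y z)\<bar>) \<le> kl / l + l"
proof -
  let ?S = "\<lambda>F. \<Sum>y\<in>UNIV. \<Sum>z\<in>UNIV. \<Sum>u\<in>U. \<Sum>x\<in>UNIV. F y z u x"
  let ?k = "\<lambda>y u x. p x y * v u x * ln (p x y * v u x / t u y)"
  define P where "P y z u x = p x y * v u x * r u y z" for y z u x
  define S where "S y z u x = t u y * r u y z * (P3 x y z / P2 y z)" for y z u x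
  have P_nonneg: "P y z u x \<ge> 0" if "u \<in> U" for y z u x
    using that by (simp add: P_def p_nonneg v_nonneg r_nonneg)
  have S_nonneg: "S y z u x \<ge> 0" if "u \<in> U" for y z u x
    using that by (simp add: S_def t_nonneg r_nonneg P3_nonneg P2_nonneg)
  have P_le: "P y z u x \<le> P3 x y z" if "u \<in> U" "finite U" for y z u x
    unfolding P3_def P_def using that by (intro member_le_sum) (auto simp: p_nonneg v_nonneg r_nonneg)
  \<comment> \<open>Over an infinite \<open>U\<close> the sum in \<open>v_sum\<close> would be
    0.\<close>
  have finU: "finite U" using v_sum by (metis sum.infinite zero_neq_one)
  have pos: "v u x > 0" "r u y z > 0" "t u y > 0" "P3 x y z > 0" "P2 y z > 0"
    if "u \<in> U" "P y z u x > 0" for y z u x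
  proof -
    show v: "v u x > 0" and "r u y z > 0"
      using that p_pos[of x y] v_nonneg[OF that(1), of x] r_nonneg[OF that(1), of y z]
      by (auto simp: P_def zero_less_mult_iff)
    have "0 < p x y * v u x" using v p_pos by simp
    also have "\<dots> \<le> t u y" unfolding t_def
      using that by (intro member_le_sum) (auto simp: p_nonneg v_nonneg)
    finally show "t u y > 0" .
    show "P3 x y z > 0" using P_le[OF that(1) finU, of y z x] that(2) by linarith
    then show "P2 y z > 0" using P3_le_P2[of x y z] by linarith
  qed
  \<comment> \<open>The factor \<open>r u y z\<close> cancels in the likelihood ratio, so its
    logarithm splits into the three entropy terms of \<open>kl\<close>.\<close>
  have log_split: "P y z u x * ln (P y z u x / S y z u x)
      = r u y z * (?k y u x)
        - P y z u x * ln (P3 x y z) + P y z u x * ln (P2 y z)" if "u \<in> U" for y z u x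
  proof (cases "P y z u x > 0")
    case True
    note pos = pos[OF that True]
    have "P y z u x / S y z u x = (p x y * v u x / t u y) / (P3 x y z / P2 y z)"
      using pos p_pos[of x y] by (simp add: P_def S_def)
    also have "ln \<dots> = ln (p x y * v u x / t u y) - ln (P3 x y z / P2 y z)"
      using pos p_pos[of x y] by (intro ln_divide_pos) auto
    also have "ln (P3 x y z / P2 y z) = ln (P3 x y z) - ln (P2 y z)"
      using pos by (intro ln_divide_pos) auto
    finally have "ln (P y z u x / S y z u x) = ln (p x y * v u x / t u y) - (ln (P3 x y z) - ln (P2 y z))" .
    then have "P y z u x * ln (P y z u x / S y z u x)
       = P y z u x * (ln (p x y * v u x / t u y) - (ln (P3 x y z) - ln (P2 y z)))" by (rule arg_cong)
    then show ?thesis by (simp add: P_def algebra_simps del: times_divide_eq_right times_divide_eq_left)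
  next
    case False
    then have "P y z u x = 0" using P_nonneg[OF that, of y z x] by linarith
    then show ?thesis using p_pos[of x y] by (auto simp: P_def)
  qed
  have "\<bar>P y z u x - S y z u x\<bar>
      \<le> (r u y z * (?k y u x)
        - P y z u x * ln (P3 x y z) + P y z u x * ln (P2 y z) - P y z u x + S y z u x) / l
        + l * (P y z u x + S y z u x) / 2" if "u \<in> U" for y z u x
    unfolding log_split[OF that, symmetric] using that assms pos[OF that, of y z x]
    by (intro abs_diff_le_kl P_nonneg S_nonneg) (auto simp: S_def)
  then have "?S (\<lambda>y z u x. \<bar>P y z u x - S y z u x\<bar>)
     \<le> (\<Sum>y\<in>UNIV. \<Sum>z\<in>UNIV. \<Sum>u\<in>U. \<Sum>x\<in>UNIV.
        (r u y z * (?k y u x)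
        - P y z u x * ln (P3 x y z) + P y z u x * ln (P2 y z) - P y z u x + S y z u x) / l
        + l * (P y z u x + S y z u x) / 2)"
    by (intro sum_mono)
  also have "\<dots> = (?S (\<lambda>y z u x. r u y z * (?k y u x))
      - ?S (\<lambda>y z u x. P y z u x * ln (P3 x y z))
      + ?S (\<lambda>y z u x. P y z u x * ln (P2 y z))
      - ?S (\<lambda>y z u x. P y z u x)
      + ?S (\<lambda>y z u x. S y z u x)) / l
      + l * (?S (\<lambda>y z u x. P y z u x)
      + ?S (\<lambda>y z u x. S y z u x)) / 2"
    unfolding sum.distrib sum_subtractf sum_divide_distrib[symmetric] sum_distrib_left[symmetric] ..
  also have "?S (\<lambda>y z u x. P y z u x) = 1"
    unfolding P_def by (simp add: sum_joint sum_P2)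
  also have "?S (\<lambda>y z u x. S y z u x) = 1"
  proof -
    have "(\<Sum>u\<in>U. \<Sum>x\<in>UNIV. S y z u x) = P2 y z" for y z
    proof -
      have "(\<Sum>u\<in>U. \<Sum>x\<in>UNIV. S y z u x) = (\<Sum>u\<in>U. t u y * r u y z) * (\<Sum>x\<in>UNIV. P3 x y z / P2 y z)"
        unfolding S_def by (simp only: sum_product)
      also have "\<dots> = P2 y z * (P2 y z / P2 y z)"
        unfolding P2_eq[symmetric] sum_divide_distrib[symmetric] P2_def[symmetric] ..
      finally show ?thesis by simp
    qed
    then show ?thesis by (simp add: sum_P2)
  qed
  also have "?S (\<lambda>y z u x. r u y z * (?k y u x))
      = (\<Sum>y\<in>UNIV. \<Sum>u\<in>U. \<Sum>x\<in>UNIV. ?k y u x)"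
  proof (rule sum.cong[OF refl])
    fix y
    show "(\<Sum>z\<in>UNIV. \<Sum>u\<in>U. \<Sum>x\<in>UNIV. r u y z * (?k y u x))
      = (\<Sum>u\<in>U. \<Sum>x\<in>UNIV. ?k y u x)"
      by (subst sum.swap) (simp add: sum_product[symmetric] r_sum del: times_divide_eq_right)
  qed
  also have "?S (\<lambda>y z u x. P y z u x * ln (P3 x y z))
      = (\<Sum>y\<in>UNIV. \<Sum>z\<in>UNIV. \<Sum>x\<in>UNIV. P3 x y z * ln (P3 x y z))"
    unfolding P_def P3_def sum_distrib_right by (intro sum.cong refl sum.swap)
  also have "?S (\<lambda>y z u x. P y z u x * ln (P2 y z))
      = (\<Sum>y\<in>UNIV. \<Sum>z\<in>UNIV. P2 y z * ln (P2 y z))"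
    unfolding P_def sum_joint[symmetric] sum_distrib_right ..
  finally show ?thesis unfolding P_def S_def kl_def by simp
qed

text \<open>Replaces the posterior of the actual output by that of the target. Summed over
  \<open>u\<close> the weight is \<open>P2 y z\<close>; numerator and normaliser each cost one
  \<open>tv\<close>, hence the factor 2.\<close>

lemma posterior_deviation:
  assumes "l > 0"
  shows "(\<Sum>y\<in>UNIV. \<Sum>z\<in>UNIV. \<Sum>u\<in>U. \<Sum>x\<in>UNIV.
      dev u x y z) \<le> kl / l + l + 2 * tv"
proof -
  let ?B = "\<lambda>y z u x. \<bar>t u y * r u y z * (P3 x y z / P2 y z) - t u y * r u y z * (p x y * q x y z / margin y z)\<bar>"
  have "(\<Sum>u\<in>U. \<Sum>x\<in>UNIV. ?B y z u x)
      \<le> 2 * (\<Sum>x\<in>UNIV. \<bar>P3 x y z - p x y * q x y z\<bar>)" (is "?L \<le> _") for y z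
  proof -
    have "?L = (\<Sum>u\<in>U. \<Sum>x\<in>UNIV. (t u y * r u y z) * \<bar>P3 x y z / P2 y z - p x y * q x y z / margin y z\<bar>)"
      by (intro sum.cong refl) (simp only: right_diff_distrib[symmetric] abs_mult
          abs_of_nonneg[OF t_nonneg] abs_of_nonneg[OF r_nonneg])
    also have "\<dots> = P2 y z * (\<Sum>x\<in>UNIV. \<bar>P3 x y z / P2 y z - p x y * q x y z / margin y z\<bar>)"
      by (simp only: sum_product[symmetric] P2_eq[symmetric])
    also have "\<dots> = (\<Sum>x\<in>UNIV. \<bar>P2 y z * (P3 x y z / P2 y z - p x y * q x y z / margin y z)\<bar>)"
      by (simp add: sum_distrib_left abs_mult P2_nonneg)
    also have "\<dots> \<le> (\<Sum>x\<in>UNIV. \<bar>P3 x y z - p x y * q x y z\<bar> + p x y * q x y z / margin y z * \<bar>margin y z - P2 y z\<bar>)"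
    proof (rule sum_mono)
      fix x
      have nn: "p x y * q x y z / margin y z \<ge> 0"
        by (simp add: p_nonneg q_nonneg margin_def sum_nonneg)
      have "P2 y z * (P3 x y z / P2 y z) = P3 x y z"
        using P3_le_P2[of x y z] P3_nonneg[of x y z] by auto
      moreover have "p x y * q x y z / margin y z * margin y z = p x y * q x y z"
      proof -
        have "p x y * q x y z \<le> margin y z" unfolding margin_def
          by (intro member_le_sum) (auto simp: p_nonneg q_nonneg)
        moreover have "p x y * q x y z \<ge> 0" by (simp add: p_nonneg q_nonneg)
        ultimately show ?thesis by (cases "margin y z = 0") auto
      qed
      moreover define e where "e = p x y * q x y z / margin y z"
      ultimately have "P2 y z * (P3 x y z / P2 y z - p x y * q x y z / margin y z)
        = (P3 x y z - p x y * q x y z) + p x y * q x y z / margin y z * (margin y z - P2 y z)"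
        unfolding right_diff_distrib e_def[symmetric] by (simp only: mult.commute[of e])
      then have "\<bar>P2 y z * (P3 x y z / P2 y z - p x y * q x y z / margin y z)\<bar>
        \<le> \<bar>P3 x y z - p x y * q x y z\<bar> + \<bar>p x y * q x y z / margin y z * (margin y z - P2 y z)\<bar>"
        using abs_triangle_ineq by metis
      then show "\<bar>P2 y z * (P3 x y z / P2 y z - p x y * q x y z / margin y z)\<bar>
        \<le> \<bar>P3 x y z - p x y * q x y z\<bar> + p x y * q x y z / margin y z * \<bar>margin y z - P2 y z\<bar>"
        using nn by (simp only: abs_mult abs_of_nonneg)
    qed
    also have "\<dots> = (\<Sum>x\<in>UNIV. \<bar>P3 x y z - p x y * q x y z\<bar>) + margin y z / margin y z * \<bar>margin y z - P2 y z\<bar>"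
      by (simp add: sum.distrib sum_distrib_right[symmetric] sum_divide_distrib[symmetric] margin_def
          del: times_divide_eq_left)
    also have "margin y z / margin y z * \<bar>margin y z - P2 y z\<bar> \<le> \<bar>margin y z - P2 y z\<bar>"
      by (cases "margin y z = 0") auto
    also have "\<bar>margin y z - P2 y z\<bar> \<le> (\<Sum>x\<in>UNIV. \<bar>P3 x y z - p x y * q x y z\<bar>)"
      unfolding margin_def P2_def sum_subtractf[symmetric]
      by (rule order.trans[OF sum_abs]) (simp add: abs_minus_commute)
    finally show ?thesis by simp
  qed
  then have "(\<Sum>y\<in>UNIV. \<Sum>z\<in>UNIV. \<Sum>u\<in>U. \<Sum>x\<in>UNIV. ?B y z u x)
      \<le> (\<Sum>y\<in>UNIV. \<Sum>z\<in>UNIV. 2 * (\<Sum>x\<in>UNIV. \<bar>P3 x y z - p x y * q x y z\<bar>))"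
    by (intro sum_mono)
  also have "\<dots> = 2 * tv" by (simp add: tv_def sum_distrib_left)
  finally have 2: "(\<Sum>y\<in>UNIV. \<Sum>z\<in>UNIV. \<Sum>u\<in>U. \<Sum>x\<in>UNIV. ?B y z u x) \<le> 2 * tv" .
  have "(\<Sum>y\<in>UNIV. \<Sum>z\<in>UNIV. \<Sum>u\<in>U. \<Sum>x\<in>UNIV.
      dev u x y z)
    \<le> (\<Sum>y\<in>UNIV. \<Sum>z\<in>UNIV. \<Sum>u\<in>U. \<Sum>x\<in>UNIV.
      \<bar>p x y * v u x * r u y z - t u y * r u y z * (P3 x y z / P2 y z)\<bar>
      + ?B y z u x)"
    by (intro sum_mono order.trans[OF _ abs_triangle_ineq]) simp
  also have "\<dots> \<le> kl / l + l + 2 * tv"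
    unfolding sum.distrib using kl_bound[OF assms] 2 by linarith
  finally show ?thesis .
qed

text \<open>In \<open>dev\<close> the factor p x y \<ge> c divides out and leaves \<open>v u\<close>
  against a multiple of the column. Total mass settles which multiple: \<open>v u\<close> has mass
  \<open>s u\<close> and the column mass 1, so passing to the multiple \<open>s u\<close> at most
  doubles the deviation.\<close>

lemma col_deviation:
  assumes c: "c > 0" "\<And>x y. c \<le> p x y" and u: "u \<in> U"
  shows "c * (r u y z * (\<Sum>x\<in>UNIV. \<bar>v u x - s u * col q y z x\<bar>))
    \<le> 2 * (\<Sum>x\<in>UNIV. dev u x y z)"
proof -
  \<comment> \<open>The scale at which the normalised column becomes the target posterior weighted
    by \<open>t u y\<close>, with \<open>p x y\<close> divided out.\<close>
  define \<theta> where "\<theta> = t u y * (\<Sum>x\<in>UNIV. q x y z) / margin y z"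
  have "(\<Sum>x\<in>UNIV. \<bar>v u x - s u * col q y z x\<bar>)
      \<le> (\<Sum>x\<in>UNIV. \<bar>v u x - \<theta> * col q y z x\<bar> + \<bar>\<theta> - s u\<bar> * col q y z x)"
  proof (rule sum_mono)
    fix x
    have "v u x - s u * col q y z x = (v u x - \<theta> * col q y z x) + (\<theta> - s u) * col q y z x"
      by (simp add: algebra_simps)
    also have "\<bar>\<dots>\<bar> \<le> \<bar>v u x - \<theta> * col q y z x\<bar> + \<bar>(\<theta> - s u) * col q y z x\<bar>"
      by (rule abs_triangle_ineq)
    finally show "\<bar>v u x - s u * col q y z x\<bar> \<le> \<bar>v u x - \<theta> * col q y z x\<bar> + \<bar>\<theta> - s u\<bar> * col q y z x"
      by (simp add: abs_mult col_nonneg)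
  qed
  also have "\<dots> = (\<Sum>x\<in>UNIV. \<bar>v u x - \<theta> * col q y z x\<bar>) + \<bar>\<theta> - s u\<bar> * (\<Sum>x\<in>UNIV. col q y z x)"
    by (simp add: sum.distrib sum_distrib_left)
  also have "\<bar>\<theta> - s u\<bar> * (\<Sum>x\<in>UNIV. col q y z x) \<le> (\<Sum>x\<in>UNIV. \<bar>v u x - \<theta> * col q y z x\<bar>)"
  proof (cases "z \<in> Zsupp q y")
    case True
    then have "\<bar>\<theta> - s u\<bar> * (\<Sum>x\<in>UNIV. col q y z x) = \<bar>s u - \<theta> * (\<Sum>x\<in>UNIV. col q y z x)\<bar>"
      by (simp add: col_sum abs_minus_commute)
    also have "\<dots> = \<bar>\<Sum>x\<in>UNIV. v u x - \<theta> * col q y z x\<bar>"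
      by (simp add: s_def sum_subtractf sum_distrib_left)
    also have "\<dots> \<le> (\<Sum>x\<in>UNIV. \<bar>v u x - \<theta> * col q y z x\<bar>)" by (rule sum_abs)
    finally show ?thesis .
  next
    case False
    then show ?thesis by (simp add: col_outside sum_nonneg)
  qed
  finally have "(\<Sum>x\<in>UNIV. \<bar>v u x - s u * col q y z x\<bar>) \<le> 2 * (\<Sum>x\<in>UNIV. \<bar>v u x - \<theta> * col q y z x\<bar>)"
    by simp
  then have "c * (r u y z * (\<Sum>x\<in>UNIV. \<bar>v u x - s u * col q y z x\<bar>))
    \<le> c * (r u y z * (2 * (\<Sum>x\<in>UNIV. \<bar>v u x - \<theta> * col q y z x\<bar>)))"
    using c u by (intro mult_left_mono) (auto simp: r_nonneg)
  also have "\<dots> = 2 * (\<Sum>x\<in>UNIV. c * (r u y z * \<bar>v u x - \<theta> * col q y z x\<bar>))"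
    by (simp add: sum_distrib_left mult_ac)
  also have "\<dots> \<le> 2 * (\<Sum>x\<in>UNIV. p x y * (r u y z * \<bar>v u x - \<theta> * col q y z x\<bar>))"
    using c u by (intro mult_left_mono sum_mono mult_right_mono) (auto simp: r_nonneg)
  also have "(\<Sum>x\<in>UNIV. p x y * (r u y z * \<bar>v u x - \<theta> * col q y z x\<bar>))
    = (\<Sum>x\<in>UNIV. dev u x y z)"
  proof (rule sum.cong[OF refl])
    fix x
    have "\<theta> * col q y z x = t u y * q x y z / margin y z"
      unfolding \<theta>_def by (subst (2) q_eq_col) simp
    then have "p x y * v u x * r u y z - t u y * r u y z * (p x y * q x y z / margin y z)
       = p x y * (r u y z * (v u x - \<theta> * col q y z x))"
      by (simp add: algebra_simps)
    then show "p x y * (r u y z * \<bar>v u x - \<theta> * col q y z x\<bar>)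
      = dev u x y z"
      using u by (simp only: abs_mult abs_of_nonneg[OF p_nonneg] abs_of_nonneg[OF r_nonneg])
  qed
  finally show ?thesis .
qed

text \<open>If \<open>I(U;X|Y,Z)\<close> is small, the likelihood vector \<open>v u\<close> is nearly proportional to the column
  of \<open>(Y,Z)\<close>; since there are only finitely many columns, the nearest one identifies the class.\<close>

lemma exists_estimator:
  assumes c: "c > 0" "\<And>x y. c \<le> p x y"
    and \<rho>: "\<rho> > 0" "\<rho> \<le> 1" "\<And>a b. a \<in> cols q \<Longrightarrow> b \<in> cols q \<Longrightarrow> a \<noteq> b \<Longrightarrow> 2 * \<rho> \<le> (\<Sum>x\<in>UNIV. \<bar>a x - b x\<bar>)"
  shows "\<exists>f. \<forall>l>0. err f \<le> 2 / (c * \<rho>) * (kl / l + l + 2 * tv)"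
proof -
  define d where "d u a = (\<Sum>x\<in>UNIV. \<bar>v u x - s u * a x\<bar>)" for u a
  define f where "f u = arg_min_on (d u) (cols q)" for u
  have f_in: "f u \<in> cols q" for u
    unfolding f_def using arg_min_if_finite(1)[OF finite_cols cols_nonempty] .
  have f_min: "d u (f u) \<le> d u a" if "a \<in> cols q" for u a
    unfolding f_def using arg_min_least[OF finite_cols cols_nonempty that] .
  \<comment> \<open>Columns in \<open>cols q\<close> are 2 \<rho> apart and \<open>f u\<close> is
    the nearest one, so any other is at least \<rho> times \<open>s u\<close> away from
    \<open>v u\<close>. The zero label is at distance exactly \<open>s u\<close>; there \<rho> \<le>
    1 enters.\<close>
  have far: "\<rho> * s u * of_bool (col q y z \<noteq> f u) \<le> d u (col q y z)" if u: "u \<in> U" for u y z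
  proof (cases "col q y z = f u")
    case False
    show ?thesis
    proof (cases "col q y z \<in> cols q")
      case True
      have "s u * (2 * \<rho>) \<le> s u * (\<Sum>x\<in>UNIV. \<bar>col q y z x - f u x\<bar>)"
        using \<rho>(3)[OF True f_in False] s_nonneg[OF u] by (rule mult_left_mono)
      also have "\<dots> = (\<Sum>x\<in>UNIV. \<bar>s u * col q y z x - s u * f u x\<bar>)"
        using s_nonneg[OF u] by (simp add: sum_distrib_left right_diff_distrib[symmetric] abs_mult)
      also have "\<dots> \<le> (\<Sum>x\<in>UNIV. \<bar>v u x - s u * col q y z x\<bar> + \<bar>v u x - s u * f u x\<bar>)"
        by (intro sum_mono order.trans[OF _ abs_triangle_ineq4]) (simp add: abs_minus_commute)
      also have "\<dots> = d u (col q y z) + d u (f u)" by (simp add: d_def sum.distrib)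
      also have "\<dots> \<le> 2 * d u (col q y z)" using f_min[OF True] by simp
      finally show ?thesis using False by (simp add: mult_ac)
    next
      case outside: False
      then have "col q y z = (\<lambda>x. 0)" using col_cases[of y z] by auto
      then have "d u (col q y z) = s u" unfolding d_def s_def using u by (simp add: v_nonneg)
      then show ?thesis using False \<rho> s_nonneg[OF u] by (simp add: mult_left_le_one_le)
    qed
  qed (simp add: d_def sum_nonneg)
  have "err f \<le> 2 / (c * \<rho>) * (kl / l + l + 2 * tv)" if "l > 0" for l
  proof -
    have "c * \<rho> * err f = (\<Sum>y\<in>UNIV. \<Sum>z\<in>UNIV. \<Sum>u\<in>U. c * (r u y z * (\<rho> * s u * of_bool (col q y z \<noteq> f u))))"
      unfolding err_def by (simp only: sum_distrib_left mult_ac)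
    also have "\<dots> \<le> (\<Sum>y\<in>UNIV. \<Sum>z\<in>UNIV. \<Sum>u\<in>U.
       2 * (\<Sum>x\<in>UNIV. dev u x y z))"
    proof (intro sum_mono)
      fix y z u assume u: "u \<in> U"
      have "c * (r u y z * (\<rho> * s u * of_bool (col q y z \<noteq> f u))) \<le> c * (r u y z * d u (col q y z))"
        using c r_nonneg[OF u] far[OF u] by (intro mult_left_mono) auto
      also have "\<dots> \<le> 2 * (\<Sum>x\<in>UNIV. dev u x y z)"
        unfolding d_def by (rule col_deviation[OF c u])
      finally show "c * (r u y z * (\<rho> * s u * of_bool (col q y z \<noteq> f u))) \<le> \<dots>" .
    qed
    also have "\<dots> \<le> 2 * (kl / l + l + 2 * tv)"
      using posterior_deviation[OF that] by (simp add: sum_distrib_left[symmetric])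
    finally show ?thesis using c \<rho> by (simp add: field_simps)
  qed
  then show ?thesis by blast
qed

text \<open>The estimated probability does not involve \<open>y\<close>, which is what
  \<open>class_prob_indep\<close> exploits. Two replacements are made: the target output by the code
  output, costing \<open>tv\<close> divided by p x y \<ge> c, and the class of the output by the
  label of \<open>u\<close>, costing \<open>err\<close> because v u x \<le> s u.\<close>

lemma class_probability:
  assumes c: "c > 0" "\<And>x y. c \<le> p x y"
  shows "\<bar>(\<Sum>z\<in>UNIV. of_bool (col q y z = j) * q x y z) - (\<Sum>u\<in>U. of_bool (f u = j) * v u x)\<bar> \<le> err f + tv / c"
proof -
  \<comment> \<open>The probability of class \<open>j\<close> given \<open>(x, y)\<close> under the
    code.\<close>
  define V where "V = (\<Sum>z\<in>UNIV. \<Sum>u\<in>U. of_bool (col q y z = j) * (v u x * r u y z))"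
  have "p x y * \<bar>(\<Sum>z\<in>UNIV. of_bool (col q y z = j) * q x y z) - V\<bar>
     = \<bar>\<Sum>z\<in>UNIV. of_bool (col q y z = j) * (p x y * q x y z - P3 x y z)\<bar>"
  proof -
    have P3: "P3 x y z = p x y * (\<Sum>u\<in>U. v u x * r u y z)" for z
      unfolding P3_def by (simp add: sum_distrib_left mult_ac)
    have "p x y * ((\<Sum>z\<in>UNIV. of_bool (col q y z = j) * q x y z) - V)
       = (\<Sum>z\<in>UNIV. p x y * (of_bool (col q y z = j) * q x y z - of_bool (col q y z = j) * (\<Sum>u\<in>U. v u x * r u y z)))"
      unfolding V_def sum_distrib_left[symmetric] sum_subtractf ..
    also have "\<dots> = (\<Sum>z\<in>UNIV. of_bool (col q y z = j) * (p x y * q x y z - P3 x y z))"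
      unfolding P3 by (intro sum.cong refl) (simp add: algebra_simps)
    finally have "\<bar>p x y * ((\<Sum>z\<in>UNIV. of_bool (col q y z = j) * q x y z) - V)\<bar>
       = \<bar>\<Sum>z\<in>UNIV. of_bool (col q y z = j) * (p x y * q x y z - P3 x y z)\<bar>" by (simp only:)
    then show ?thesis by (simp only: abs_mult abs_of_nonneg[OF p_nonneg])
  qed
  also have "\<dots> \<le> (\<Sum>z\<in>UNIV. \<bar>of_bool (col q y z = j) * (p x y * q x y z - P3 x y z)\<bar>)"
    by (rule sum_abs)
  also have "\<dots> \<le> (\<Sum>z\<in>UNIV. \<Sum>x\<in>UNIV. \<bar>P3 x y z - p x y * q x y z\<bar>)"
  proof (intro sum_mono)
    fix z
    have "\<bar>of_bool (col q y z = j) * (p x y * q x y z - P3 x y z)\<bar> \<le> \<bar>P3 x y z - p x y * q x y z\<bar>"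
      by (simp add: abs_minus_commute)
    also have "\<dots> \<le> (\<Sum>x\<in>UNIV. \<bar>P3 x y z - p x y * q x y z\<bar>)"
      by (intro member_le_sum[of x UNIV "\<lambda>x. \<bar>P3 x y z - p x y * q x y z\<bar>"]) auto
    finally show "\<bar>of_bool (col q y z = j) * (p x y * q x y z - P3 x y z)\<bar> \<le> \<dots>" .
  qed
  also have "\<dots> \<le> tv" unfolding tv_def
    by (intro member_le_sum[of y UNIV "\<lambda>y. \<Sum>z\<in>UNIV. \<Sum>x\<in>UNIV. \<bar>P3 x y z - p x y * q x y z\<bar>"])
      (auto intro!: sum_nonneg)
  finally have "p x y * \<bar>(\<Sum>z\<in>UNIV. of_bool (col q y z = j) * q x y z) - V\<bar> \<le> tv" .
  then have "c * \<bar>(\<Sum>z\<in>UNIV. of_bool (col q y z = j) * q x y z) - V\<bar> \<le> tv"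
    by (rule order.trans[OF mult_right_mono[OF c(2) abs_ge_zero]])
  then have 1: "\<bar>(\<Sum>z\<in>UNIV. of_bool (col q y z = j) * q x y z) - V\<bar> \<le> tv / c"
    using c(1) by (simp add: field_simps)
  have "(\<Sum>u\<in>U. of_bool (f u = j) * v u x) = (\<Sum>u\<in>U. of_bool (f u = j) * v u x * (\<Sum>z\<in>UNIV. r u y z))"
    by (simp add: r_sum)
  also have "\<dots> = (\<Sum>z\<in>UNIV. \<Sum>u\<in>U. of_bool (f u = j) * (v u x * r u y z))"
    unfolding sum_distrib_left by (subst sum.swap) (simp add: mult_ac)
  finally have "\<bar>V - (\<Sum>u\<in>U. of_bool (f u = j) * v u x)\<bar>
     = \<bar>\<Sum>z\<in>UNIV. \<Sum>u\<in>U. (of_bool (col q y z = j) - of_bool (f u = j)) * (v u x * r u y z)\<bar>"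
    by (simp add: V_def sum_subtractf left_diff_distrib)
  also have "\<dots> \<le> (\<Sum>z\<in>UNIV. \<Sum>u\<in>U. \<bar>(of_bool (col q y z = j) - of_bool (f u = j)) * (v u x * r u y z)\<bar>)"
    by (intro order.trans[OF sum_abs] sum_mono) simp
  also have "\<dots> \<le> (\<Sum>z\<in>UNIV. \<Sum>u\<in>U. s u * r u y z * of_bool (col q y z \<noteq> f u))"
  proof (intro sum_mono)
    fix z u assume u: "u \<in> U"
    have "v u x * r u y z \<le> s u * r u y z"
      using v_le_s[OF u] r_nonneg[OF u] by (intro mult_right_mono)
    then show "\<bar>(of_bool (col q y z = j) - of_bool (f u = j)) * (v u x * r u y z)\<bar>
      \<le> s u * r u y z * of_bool (col q y z \<noteq> f u)"
      using v_nonneg[OF u, of x] r_nonneg[OF u, of y z] s_nonneg[OF u]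
      by (auto simp: abs_mult of_bool_def)
  qed
  also have "\<dots> \<le> err f" unfolding err_def
    by (intro member_le_sum[of y UNIV "\<lambda>y. \<Sum>z\<in>UNIV. \<Sum>u\<in>U. s u * r u y z * of_bool (col q y z \<noteq> f u)"])
      (auto intro!: sum_nonneg simp: s_nonneg r_nonneg)
  finally show ?thesis using 1 by linarith
qed

end

subsection \<open>Block codes\<close>

lemma sum_seqs_triple:
  "(\<Sum>ts\<in>(seqs n :: ('a::finite \<times> 'b::finite \<times> 'c::finite) list set).
      f (map fst ts) (map (fst \<circ> snd) ts) (map (snd \<circ> snd) ts))
     = (\<Sum>xs\<in>seqs n. \<Sum>ys\<in>seqs n. \<Sum>zs\<in>seqs n. f xs ys zs)"
  using sum_seqs_pair[of "\<lambda>xs ts. f xs (map fst ts) (map snd ts)" n]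
  by (simp add: sum_seqs_pair)

lemma iid_entropy:
  fixes Q :: "'a::finite \<Rightarrow> real"
  assumes "\<And>a. Q a \<ge> 0" "(\<Sum>a\<in>UNIV. Q a) = 1"
  shows "(\<Sum>ts\<in>seqs n. (\<Prod>i<n. Q (ts ! i)) * ln (\<Prod>i<n. Q (ts ! i))) = real n * (\<Sum>a\<in>UNIV. Q a * ln (Q a))"
proof -
  have "(\<Prod>i<n. Q (ts ! i)) * ln (\<Prod>i<n. Q (ts ! i)) = (\<Prod>i<n. Q (ts ! i)) * (\<Sum>i<n. ln (Q (ts ! i)))" for ts
  proof (cases "\<forall>i<n. Q (ts ! i) > 0")
    case True
    then show ?thesis by (subst ln_prod) auto
  next
    case False
    then have "(\<Prod>i<n. Q (ts ! i)) = 0" using assms(1) by (auto simp: not_less intro: antisym)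
    then show ?thesis by simp
  qed
  then show ?thesis using expectation_sum_seqs[OF assms(2), of n "\<lambda>a. ln (Q a)"] by (simp only:)
qed

lemma entropy_continuity2:
  fixes a b :: "'s \<Rightarrow> 't \<Rightarrow> real"
  assumes "\<And>y z. y \<in> A \<Longrightarrow> z \<in> B \<Longrightarrow> a y z \<ge> 0"
    and "\<And>y z. y \<in> A \<Longrightarrow> z \<in> B \<Longrightarrow> b y z \<ge> 0"
    and "(\<Sum>y\<in>A. \<Sum>z\<in>B. a y z) = 1" "(\<Sum>y\<in>A. \<Sum>z\<in>B. b y z) = 1" and "0 < \<tau>" "\<tau> \<le> 1 / 2"
    and fin: "finite A" "finite B"
  shows "(\<Sum>y\<in>A. \<Sum>z\<in>B. b y z * ln (b y z)) \<le> (\<Sum>y\<in>A. \<Sum>z\<in>B. a y z * ln (a y z))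
           + (\<Sum>y\<in>A. \<Sum>z\<in>B. \<bar>a y z - b y z\<bar>) * ln (1 / \<tau>) + real (card A * card B) * \<tau>"
proof -
  have "b y z \<le> 1" if "y \<in> A" "z \<in> B" for y z
  proof -
    have "(case (y, z) of (y, z) \<Rightarrow> b y z) \<le> (\<Sum>(y, z)\<in>A \<times> B. b y z)"
      using that fin assms(2) by (intro member_le_sum) auto
    then show ?thesis using assms(4) by (simp add: sum.cartesian_product)
  qed
  then show ?thesis
    using entropy_continuity[of "A \<times> B" "\<lambda>(y, z). a y z" "\<lambda>(y, z). b y z" \<tau>] assms
    by (auto simp: sum.cartesian_product case_prod_unfold card_cartesian_product)
qed

lemma entropy_continuity3:
  fixes a b :: "'s \<Rightarrow> 't \<Rightarrow> 'u \<Rightarrow> real"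
  assumes "\<And>y z x. y \<in> A \<Longrightarrow> z \<in> B \<Longrightarrow> x \<in> C \<Longrightarrow> a y z x \<ge> 0"
    and "\<And>y z x. y \<in> A \<Longrightarrow> z \<in> B \<Longrightarrow> x \<in> C \<Longrightarrow> b y z x \<ge> 0"
    and "(\<Sum>y\<in>A. \<Sum>z\<in>B. \<Sum>x\<in>C. a y z x) = 1" "(\<Sum>y\<in>A. \<Sum>z\<in>B. \<Sum>x\<in>C. b y z x) = 1" and "0 < \<tau>" "\<tau> \<le> 1 / 2"
    and "finite A" "finite B" "finite C"
  shows "(\<Sum>y\<in>A. \<Sum>z\<in>B. \<Sum>x\<in>C. b y z x * ln (b y z x)) \<le> (\<Sum>y\<in>A. \<Sum>z\<in>B. \<Sum>x\<in>C. a y z x * ln (a y z x))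
           + (\<Sum>y\<in>A. \<Sum>z\<in>B. \<Sum>x\<in>C. \<bar>a y z x - b y z x\<bar>) * ln (1 / \<tau>) + real (card A * card B * card C) * \<tau>"
  using entropy_continuity2[of A "B \<times> C" "\<lambda>y (z, x). a y z x" "\<lambda>y (z, x). b y z x" \<tau>] assms
  by (auto simp: sum.cartesian_product[of _ C B] case_prod_unfold card_cartesian_product mult.assoc)

lemma src_n_nonneg: "(\<And>x y. p x y \<ge> 0) \<Longrightarrow> src_n p n xs ys \<ge> 0"
  unfolding src_n_def by (intro prod_nonneg) auto

section \<open>The i.i.d. target law and its entropies\<close>

context source_channel
begin

lemma src_pos: "src_n p n xs ys > 0"
  unfolding src_n_def by (intro prod_pos) (auto simp: p_pos)

lemma sum_src: "(\<Sum>ys\<in>seqs n. \<Sum>xs\<in>seqs n. src_n p n xs ys) = 1"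
proof -
  have "(\<Sum>xs\<in>seqs n. src_n p n xs ys) = (\<Prod>i<n. \<Sum>x\<in>UNIV. p x (ys ! i))" for ys
    unfolding src_n_def by (rule sum_prod_seqs)
  then show ?thesis using sum_prod_seqs[of "\<lambda>i y. \<Sum>x\<in>UNIV. p x y" n] p_sum' by simp
qed

lemma target_nonneg: "target_n p q n xs ys zs \<ge> 0"
  unfolding target_n_def by (intro mult_nonneg_nonneg prod_nonneg src_n_nonneg) (auto simp: p_nonneg q_nonneg)

lemma target_eq_prod: "target_n p q n xs ys zs = (\<Prod>i<n. p (xs ! i) (ys ! i) * q (xs ! i) (ys ! i) (zs ! i))"
  unfolding target_n_def src_n_def by (rule prod.distrib[symmetric])

lemma pq_sum: "(\<Sum>y\<in>UNIV. \<Sum>z\<in>UNIV. \<Sum>x\<in>UNIV. p x y * q x y z) = 1"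
proof -
  have "(\<Sum>z\<in>UNIV. \<Sum>x\<in>UNIV. p x y * q x y z) = (\<Sum>x\<in>UNIV. p x y)" for y
    by (subst sum.swap) (simp add: sum_distrib_left[symmetric] q_sum)
  then show ?thesis by (simp add: p_sum')
qed

text \<open>Turns three words into one word of triples, over which the target is an i.i.d. law. With
  \<open>xs\<close> innermost, the law of \<open>(Y,Z)\<close> arises by carrying out the inner
  sum.\<close>

lemma sum_target_fun:
  "(\<Sum>ys\<in>seqs n. \<Sum>zs\<in>seqs n. \<Sum>xs\<in>seqs n. F (target_n p q n xs ys zs) xs ys zs)
    = (\<Sum>ts\<in>seqs n. F (\<Prod>i<n. case ts ! i of (y, z, x) \<Rightarrow> p x y * q x y z)
         (map (snd \<circ> snd) ts) (map fst ts) (map (fst \<circ> snd) ts))"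
  unfolding sum_seqs_triple[of "\<lambda>ys zs xs. F (target_n p q n xs ys zs) xs ys zs", symmetric]
  by (intro sum.cong refl) (simp add: target_eq_prod length_seqs case_prod_unfold)

lemma target_sum_additive:
  "(\<Sum>ys\<in>seqs n. \<Sum>zs\<in>seqs n. \<Sum>xs\<in>seqs n. target_n p q n xs ys zs * (\<Sum>i<n. \<phi> (ys ! i) (zs ! i)))
    = real n * (\<Sum>y\<in>UNIV. \<Sum>z\<in>UNIV. \<Sum>x\<in>UNIV. p x y * q x y z * \<phi> y z)"
proof -
  define Q where "Q = (\<lambda>(y, z, x). p x y * q x y z)"
  have one: "(\<Sum>t\<in>UNIV. Q t) = 1"
    using pq_sum unfolding UNIV_Times_UNIV[symmetric] sum.cartesian_product' Q_def by simp
  have "(\<Sum>ys\<in>seqs n. \<Sum>zs\<in>seqs n. \<Sum>xs\<in>seqs n. target_n p q n xs ys zs * (\<Sum>i<n. \<phi> (ys ! i) (zs ! i)))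
    = (\<Sum>ts\<in>seqs n. (\<Prod>i<n. Q (ts ! i)) * (\<Sum>i<n. (\<lambda>(y, z, x). \<phi> y z) (ts ! i)))"
    unfolding sum_target_fun[of "\<lambda>T xs ys zs. T * (\<Sum>i<n. \<phi> (ys ! i) (zs ! i))"] Q_def
    by (intro sum.cong refl) (simp add: length_seqs case_prod_unfold)
  also have "\<dots> = real n * (\<Sum>t\<in>UNIV. Q t * (\<lambda>(y, z, x). \<phi> y z) t)"
    by (rule expectation_sum_seqs[OF one])
  also have "(\<Sum>t\<in>UNIV. Q t * (\<lambda>(y, z, x). \<phi> y z) t) = (\<Sum>y\<in>UNIV. \<Sum>z\<in>UNIV. \<Sum>x\<in>UNIV. p x y * q x y z * \<phi> y z)"
    unfolding UNIV_Times_UNIV[symmetric] sum.cartesian_product' Q_def by simp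
  finally show ?thesis .
qed

lemma sum_target: "(\<Sum>ys\<in>seqs n. \<Sum>zs\<in>seqs n. \<Sum>xs\<in>seqs n. target_n p q n xs ys zs) = 1"
proof -
  have "(\<Sum>t\<in>UNIV. case t of (y, z, x) \<Rightarrow> p x y * q x y z) = 1"
    using pq_sum unfolding UNIV_Times_UNIV[symmetric] sum.cartesian_product' by simp
  then show ?thesis
    using sum_prod_seqs[of "\<lambda>i (y, z, x). p x y * q x y z" n] by (simp add: sum_target_fun[of "\<lambda>T xs ys zs. T"])
qed

lemma sum_target_x: "(\<Sum>xs\<in>seqs n. target_n p q n xs ys zs) = (\<Prod>i<n. margin (ys ! i) (zs ! i))"
  unfolding target_eq_prod margin_def by (rule sum_prod_seqs)

lemma target_entropy:
  "(\<Sum>ys\<in>seqs n. \<Sum>zs\<in>seqs n. \<Sum>xs\<in>seqs n. target_n p q n xs ys zs * ln (target_n p q n xs ys zs))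
    = real n * (\<Sum>y\<in>UNIV. \<Sum>z\<in>UNIV. \<Sum>x\<in>UNIV. p x y * q x y z * ln (p x y * q x y z))"
proof -
  define Q where "Q = (\<lambda>(y, z, x). p x y * q x y z)"
  have one: "(\<Sum>t\<in>UNIV. Q t) = 1" and nn: "\<And>t. Q t \<ge> 0"
    using pq_sum unfolding UNIV_Times_UNIV[symmetric] sum.cartesian_product' Q_def
    by (auto simp: p_nonneg q_nonneg)
  have "(\<Sum>ys\<in>seqs n. \<Sum>zs\<in>seqs n. \<Sum>xs\<in>seqs n. target_n p q n xs ys zs * ln (target_n p q n xs ys zs))
     = real n * (\<Sum>t\<in>UNIV. Q t * ln (Q t))"
    using iid_entropy[of Q n, OF nn one] unfolding sum_target_fun[of "\<lambda>T xs ys zs. T * ln T"] Q_def .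
  then show ?thesis
    unfolding UNIV_Times_UNIV[symmetric] sum.cartesian_product' Q_def by simp
qed

lemma target_margin_entropy:
  "(\<Sum>ys\<in>seqs n. \<Sum>zs\<in>seqs n. (\<Sum>xs\<in>seqs n. target_n p q n xs ys zs) * ln (\<Sum>xs\<in>seqs n. target_n p q n xs ys zs))
    = real n * (\<Sum>y\<in>UNIV. \<Sum>z\<in>UNIV. margin y z * ln (margin y z))"
proof -
  define Q where "Q = (\<lambda>(y, z). margin y z)"
  have one: "(\<Sum>t\<in>UNIV. Q t) = 1" and nn: "\<And>t. Q t \<ge> 0"
    using pq_sum unfolding UNIV_Times_UNIV[symmetric] sum.cartesian_product' Q_def
    by (auto simp: margin_nonneg margin_def[symmetric])
  have "(\<Sum>ys\<in>seqs n. \<Sum>zs\<in>seqs n. (\<Prod>i<n. margin (ys ! i) (zs ! i)) * ln (\<Prod>i<n. margin (ys ! i) (zs ! i)))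
     = (\<Sum>ts\<in>seqs n. (\<Prod>i<n. Q (ts ! i)) * ln (\<Prod>i<n. Q (ts ! i)))"
    unfolding sum_seqs_pair[symmetric] Q_def
    by (intro sum.cong refl) (simp add: length_seqs case_prod_unfold)
  also have "\<dots> = real n * (\<Sum>t\<in>UNIV. Q t * ln (Q t))"
    by (rule iid_entropy[OF nn one])
  finally show ?thesis
    unfolding sum_target_x UNIV_Times_UNIV[symmetric] sum.cartesian_product' Q_def by simp
qed

end

text \<open>The block length is \<open>Suc N\<close>, so deleting a coordinate leaves length
  \<open>N\<close> and the coordinates are the i \<le> N. The message set is any finite set: the
  rate enters only through its cardinality.\<close>

locale block_code = source_channel p q
  for p :: "'x::finite \<Rightarrow> 'y::finite \<Rightarrow> real" and q :: "'x \<Rightarrow> 'y \<Rightarrow> 'z::finite \<Rightarrow> real" +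
  fixes N :: nat and Msg :: "nat set"
    and enc :: "'x list \<Rightarrow> nat \<Rightarrow> real" and dec :: "nat \<Rightarrow> 'y list \<Rightarrow> 'z list \<Rightarrow> real"
  assumes finite_Msg: "finite Msg"
    and enc_nonneg: "xs \<in> seqs (Suc N) \<Longrightarrow> m \<in> Msg \<Longrightarrow> enc xs m \<ge> 0"
    and enc_sum: "xs \<in> seqs (Suc N) \<Longrightarrow> (\<Sum>m\<in>Msg. enc xs m) = 1"
    and dec_nonneg: "m \<in> Msg \<Longrightarrow> ys \<in> seqs (Suc N) \<Longrightarrow> zs \<in> seqs (Suc N) \<Longrightarrow> dec m ys zs \<ge> 0"
    and dec_sum: "m \<in> Msg \<Longrightarrow> ys \<in> seqs (Suc N) \<Longrightarrow> (\<Sum>zs\<in>seqs (Suc N). dec m ys zs) = 1"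
begin

abbreviation n :: nat where "n \<equiv> Suc N"

text \<open>For coordinate \<open>i\<close> the single-letter variable \<open>U\<close> is the message together with Bob's
  other observations.\<close>

definition U :: "(nat \<times> 'y list) set" where "U = Msg \<times> seqs N"

text \<open>The probability of the message and of Bob's other letters given X_i = x. The letter of
  Bob at coordinate \<open>i\<close> does not appear, since the source is memoryless and Alice does
  not see it: this is U - X - Y.\<close>

definition v :: "nat \<Rightarrow> nat \<times> 'y list \<Rightarrow> 'x \<Rightarrow> real" where
  "v i = (\<lambda>(m, ys) x. \<Sum>xs\<in>seqs N. src_n p N xs ys * enc (ins i x xs) m)"

definition r :: "nat \<Rightarrow> nat \<times> 'y list \<Rightarrow> 'y \<Rightarrow> 'z \<Rightarrow> real" where
  "r i = (\<lambda>(m, ys) y z. \<Sum>zs\<in>seqs N. dec m (ins i y ys) (ins i z zs))"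

text \<open>The joint law of message, \<open>ys\<close> and \<open>xs\<close> before decoding;
  \<open>B\<close>, \<open>Out\<close> and \<open>Out2\<close> are the laws of (M,Y), (Y,Z,X) and
  (Y,Z) on blocks under the code.\<close>

definition A :: "nat \<Rightarrow> 'y list \<Rightarrow> 'x list \<Rightarrow> real" where
  "A m ys xs = src_n p n xs ys * enc xs m"

definition B :: "nat \<Rightarrow> 'y list \<Rightarrow> real" where
  "B m ys = (\<Sum>xs\<in>seqs n. A m ys xs)"

definition Out :: "'y list \<Rightarrow> 'z list \<Rightarrow> 'x list \<Rightarrow> real" where
  "Out ys zs xs = (\<Sum>m\<in>Msg. A m ys xs * dec m ys zs)"

definition Out2 :: "'y list \<Rightarrow> 'z list \<Rightarrow> real" where
  "Out2 ys zs = (\<Sum>xs\<in>seqs n. Out ys zs xs)"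

definition dist :: real where
  "dist = (\<Sum>ys\<in>seqs n. \<Sum>zs\<in>seqs n. \<Sum>xs\<in>seqs n. \<bar>Out ys zs xs - target_n p q n xs ys zs\<bar>)"

lemma card_Msg_ge_1: "real (card Msg) \<ge> 1"
proof -
  have "Msg \<noteq> {}" using enc_sum[of "replicate n undefined"] by (auto simp: seqs_def)
  then show ?thesis using finite_Msg by (simp add: Suc_le_eq card_gt_0_iff)
qed

lemma single_letter: "i \<le> N \<Longrightarrow> test_channel p q U (v i) (r i)"
proof
  fix u x y z
  assume i: "i \<le> N"
  show "v i u x \<ge> 0" if "u \<in> U" for u x
    using that i by (auto simp: U_def v_def intro!: sum_nonneg mult_nonneg_nonneg enc_nonneg less_imp_le[OF src_pos])
  show "r i u y z \<ge> 0" if "u \<in> U" for u y z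
    using that i by (auto simp: U_def r_def intro!: sum_nonneg dec_nonneg)
  show "(\<Sum>z\<in>UNIV. r i u y z) = 1" if "u \<in> U" for u y
    using that i by (auto simp: U_def r_def sum_seqs_ins[symmetric] dec_sum)
  have "(\<Sum>u\<in>U. v i u x) = (\<Sum>ys\<in>seqs N. \<Sum>m\<in>Msg. \<Sum>xs\<in>seqs N. src_n p N xs ys * enc (ins i x xs) m)"
    unfolding U_def v_def sum.cartesian_product' by (simp add: sum.swap[of _ Msg])
  also have "\<dots> = (\<Sum>ys\<in>seqs N. \<Sum>xs\<in>seqs N. src_n p N xs ys * (\<Sum>m\<in>Msg. enc (ins i x xs) m))"
    unfolding sum_distrib_left by (intro sum.cong refl sum.swap)
  also have "\<dots> = 1" using i by (simp add: enc_sum sum_src)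
  finally show "(\<Sum>u\<in>U. v i u x) = 1" .
qed

lemma A_nonneg: "m \<in> Msg \<Longrightarrow> xs \<in> seqs n \<Longrightarrow> A m ys xs \<ge> 0"
  unfolding A_def by (intro mult_nonneg_nonneg enc_nonneg less_imp_le[OF src_pos]) auto

lemma B_nonneg: "m \<in> Msg \<Longrightarrow> B m ys \<ge> 0"
  unfolding B_def by (intro sum_nonneg A_nonneg)

lemma A_le_B: "m \<in> Msg \<Longrightarrow> xs \<in> seqs n \<Longrightarrow> A m ys xs \<le> B m ys"
  unfolding B_def by (intro member_le_sum A_nonneg) auto

lemma Out_nonneg: "ys \<in> seqs n \<Longrightarrow> zs \<in> seqs n \<Longrightarrow> xs \<in> seqs n \<Longrightarrow> Out ys zs xs \<ge> 0"
  unfolding Out_def by (intro sum_nonneg mult_nonneg_nonneg A_nonneg dec_nonneg)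

lemma Out2_nonneg: "ys \<in> seqs n \<Longrightarrow> zs \<in> seqs n \<Longrightarrow> Out2 ys zs \<ge> 0"
  unfolding Out2_def by (intro sum_nonneg Out_nonneg)

lemma sum_dec_mult:
  "ys \<in> seqs n \<Longrightarrow> (\<Sum>zs\<in>seqs n. \<Sum>m\<in>Msg. dec m ys zs * h m) = (\<Sum>m\<in>Msg. h m)"
  by (subst sum.swap) (simp add: sum_distrib_right[symmetric] dec_sum)

lemma sum_A: "(\<Sum>ys\<in>seqs n. \<Sum>xs\<in>seqs n. \<Sum>m\<in>Msg. A m ys xs) = 1"
proof -
  have "(\<Sum>m\<in>Msg. A m ys xs) = src_n p n xs ys" if "xs \<in> seqs n" for xs ys
    unfolding A_def using that by (simp add: sum_distrib_left[symmetric] enc_sum)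
  then show ?thesis by (simp add: sum_src)
qed

lemma sum_Out: "(\<Sum>ys\<in>seqs n. \<Sum>zs\<in>seqs n. \<Sum>xs\<in>seqs n. Out ys zs xs) = 1"
proof -
  have "(\<Sum>zs\<in>seqs n. \<Sum>xs\<in>seqs n. Out ys zs xs) = (\<Sum>xs\<in>seqs n. \<Sum>m\<in>Msg. A m ys xs)" if "ys \<in> seqs n" for ys
    unfolding Out_def using that
    by (subst sum.swap) (simp add: mult.commute[of "A _ _ _"] sum_dec_mult)
  then show ?thesis by (simp add: sum_A)
qed

text \<open>Moves expectations from the block to coordinate \<open>i\<close>. After all words are
  split at \<open>i\<close>, the remaining letters of \<open>xs\<close> are absorbed into
  \<open>v i\<close>, those of \<open>zs\<close> into \<open>r i\<close>, and those of
  \<open>ys\<close> become part of \<open>u\<close>.\<close>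

lemma letter_sum:
  assumes i: "i \<le> N"
  shows "(\<Sum>ys\<in>seqs n. \<Sum>zs\<in>seqs n. \<Sum>xs\<in>seqs n. \<Sum>m\<in>Msg. A m ys xs * dec m ys zs * G (m, del i ys) (xs ! i) (ys ! i) (zs ! i))
    = (\<Sum>y\<in>UNIV. \<Sum>z\<in>UNIV. \<Sum>u\<in>U. \<Sum>x\<in>UNIV. p x y * v i u x * r i u y z * G u x y z)"
proof -
  have "(\<Sum>ys\<in>seqs n. \<Sum>zs\<in>seqs n. \<Sum>xs\<in>seqs n. \<Sum>m\<in>Msg. A m ys xs * dec m ys zs * G (m, del i ys) (xs ! i) (ys ! i) (zs ! i))
    = (\<Sum>y\<in>UNIV. \<Sum>ys\<in>seqs N. \<Sum>z\<in>UNIV. \<Sum>zs\<in>seqs N. \<Sum>x\<in>UNIV. \<Sum>xs\<in>seqs N. \<Sum>m\<in>Msg.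
        p x y * (src_n p N xs ys * enc (ins i x xs) m) * dec m (ins i y ys) (ins i z zs) * G (m, ys) x y z)"
    unfolding sum_seqs_ins[OF i] A_def using i
    by (intro sum.cong refl) (simp add: src_n_ins mult_ac)
  also have "\<dots> = (\<Sum>y\<in>UNIV. \<Sum>z\<in>UNIV. \<Sum>m\<in>Msg. \<Sum>ys\<in>seqs N. \<Sum>x\<in>UNIV. \<Sum>xs\<in>seqs N. \<Sum>zs\<in>seqs N.
        p x y * (src_n p N xs ys * enc (ins i x xs) m) * dec m (ins i y ys) (ins i z zs) * G (m, ys) x y z)"
    unfolding sum.cartesian_product
    by (rule sum.reindex_bij_witness[of _
          "\<lambda>(y, z, m, ys, x, xs, zs). (y, ys, z, zs, x, xs, m)"
          "\<lambda>(y, ys, z, zs, x, xs, m). (y, z, m, ys, x, xs, zs)"]) auto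
  also have "\<dots> = (\<Sum>y\<in>UNIV. \<Sum>z\<in>UNIV. \<Sum>m\<in>Msg. \<Sum>ys\<in>seqs N. \<Sum>x\<in>UNIV. p x y * v i (m, ys) x * r i (m, ys) y z * G (m, ys) x y z)"
    unfolding v_def r_def split by (simp only: sum_distrib_left sum_distrib_right mult_ac)
  also have "\<dots> = (\<Sum>y\<in>UNIV. \<Sum>z\<in>UNIV. \<Sum>u\<in>U. \<Sum>x\<in>UNIV. p x y * v i u x * r i u y z * G u x y z)"
    unfolding U_def sum.cartesian_product' ..
  finally show ?thesis .
qed

lemma marginal:
  assumes i: "i \<le> N"
  shows "(\<Sum>ys\<in>seqs N. \<Sum>zs\<in>seqs N. \<Sum>xs\<in>seqs N. Out (ins i y ys) (ins i z zs) (ins i x xs))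
    = test_channel.P3 p U (v i) (r i) x y z"
proof -
  interpret test_channel p q U "v i" "r i" using single_letter[OF i] .
  have "(\<Sum>ys\<in>seqs N. \<Sum>zs\<in>seqs N. \<Sum>xs\<in>seqs N. Out (ins i y ys) (ins i z zs) (ins i x xs))
    = (\<Sum>ys\<in>seqs N. \<Sum>zs\<in>seqs N. \<Sum>xs\<in>seqs N. \<Sum>m\<in>Msg.
        p x y * (src_n p N xs ys * enc (ins i x xs) m) * dec m (ins i y ys) (ins i z zs))"
    unfolding Out_def A_def using i by (intro sum.cong refl) (simp add: src_n_ins mult_ac)
  also have "\<dots> = (\<Sum>m\<in>Msg. \<Sum>ys\<in>seqs N. \<Sum>xs\<in>seqs N. \<Sum>zs\<in>seqs N.
        p x y * (src_n p N xs ys * enc (ins i x xs) m) * dec m (ins i y ys) (ins i z zs))"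
    unfolding sum.cartesian_product
    by (rule sum.reindex_bij_witness[of _ "\<lambda>(m, ys, xs, zs). (ys, zs, xs, m)" "\<lambda>(ys, zs, xs, m). (m, ys, xs, zs)"]) auto
  also have "\<dots> = (\<Sum>m\<in>Msg. \<Sum>ys\<in>seqs N. p x y * v i (m, ys) x * r i (m, ys) y z)"
    unfolding v_def r_def split by (simp only: sum_distrib_left sum_distrib_right mult_ac)
  also have "\<dots> = P3 x y z" unfolding P3_def unfolding U_def sum.cartesian_product' ..
  finally show ?thesis .
qed

text \<open>Marginalisation contracts the L1 distance, so one block bound serves all
  coordinates.\<close>

lemma tv_le_dist:
  assumes i: "i \<le> N"
  shows "test_channel.tv p q U (v i) (r i) \<le> dist"
proof -
  interpret test_channel p q U "v i" "r i" using single_letter[OF i] .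
  have target: "p x y * q x y z = (\<Sum>ys\<in>seqs N. \<Sum>zs\<in>seqs N. \<Sum>xs\<in>seqs N. target_n p q n (ins i x xs) (ins i y ys) (ins i z zs))" for x y z
    using i by (simp add: target_n_ins sum_distrib_left[symmetric] sum_target)
  have "tv \<le> (\<Sum>y\<in>UNIV. \<Sum>z\<in>UNIV. \<Sum>x\<in>UNIV. \<Sum>ys\<in>seqs N. \<Sum>zs\<in>seqs N. \<Sum>xs\<in>seqs N.
      \<bar>Out (ins i y ys) (ins i z zs) (ins i x xs) - target_n p q n (ins i x xs) (ins i y ys) (ins i z zs)\<bar>)"
    unfolding tv_def marginal[OF i, symmetric] target sum_subtractf[symmetric]
    by (intro sum_mono order.trans[OF sum_abs] order.refl)
  also have "\<dots> = (\<Sum>y\<in>UNIV. \<Sum>ys\<in>seqs N. \<Sum>z\<in>UNIV. \<Sum>zs\<in>seqs N. \<Sum>x\<in>UNIV. \<Sum>xs\<in>seqs N.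
      \<bar>Out (ins i y ys) (ins i z zs) (ins i x xs) - target_n p q n (ins i x xs) (ins i y ys) (ins i z zs)\<bar>)"
    unfolding sum.cartesian_product
    by (rule sum.reindex_bij_witness[of _ "\<lambda>(y, ys, z, zs, x, xs). (y, z, x, ys, zs, xs)" "\<lambda>(y, z, x, ys, zs, xs). (y, ys, z, zs, x, xs)"]) auto
  also have "\<dots> = dist" unfolding dist_def sum_seqs_ins[OF i] ..
  finally show ?thesis .
qed

text \<open>The law of X_i given the message and all of Bob's letters: \<open>U\<close> at
  coordinate \<open>i\<close> together with Y_i carries exactly \<open>m\<close> and
  \<open>ys\<close>.\<close>

definition post :: "nat \<Rightarrow> nat \<Rightarrow> 'y list \<Rightarrow> 'x \<Rightarrow> real" where
  "post i m ys x = p x (ys ! i) * v i (m, del i ys) x / test_channel.t p (v i) (m, del i ys) (ys ! i)"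

text \<open>Only an inequality: where the conditioning event has probability 0, division by zero
  makes the sum 0. A subprobability is enough for Gibbs' inequality.\<close>

lemma post_sum_le: 
  assumes "i \<le> N" shows "(\<Sum>x\<in>UNIV. post i m ys x) \<le> 1"
proof -
  interpret test_channel p q U "v i" "r i" using single_letter[OF assms] .
  have "(\<Sum>x\<in>UNIV. post i m ys x) = t (m, del i ys) (ys ! i) / t (m, del i ys) (ys ! i)"
    unfolding post_def sum_divide_distrib[symmetric] t_def ..
  then show ?thesis by simp
qed

lemma post_nonneg:
  assumes "i \<le> N" "m \<in> Msg" "ys \<in> seqs n" shows "post i m ys x \<ge> 0"
proof -
  interpret test_channel p q U "v i" "r i" using single_letter[OF assms(1)] .
  have "(m, del i ys) \<in> U" using assms by (simp add: U_def)
  then show ?thesis unfolding post_def by (simp add: p_nonneg v_nonneg t_nonneg)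
qed

lemma post_pos:
  assumes i: "i \<le> N" and m: "m \<in> Msg" and ys: "ys \<in> seqs n" and xs: "xs \<in> seqs n" and A: "A m ys xs > 0"
  shows "post i m ys (xs ! i) > 0"
proof -
  interpret test_channel p q U "v i" "r i" using single_letter[OF i] .
  have u: "(m, del i ys) \<in> U" using i m ys by (simp add: U_def)
  have "0 < enc xs m" using A src_pos[of n xs ys] by (auto simp: A_def zero_less_mult_iff)
  then have "0 < src_n p N (del i xs) (del i ys) * enc (ins i (xs ! i) (del i xs)) m"
    using i xs src_pos by (simp add: ins_del)
  also have "\<dots> \<le> v i (m, del i ys) (xs ! i)" unfolding v_def split
    using i xs m by (intro member_le_sum[where f = "\<lambda>xs'. src_n p N xs' (del i ys) * enc (ins i (xs ! i) xs') m"])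
      (auto intro!: mult_nonneg_nonneg enc_nonneg less_imp_le[OF src_pos])
  finally have v: "v i (m, del i ys) (xs ! i) > 0" .
  have "0 < p (xs ! i) (ys ! i) * v i (m, del i ys) (xs ! i)" using v p_pos by simp
  also have "\<dots> \<le> t (m, del i ys) (ys ! i)" unfolding t_def
    using u by (intro member_le_sum) (auto intro!: mult_nonneg_nonneg p_nonneg v_nonneg)
  finally show ?thesis using v p_pos unfolding post_def by simp
qed

text \<open>Conditional entropy is subadditive: the product of the coordinate posteriors is a
  competitor for the posterior of the whole block.\<close>

lemma sum_posterior_le:
  "(\<Sum>i<n. \<Sum>ys\<in>seqs n. \<Sum>xs\<in>seqs n. \<Sum>m\<in>Msg. A m ys xs * ln (post i m ys (xs ! i)))
    \<le> (\<Sum>ys\<in>seqs n. \<Sum>xs\<in>seqs n. \<Sum>m\<in>Msg. A m ys xs * ln (A m ys xs / B m ys))"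
proof -
  define G where "G m ys xs = (\<Prod>i<n. post i m ys (xs ! i))" for m ys xs
  have "(\<Sum>i<n. \<Sum>ys\<in>seqs n. \<Sum>xs\<in>seqs n. \<Sum>m\<in>Msg. A m ys xs * ln (post i m ys (xs ! i)))
    = (\<Sum>ys\<in>seqs n. \<Sum>xs\<in>seqs n. \<Sum>m\<in>Msg. A m ys xs * (\<Sum>i<n. ln (post i m ys (xs ! i))))"
    unfolding sum_distrib_left by (simp only: sum.swap[of _ _ "{..<n}"])
  \<comment> \<open>Adding and subtracting the logarithm of \<open>B\<close> turns the product of
    posteriors into a competitor \<open>B m ys * G m ys xs\<close> for the joint law
    \<open>A\<close>.\<close>
  also have "\<dots> = (\<Sum>ys\<in>seqs n. \<Sum>xs\<in>seqs n. \<Sum>m\<in>Msg. A m ys xs * ln (B m ys * G m ys xs)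
                    - A m ys xs * ln (B m ys))"
  proof (intro sum.cong refl)
    fix ys :: "'y list" and xs :: "'x list" and m assume *: "ys \<in> seqs n" "xs \<in> seqs n" "m \<in> Msg"
    show "A m ys xs * (\<Sum>i<n. ln (post i m ys (xs ! i))) = A m ys xs * ln (B m ys * G m ys xs) - A m ys xs * ln (B m ys)"
    proof (cases "A m ys xs > 0")
      case True
      have post: "post i m ys (xs ! i) > 0" if "i \<in> {..<n}" for i
        using post_pos[OF _ *(3,1,2) True, of i] that by simp
      then have "G m ys xs > 0" unfolding G_def by (intro prod_pos) auto
      moreover have "B m ys > 0" using A_le_B[OF *(3,2), of ys] True by linarith
      moreover have "ln (G m ys xs) = (\<Sum>i<n. ln (post i m ys (xs ! i)))"
        unfolding G_def by (rule ln_prod) (use post in fastforce)+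
      ultimately show ?thesis by (simp add: ln_mult algebra_simps)
    next
      case False
      then show ?thesis using A_nonneg[OF *(3,2), of ys] by simp
    qed
  qed
  also have "\<dots> \<le> (\<Sum>ys\<in>seqs n. \<Sum>xs\<in>seqs n. \<Sum>m\<in>Msg. A m ys xs * ln (A m ys xs) - A m ys xs * ln (B m ys))"
  proof -
    define S where "S = (seqs n :: 'y list set) \<times> (seqs n :: 'x list set) \<times> Msg"
    have "(\<Sum>(ys, xs, m)\<in>S. A m ys xs * ln (B m ys * G m ys xs)) \<le>
       (\<Sum>(ys, xs, m)\<in>S. A m ys xs * ln (A m ys xs)) + (\<Sum>(ys, xs, m)\<in>S. B m ys * G m ys xs) - (\<Sum>(ys, xs, m)\<in>S. A m ys xs)"
      unfolding case_prod_unfold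
    proof (rule gibbs_inequality)
      fix w assume "w \<in> S"
      then obtain ys xs m where w: "w = (ys, xs, m)" "ys \<in> seqs n" "xs \<in> seqs n" "m \<in> Msg"
        by (auto simp: S_def)
      show "0 \<le> A (snd (snd w)) (fst w) (fst (snd w))" using w A_nonneg by simp
      show "0 \<le> B (snd (snd w)) (fst w) * G (snd (snd w)) (fst w) (fst (snd w))"
        using w by (auto simp: G_def intro!: mult_nonneg_nonneg B_nonneg prod_nonneg post_nonneg)
      assume "0 < A (snd (snd w)) (fst w) (fst (snd w))"
      then have pos: "A m ys xs > 0" using w by simp
      have "G m ys xs > 0" unfolding G_def
        using post_pos[OF _ w(4,2,3) pos] by (intro prod_pos) auto
      moreover have "B m ys > 0" using A_le_B[OF w(4,3), of ys] pos by linarith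
      ultimately show "0 < B (snd (snd w)) (fst w) * G (snd (snd w)) (fst w) (fst (snd w))"
        using w by simp
    qed
    moreover have "(\<Sum>(ys, xs, m)\<in>S. A m ys xs) = 1"
      unfolding S_def sum.cartesian_product' by (simp add: sum_A)
    moreover have "(\<Sum>(ys, xs, m)\<in>S. B m ys * G m ys xs) \<le> 1"
    proof -
      have "(\<Sum>(ys, xs, m)\<in>S. B m ys * G m ys xs) = (\<Sum>ys\<in>seqs n. \<Sum>m\<in>Msg. B m ys * (\<Sum>xs\<in>seqs n. G m ys xs))"
        unfolding S_def sum.cartesian_product' sum_distrib_left by (simp add: sum.swap[of _ Msg])
      also have "\<dots> \<le> (\<Sum>ys\<in>seqs n. \<Sum>m\<in>Msg. B m ys)"
      proof (intro sum_mono)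
        fix ys :: "'y list" and m assume *: "ys \<in> seqs n" "m \<in> Msg"
        have "(\<Sum>xs\<in>seqs n. G m ys xs) = (\<Prod>i<n. \<Sum>x\<in>UNIV. post i m ys x)"
          unfolding G_def by (rule sum_prod_seqs)
        also have "\<dots> \<le> 1"
          using * by (intro prod_le_1 conjI sum_nonneg post_nonneg post_sum_le) auto
        finally show "B m ys * (\<Sum>xs\<in>seqs n. G m ys xs) \<le> B m ys"
          using B_nonneg[OF *(2), of ys] by (simp add: mult_left_le)
      qed
      also have "\<dots> = 1" unfolding B_def using sum_A by (simp add: sum.swap[of _ Msg])
      finally show ?thesis .
    qed
    ultimately have "(\<Sum>(ys, xs, m)\<in>S. A m ys xs * ln (B m ys * G m ys xs)) \<le> (\<Sum>(ys, xs, m)\<in>S. A m ys xs * ln (A m ys xs))"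
      by linarith
    then show ?thesis
      unfolding S_def sum.cartesian_product' sum_subtractf by simp
  qed
  also have "\<dots> = (\<Sum>ys\<in>seqs n. \<Sum>xs\<in>seqs n. \<Sum>m\<in>Msg. A m ys xs * ln (A m ys xs / B m ys))"
  proof (intro sum.cong refl)
    fix ys :: "'y list" and xs :: "'x list" and m assume *: "ys \<in> seqs n" "xs \<in> seqs n" "m \<in> Msg"
    show "A m ys xs * ln (A m ys xs) - A m ys xs * ln (B m ys) = A m ys xs * ln (A m ys xs / B m ys)"
      using A_nonneg[OF *(3,2), of ys] A_le_B[OF *(3,2), of ys]
      by (cases "A m ys xs = 0") (auto simp: ln_divide_pos right_diff_distrib)
  qed
  finally show ?thesis .
qed

lemma letter_posterior:
  assumes i: "i \<le> N"
  shows "(\<Sum>ys\<in>seqs n. \<Sum>xs\<in>seqs n. \<Sum>m\<in>Msg. A m ys xs * ln (post i m ys (xs ! i)))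
    = (\<Sum>y\<in>UNIV. \<Sum>u\<in>U. \<Sum>x\<in>UNIV. p x y * v i u x * ln (p x y * v i u x / test_channel.t p (v i) u y))"
proof -
  interpret test_channel p q U "v i" "r i" using single_letter[OF i] .
  define G where "G u x y = ln (p x y * v i u x / t u y)" for u x y
  \<comment> \<open>The decoder, of total weight 1 over \<open>zs\<close>, is inserted so that
    \<open>letter_sum\<close> applies, and is summed out again at the end.\<close>
  have "(\<Sum>ys\<in>seqs n. \<Sum>xs\<in>seqs n. \<Sum>m\<in>Msg. A m ys xs * ln (post i m ys (xs ! i)))
    = (\<Sum>ys\<in>seqs n. \<Sum>xs\<in>seqs n. \<Sum>zs\<in>seqs n. \<Sum>m\<in>Msg. dec m ys zs * (A m ys xs * G (m, del i ys) (xs ! i) (ys ! i)))"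
    unfolding G_def post_def by (simp add: sum_dec_mult)
  also have "\<dots> = (\<Sum>ys\<in>seqs n. \<Sum>zs\<in>seqs n. \<Sum>xs\<in>seqs n. \<Sum>m\<in>Msg. A m ys xs * dec m ys zs * G (m, del i ys) (xs ! i) (ys ! i))"
    by (subst (2) sum.swap) (simp only: mult_ac)
  also have "\<dots> = (\<Sum>y\<in>UNIV. \<Sum>z\<in>UNIV. \<Sum>u\<in>U. \<Sum>x\<in>UNIV. p x y * v i u x * r i u y z * G u x y)"
    by (rule letter_sum[OF i])
  also have "\<dots> = (\<Sum>y\<in>UNIV. \<Sum>u\<in>U. \<Sum>x\<in>UNIV. p x y * v i u x * G u x y)"
  proof (rule sum.cong[OF refl])
    fix y
    have "(\<Sum>z\<in>UNIV. \<Sum>u\<in>U. \<Sum>x\<in>UNIV. p x y * v i u x * r i u y z * G u x y)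
       = (\<Sum>u\<in>U. \<Sum>z\<in>UNIV. \<Sum>x\<in>UNIV. r i u y z * (p x y * v i u x * G u x y))"
      by (subst sum.swap) (simp only: mult_ac)
    also have "\<dots> = (\<Sum>u\<in>U. \<Sum>x\<in>UNIV. p x y * v i u x * G u x y)"
      by (simp add: sum_product[symmetric] r_sum)
    finally show "(\<Sum>z\<in>UNIV. \<Sum>u\<in>U. \<Sum>x\<in>UNIV. p x y * v i u x * r i u y z * G u x y)
       = (\<Sum>u\<in>U. \<Sum>x\<in>UNIV. p x y * v i u x * G u x y)" .
  qed
  finally show ?thesis unfolding G_def .
qed

end

section \<open>The leakage as a difference of conditional entropies\<close>

lemma sum_sum_delta:
  assumes "finite C" "finite D" "c \<in> C" "d \<in> D"
  shows "(\<Sum>a\<in>C. \<Sum>b\<in>D. if a = c \<and> b = d then f a b else 0) = f c d"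
proof -
  have "(\<Sum>a\<in>C. \<Sum>b\<in>D. if a = c \<and> b = d then f a b else 0)
      = (\<Sum>w\<in>C \<times> D. if w = (c, d) then f (fst w) (snd w) else 0)"
    unfolding sum.cartesian_product by (intro sum.cong refl) (auto split: if_splits)
  also have "\<dots> = f c d" using assms by simp
  finally show ?thesis .
qed

context block_code
begin

abbreviation leak :: real where
  "leak \<equiv> cond_mi (Msg \<times> seqs n \<times> (seqs n \<times> seqs n)) (\<lambda>(m, xs, ys, zs). code_joint p n enc dec m xs ys zs)"

abbreviation density :: "nat \<Rightarrow> 'x list \<Rightarrow> 'y list \<Rightarrow> 'z list \<Rightarrow> real" where
  "density m xs ys zs \<equiv> A m ys xs * dec m ys zs * Out2 ys zs / (B m ys * dec m ys zs * Out ys zs xs)"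

text \<open>The three marginals inside \<open>cond_mi\<close> are \<open>Out2\<close>,
  \<open>B\<close> times \<open>dec\<close>, and \<open>Out\<close>; the second factorises because
  Bob's output depends on \<open>xs\<close> only through the message.\<close>

lemma leak_expand:
  "leak = (\<Sum>m\<in>Msg. \<Sum>xs\<in>seqs n. \<Sum>ys\<in>seqs n. \<Sum>zs\<in>seqs n.
      if A m ys xs * dec m ys zs > 0
      then A m ys xs * dec m ys zs * log 2 (density m xs ys zs)
      else 0)"
proof -
  define J where "J = (\<lambda>(m, xs, ys, zs). A m ys xs * dec m ys zs)"
  define S where "S = Msg \<times> (seqs n :: 'x list set) \<times> (seqs n :: 'y list set) \<times> (seqs n :: 'z list set)"
  have J: "(\<lambda>(m, xs, ys, zs). code_joint p n enc dec m xs ys zs) = J"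
    by (auto simp: J_def code_joint_def A_def)
  have c: "(\<Sum>t\<in>S. if snd (snd t) = (ys, zs) then J t else 0) = Out2 ys zs"
    if "ys \<in> seqs n" "zs \<in> seqs n" for ys zs
  proof -
    have "(\<Sum>t\<in>S. if snd (snd t) = (ys, zs) then J t else 0)
      = (\<Sum>m\<in>Msg. \<Sum>xs\<in>seqs n. \<Sum>ys'\<in>seqs n. \<Sum>zs'\<in>seqs n. if ys' = ys \<and> zs' = zs then A m ys' xs * dec m ys' zs' else 0)"
      unfolding S_def J_def sum.cartesian_product' by (intro sum.cong refl) auto
    also have "\<dots> = Out2 ys zs"
      using that by (simp add: sum_sum_delta Out2_def Out_def sum.swap[of _ Msg])
    finally show ?thesis .
  qed
  have ac: "(\<Sum>t\<in>S. if fst t = m \<and> snd (snd t) = (ys, zs) then J t else 0) = B m ys * dec m ys zs"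
    if "m \<in> Msg" "ys \<in> seqs n" "zs \<in> seqs n" for m ys zs
  proof -
    have "(\<Sum>t\<in>S. if fst t = m \<and> snd (snd t) = (ys, zs) then J t else 0)
      = (\<Sum>m'\<in>Msg. \<Sum>xs\<in>seqs n. \<Sum>ys'\<in>seqs n. \<Sum>zs'\<in>seqs n.
           if ys' = ys \<and> zs' = zs then (if m' = m then A m' ys' xs * dec m' ys' zs' else 0) else 0)"
      unfolding S_def J_def sum.cartesian_product' by (intro sum.cong refl) auto
    also have "\<dots> = (\<Sum>m'\<in>Msg. if m' = m then \<Sum>xs\<in>seqs n. A m' ys xs * dec m' ys zs else 0)"
      using that by (auto simp: sum_sum_delta intro!: sum.cong)
    also have "\<dots> = B m ys * dec m ys zs"
      using that finite_Msg by (simp add: B_def sum_distrib_right)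
    finally show ?thesis .
  qed
  have bc: "(\<Sum>t\<in>S. if fst (snd t) = xs \<and> snd (snd t) = (ys, zs) then J t else 0) = Out ys zs xs"
    if "xs \<in> seqs n" "ys \<in> seqs n" "zs \<in> seqs n" for xs ys zs
  proof -
    have "(\<Sum>t\<in>S. if fst (snd t) = xs \<and> snd (snd t) = (ys, zs) then J t else 0)
      = (\<Sum>m\<in>Msg. \<Sum>xs'\<in>seqs n. \<Sum>ys'\<in>seqs n. \<Sum>zs'\<in>seqs n.
           if ys' = ys \<and> zs' = zs then (if xs' = xs then A m ys' xs' * dec m ys' zs' else 0) else 0)"
      unfolding S_def J_def sum.cartesian_product' by (intro sum.cong refl) auto
    also have "\<dots> = Out ys zs xs"
      using that by (simp add: sum_sum_delta Out_def)
    finally show ?thesis .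
  qed
  have "leak = (\<Sum>(m, xs, ys, zs)\<in>S. if J (m, xs, ys, zs) > 0
      then J (m, xs, ys, zs) * log 2 (J (m, xs, ys, zs) * Out2 ys zs / (B m ys * dec m ys zs * Out ys zs xs)) else 0)"
    unfolding J cond_mi_def Let_def S_def[symmetric]
    by (intro sum.cong refl) (auto simp: S_def c[unfolded S_def] ac[unfolded S_def] bc[unfolded S_def])
  then show ?thesis unfolding S_def J_def sum.cartesian_product' split .
qed

text \<open>This is I(M;X|Y,Z) = H(X|Y,Z) - H(X|M,Y): the decoder cancels from
  \<open>density\<close>, so \<open>zs\<close> drops out of the second conditional entropy.\<close>

lemma leak_eq:
  "ln 2 * leak = (\<Sum>ys\<in>seqs n. \<Sum>xs\<in>seqs n. \<Sum>m\<in>Msg. A m ys xs * ln (A m ys xs / B m ys))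
     - (\<Sum>ys\<in>seqs n. \<Sum>zs\<in>seqs n. \<Sum>xs\<in>seqs n. Out ys zs xs * ln (Out ys zs xs))
     + (\<Sum>ys\<in>seqs n. \<Sum>zs\<in>seqs n. Out2 ys zs * ln (Out2 ys zs))"
proof -
  let ?S = "\<lambda>F. \<Sum>ys\<in>seqs n. \<Sum>zs\<in>seqs n. \<Sum>xs\<in>seqs n. F ys zs xs"
  let ?A = "\<lambda>m xs ys. A m ys xs * ln (A m ys xs / B m ys)" and ?J = "\<lambda>m xs ys zs. A m ys xs * dec m ys zs"
  define G where "G m xs ys zs = dec m ys zs * (?A m xs ys)
      - ?J m xs ys zs * ln (Out ys zs xs) + ?J m xs ys zs * ln (Out2 ys zs)" for m xs ys zs
  have summand: "ln 2 * (if ?J m xs ys zs > 0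
      then ?J m xs ys zs * log 2 (density m xs ys zs)
      else 0) = G m xs ys zs" if *: "m \<in> Msg" "xs \<in> seqs n" "ys \<in> seqs n" "zs \<in> seqs n" for m xs ys zs
  proof (cases "?J m xs ys zs > 0")
    case True
    then have A: "A m ys xs > 0" and d: "dec m ys zs > 0"
      using A_nonneg[OF *(1,2), of ys] dec_nonneg[OF *(1,3,4)] by (auto simp: zero_less_mult_iff)
    have B: "B m ys > 0" using A A_le_B[OF *(1,2), of ys] by linarith
    have "?J m xs ys zs \<le> Out ys zs xs" unfolding Out_def
      using * finite_Msg by (intro member_le_sum) (auto intro!: mult_nonneg_nonneg A_nonneg dec_nonneg)
    then have O: "Out ys zs xs > 0" using True by linarith
    have "Out ys zs xs \<le> Out2 ys zs" unfolding Out2_def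
      using * by (intro member_le_sum Out_nonneg) auto
    then have O2: "Out2 ys zs > 0" using O by linarith
    have "density m xs ys zs
        = (A m ys xs / B m ys) * (Out2 ys zs / Out ys zs xs)" using d by simp
    also have "ln \<dots> = ln (A m ys xs / B m ys) + ln (Out2 ys zs / Out ys zs xs)"
      using A B O O2 by (simp add: ln_mult del: times_divide_times_eq times_divide_eq_left times_divide_eq_right)
    also have "ln (Out2 ys zs / Out ys zs xs) = ln (Out2 ys zs) - ln (Out ys zs xs)"
      using O O2 by (rule ln_divide_pos[rotated])
    finally have ln: "ln (density m xs ys zs)
        = ln (A m ys xs / B m ys) + (ln (Out2 ys zs) - ln (Out ys zs xs))" .
    have "ln 2 * (?J m xs ys zs * log 2 (density m xs ys zs))
        = ?J m xs ys zs * ln (density m xs ys zs)"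
      by (simp add: log_def)
    also have "\<dots> = G m xs ys zs"
      unfolding ln G_def by (simp add: algebra_simps del: times_divide_eq_left times_divide_eq_right)
    finally show ?thesis using True by simp
  next
    case False
    then have "?J m xs ys zs = 0"
      using A_nonneg[OF *(1,2), of ys] dec_nonneg[OF *(1,3,4)] by (metis mult_nonneg_nonneg order.not_eq_order_implies_strict)
    then show ?thesis by (auto simp: G_def)
  qed
  have "ln 2 * leak = (\<Sum>m\<in>Msg. \<Sum>xs\<in>seqs n. \<Sum>ys\<in>seqs n. \<Sum>zs\<in>seqs n. G m xs ys zs)"
    unfolding leak_expand sum_distrib_left by (intro sum.cong refl summand)
  also have "\<dots> = ?S (\<lambda>ys zs xs. \<Sum>m\<in>Msg. G m xs ys zs)"
    unfolding sum.cartesian_product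
    by (rule sum.reindex_bij_witness[of _ "\<lambda>(ys, zs, xs, m). (m, xs, ys, zs)" "\<lambda>(m, xs, ys, zs). (ys, zs, xs, m)"]) auto
  also have "\<dots> = ?S (\<lambda>ys zs xs. \<Sum>m\<in>Msg. dec m ys zs * (?A m xs ys))
     - ?S (\<lambda>ys zs xs. \<Sum>m\<in>Msg. ?J m xs ys zs * ln (Out ys zs xs))
     + ?S (\<lambda>ys zs xs. \<Sum>m\<in>Msg. ?J m xs ys zs * ln (Out2 ys zs))"
    unfolding G_def sum.distrib sum_subtractf ..
  also have "?S (\<lambda>ys zs xs. \<Sum>m\<in>Msg. dec m ys zs * (?A m xs ys))
      = (\<Sum>ys\<in>seqs n. \<Sum>xs\<in>seqs n. \<Sum>m\<in>Msg. ?A m xs ys)"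
  proof (rule sum.cong[OF refl])
    fix ys :: "'y list" assume "ys \<in> seqs n"
    then show "(\<Sum>zs\<in>seqs n. \<Sum>xs\<in>seqs n. \<Sum>m\<in>Msg. dec m ys zs * (?A m xs ys))
      = (\<Sum>xs\<in>seqs n. \<Sum>m\<in>Msg. ?A m xs ys)"
      by (subst sum.swap) (simp only: sum_dec_mult)
  qed
  also have "?S (\<lambda>ys zs xs. \<Sum>m\<in>Msg. ?J m xs ys zs * ln (Out ys zs xs))
      = ?S (\<lambda>ys zs xs. Out ys zs xs * ln (Out ys zs xs))"
    unfolding sum_distrib_right[symmetric] Out_def ..
  also have "?S (\<lambda>ys zs xs. \<Sum>m\<in>Msg. ?J m xs ys zs * ln (Out2 ys zs))
      = (\<Sum>ys\<in>seqs n. \<Sum>zs\<in>seqs n. Out2 ys zs * ln (Out2 ys zs))"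
    unfolding sum_distrib_right[symmetric] Out2_def Out_def ..
  finally show ?thesis .
qed

section \<open>From the leakage to the sum of single-letter leakages\<close>

abbreviation negent :: real where
  "negent \<equiv> (\<Sum>y\<in>UNIV. \<Sum>z\<in>UNIV. \<Sum>x\<in>UNIV. p x y * q x y z * ln (p x y * q x y z))
          - (\<Sum>y\<in>UNIV. \<Sum>z\<in>UNIV. margin y z * ln (margin y z))"

text \<open>Here \<open>negent\<close> is -H(X|Y,Z) of one target letter in nats. The continuity
  bound is one-sided, so code and target exchange roles between (Y,Z,X) and (Y,Z). The smoothing
  term pays for the whole block alphabet.\<close>

lemma block_entropy_le:
  assumes \<tau>: "0 < \<tau>" "\<tau> \<le> 1 / 2"
  shows "(\<Sum>ys\<in>seqs n. \<Sum>zs\<in>seqs n. \<Sum>xs\<in>seqs n. Out ys zs xs * ln (Out ys zs xs))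
     - (\<Sum>ys\<in>seqs n. \<Sum>zs\<in>seqs n. Out2 ys zs * ln (Out2 ys zs))
     \<le> real n * negent
       + 2 * dist * ln (1 / \<tau>) + 2 * real (card (UNIV :: ('y \<times> 'z \<times> 'x) set)) ^ n * \<tau>"
proof -
  define T where "T ys zs xs = target_n p q n xs ys zs" for ys zs xs
  define T2 where "T2 ys zs = (\<Sum>xs\<in>seqs n. T ys zs xs)" for ys zs
  define O3 O2 T3 R2 H where
    "O3 = (\<Sum>ys\<in>seqs n. \<Sum>zs\<in>seqs n. \<Sum>xs\<in>seqs n. Out ys zs xs * ln (Out ys zs xs))" and
    "O2 = (\<Sum>ys\<in>seqs n. \<Sum>zs\<in>seqs n. Out2 ys zs * ln (Out2 ys zs))" and
    "T3 = (\<Sum>ys\<in>seqs n. \<Sum>zs\<in>seqs n. \<Sum>xs\<in>seqs n. T ys zs xs * ln (T ys zs xs))" and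
    "R2 = (\<Sum>ys\<in>seqs n. \<Sum>zs\<in>seqs n. T2 ys zs * ln (T2 ys zs))" and
    "H = negent"
  define c3 c2 c L d3 d2 where "c3 = real (card (seqs n :: 'y list set) * card (seqs n :: 'z list set) * card (seqs n :: 'x list set)) * \<tau>" and
    "c2 = real (card (seqs n :: 'y list set) * card (seqs n :: 'z list set)) * \<tau>" and
    "c = real (card (UNIV :: ('y \<times> 'z \<times> 'x) set)) ^ n * \<tau>" and "L = ln (1 / \<tau>)" and
    "d3 = (\<Sum>ys\<in>seqs n. \<Sum>zs\<in>seqs n. \<Sum>xs\<in>seqs n. \<bar>T ys zs xs - Out ys zs xs\<bar>)" and
    "d2 = (\<Sum>ys\<in>seqs n. \<Sum>zs\<in>seqs n. \<bar>Out2 ys zs - T2 ys zs\<bar>)"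
  have "O3
    \<le> T3
     + d3 * L
     + c3"
    unfolding O3_def T3_def d3_def c3_def L_def using \<tau> by (intro entropy_continuity3) (auto simp: T_def target_nonneg Out_nonneg sum_Out sum_target)
  moreover have "R2
    \<le> O2
     + d2 * L
     + c2"
    unfolding O2_def R2_def d2_def c2_def L_def using \<tau> by (intro entropy_continuity2)
      (auto simp: T_def T2_def Out2_def[symmetric] target_nonneg Out2_nonneg sum_Out[folded Out2_def] sum_target intro!: sum_nonneg)
  moreover have "d3 * L = dist * L"
    unfolding d3_def dist_def T_def by (simp add: abs_minus_commute)
  moreover have "d2 * L \<le> dist * L"
    unfolding L_def d2_def dist_def T_def T2_def Out2_def sum_subtractf[symmetric] using \<tau>
    by (intro mult_right_mono sum_mono sum_abs) auto
  moreover have "c3 = c"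
    unfolding c3_def c_def by (simp add: card_seqs card_cartesian_product UNIV_Times_UNIV[symmetric] power_mult_distrib del: UNIV_Times_UNIV)
  moreover have "c2
     \<le> c"
  proof -
    have "card (UNIV :: ('y \<times> 'z) set) \<le> card (UNIV :: ('y \<times> 'z \<times> 'x) set)"
      by (simp add: card_cartesian_product UNIV_Times_UNIV[symmetric] Suc_le_eq card_gt_0_iff del: UNIV_Times_UNIV)
    then have "card (UNIV :: ('y \<times> 'z) set) ^ n \<le> card (UNIV :: ('y \<times> 'z \<times> 'x) set) ^ n"
      by (intro power_mono) auto
    also have "card (UNIV :: ('y \<times> 'z) set) ^ n = card (seqs n :: 'y list set) * card (seqs n :: 'z list set)"
      by (simp add: card_seqs card_cartesian_product UNIV_Times_UNIV[symmetric] power_mult_distrib del: UNIV_Times_UNIV)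
    finally show ?thesis using \<tau>
      unfolding c2_def c_def of_nat_power[symmetric] by (intro mult_right_mono) (simp_all only: of_nat_le_iff less_imp_le)
  qed
  moreover have "T3
     - R2
     = real n * H"
    unfolding T3_def R2_def H_def T_def T2_def target_entropy target_margin_entropy by (simp only: right_diff_distrib)
  ultimately show ?thesis
    unfolding O3_def[symmetric] O2_def[symmetric] H_def[symmetric] L_def[symmetric]
      mult.assoc[of 2] c_def[symmetric] by argo
qed

abbreviation kl_at :: "nat \<Rightarrow> real" where "kl_at i \<equiv> test_channel.kl p U (v i) (r i)"

text \<open>The single-letter counterpart of \<open>block_entropy_le\<close> in the other direction:
  H(X|Y,Z) of the code letter is bounded above by that of the target. Letter alphabets are fixed, so
  here \<tau> can stay independent of the block length.\<close>

lemma kl_le: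
  assumes i: "i \<le> N" and \<tau>: "0 < \<tau>" "\<tau> \<le> 1 / 2"
  shows "kl_at i
    \<le> (\<Sum>ys\<in>seqs n. \<Sum>xs\<in>seqs n. \<Sum>m\<in>Msg. A m ys xs * ln (post i m ys (xs ! i)))
      - negent
      + 2 * dist * ln (1 / \<tau>) + 2 * real (card (UNIV :: ('y \<times> 'z \<times> 'x) set)) * \<tau>"
proof -
  interpret test_channel p q U "v i" "r i" using single_letter[OF i] .
  have sum_P3: "(\<Sum>y\<in>UNIV. \<Sum>z\<in>UNIV. \<Sum>x\<in>UNIV. P3 x y z) = 1"
    using sum_P2 unfolding P2_def .
  define S3 S2 H3 H2 d2 where
    "S3 = (\<Sum>y\<in>UNIV. \<Sum>z\<in>UNIV. \<Sum>x\<in>UNIV. P3 x y z * ln (P3 x y z))" and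
    "S2 = (\<Sum>y\<in>UNIV. \<Sum>z\<in>UNIV. P2 y z * ln (P2 y z))" and
    "H3 = (\<Sum>y\<in>UNIV. \<Sum>z\<in>UNIV. \<Sum>x\<in>UNIV. p x y * q x y z * ln (p x y * q x y z))" and
    "H2 = (\<Sum>y\<in>UNIV. \<Sum>z\<in>UNIV. margin y z * ln (margin y z))" and
    "d2 = (\<Sum>y\<in>UNIV. \<Sum>z\<in>UNIV. \<bar>margin y z - P2 y z\<bar>)"
  define c3 c2 c L where "c3 = real (card (UNIV :: 'y set) * card (UNIV :: 'z set) * card (UNIV :: 'x set)) * \<tau>" and
    "c2 = real (card (UNIV :: 'y set) * card (UNIV :: 'z set)) * \<tau>" and
    "c = real (card (UNIV :: ('y \<times> 'z \<times> 'x) set)) * \<tau>" and "L = ln (1 / \<tau>)"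
  have "H3
    \<le> S3
     + tv * L
     + c3"
    unfolding S3_def H3_def tv_def c3_def L_def using \<tau> by (intro entropy_continuity3) (auto simp: P3_nonneg sum_P3 p_nonneg q_nonneg pq_sum)
  moreover have "S2
    \<le> H2
     + d2 * L
     + c2"
    unfolding S2_def H2_def d2_def c2_def L_def using \<tau> by (intro entropy_continuity2) (auto simp: P2_nonneg sum_P2 margin_nonneg margin_def pq_sum intro!: sum_nonneg mult_nonneg_nonneg p_nonneg q_nonneg)
  moreover have "d2 \<le> tv"
    unfolding d2_def tv_def margin_def P2_def sum_subtractf[symmetric]
    by (intro sum_mono order.trans[OF sum_abs]) (simp add: abs_minus_commute)
  moreover have "tv \<le> dist" using tv_le_dist[OF i] .
  moreover have "L \<ge> 0" unfolding L_def using \<tau> by simp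
  moreover have "c2 \<le> c"
  proof -
    have "card (UNIV :: 'y set) * card (UNIV :: 'z set) \<le> card (UNIV :: ('y \<times> 'z \<times> 'x) set)"
      by (simp add: card_cartesian_product UNIV_Times_UNIV[symmetric] Suc_le_eq card_gt_0_iff del: UNIV_Times_UNIV)
    then show ?thesis unfolding c2_def c_def using \<tau> by (intro mult_right_mono) (simp_all only: of_nat_le_iff less_imp_le)
  qed
  moreover have "c3 = c"
    unfolding c3_def c_def by (simp add: card_cartesian_product UNIV_Times_UNIV[symmetric] del: UNIV_Times_UNIV)
  moreover have "d2 * L \<le> dist * L"
    "tv * L \<le> dist * L"
    using calculation(3-5) by (auto intro!: mult_right_mono)
  ultimately show ?thesis
    unfolding kl_def letter_posterior[OF i] S3_def[symmetric] S2_def[symmetric] H3_def[symmetric] H2_def[symmetric] L_def[symmetric]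
      mult.assoc[of 2] c_def[symmetric] by argo
qed

text \<open>The terms with \<open>negent\<close> cancel between the letters (\<open>kl_le\<close>)
  and the block (\<open>block_entropy_le\<close>); \<open>sum_posterior_le\<close> compares what
  remains with \<open>leak_eq\<close>.\<close>

lemma sum_kl_le:
  assumes \<tau>: "0 < \<tau>" "\<tau> \<le> 1 / 2"
  shows "(\<Sum>i<n. kl_at i)
    \<le> ln 2 * leak + 2 + real n * (2 * dist * ln (2 * real (card (UNIV :: ('y \<times> 'z \<times> 'x) set)))
       + 2 * dist * ln (1 / \<tau>) + 2 * real (card (UNIV :: ('y \<times> 'z \<times> 'x) set)) * \<tau>)"
proof -
  define K where "K = real (card (UNIV :: ('y \<times> 'z \<times> 'x) set))"
  define H where "H = negent"
  have K: "K \<ge> 1" unfolding K_def by (simp add: Suc_le_eq card_gt_0_iff)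
  have "(\<Sum>i<n. kl_at i)
     \<le> (\<Sum>i<n. (\<Sum>ys\<in>seqs n. \<Sum>xs\<in>seqs n. \<Sum>m\<in>Msg. A m ys xs * ln (post i m ys (xs ! i)))
       - H + 2 * dist * ln (1 / \<tau>) + 2 * K * \<tau>)"
    unfolding H_def K_def using \<tau> by (intro sum_mono kl_le) auto
  also have "\<dots> = (\<Sum>i<n. (\<Sum>ys\<in>seqs n. \<Sum>xs\<in>seqs n. \<Sum>m\<in>Msg. A m ys xs * ln (post i m ys (xs ! i))))
       - real n * H + real n * (2 * dist * ln (1 / \<tau>) + 2 * K * \<tau>)"
    by (simp only: sum.distrib sum_subtractf sum_constant card_lessThan distrib_left)
  finally have 1: "(\<Sum>i<n. kl_at i) \<le> \<dots>" .
  \<comment> \<open>The block smoothing: small enough to beat the alphabet size K ^ n, yet with ln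
    (1 / \<sigma>) linear in \<open>n\<close>, so that it costs \<open>dist\<close> times a constant
    per letter. The 2 ensures \<sigma> \<le> 1 / 2 even for K = 1.\<close>
  define \<sigma> where "\<sigma> = 1 / (2 * K) ^ n"
  have \<sigma>: "0 < \<sigma>" "\<sigma> \<le> 1 / 2"
  proof -
    have "2 \<le> 2 * K" using K by simp
    also have "\<dots> \<le> (2 * K) ^ n" using K by (intro self_le_power) auto
    finally show "\<sigma> \<le> 1 / 2" unfolding \<sigma>_def by (intro divide_left_mono) auto
    show "0 < \<sigma>" unfolding \<sigma>_def using K by simp
  qed
  have "K ^ n * \<sigma> = 1 / 2 ^ n" unfolding \<sigma>_def using K by (simp add: power_mult_distrib)
  also have "\<dots> \<le> 1" by (simp add: one_le_power del: power_Suc)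
  finally have Ks: "K ^ n * \<sigma> \<le> 1" .
  have "ln (1 / \<sigma>) = ln ((2 * K) ^ n)" unfolding \<sigma>_def by simp
  also have "\<dots> = real n * ln (2 * K)" using K by (intro ln_realpow)
  finally have "ln (1 / \<sigma>) = real n * ln (2 * K)" .
  with block_entropy_le[OF \<sigma>] Ks
  have "(\<Sum>ys\<in>seqs n. \<Sum>zs\<in>seqs n. \<Sum>xs\<in>seqs n. Out ys zs xs * ln (Out ys zs xs))
     - (\<Sum>ys\<in>seqs n. \<Sum>zs\<in>seqs n. Out2 ys zs * ln (Out2 ys zs)) \<le> real n * H + 2 * dist * (real n * ln (2 * K)) + 2"
    unfolding H_def[symmetric] K_def[symmetric] by (simp only:)
  moreover note leak_eq sum_posterior_le 1
  ultimately show ?thesis unfolding K_def[symmetric] by (simp add: algebra_simps)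
qed

end

section \<open>Class estimators with vanishing average error\<close>

context block_code
begin

abbreviation err_at :: "nat \<Rightarrow> (nat \<times> 'y list \<Rightarrow> 'x \<Rightarrow> real) \<Rightarrow> real" where
  "err_at i \<equiv> test_channel.err q U (v i) (r i)"

definition total_err :: "(nat \<Rightarrow> nat \<times> 'y list \<Rightarrow> 'x \<Rightarrow> real) \<Rightarrow> real" where
  "total_err f = (\<Sum>i<n. err_at i (f i))"

lemma exists_estimators:
  assumes c: "c > 0" "\<And>x y. c \<le> p x y"
    and \<rho>: "\<rho> > 0" "\<rho> \<le> 1" "\<And>a b. a \<in> cols q \<Longrightarrow> b \<in> cols q \<Longrightarrow> a \<noteq> b \<Longrightarrow> 2 * \<rho> \<le> (\<Sum>x\<in>UNIV. \<bar>a x - b x\<bar>)"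
    and l: "l > 0"
  shows "\<exists>f. total_err f \<le> 2 / (c * \<rho>) * ((\<Sum>i<n. kl_at i) / l + real n * l + real n * (2 * dist))"
proof -
  have "\<exists>f. err_at i f \<le> 2 / (c * \<rho>) * (kl_at i / l + l + 2 * dist)"
    if "i < n" for i
  proof -
    have i: "i \<le> N" using that by simp
    interpret test_channel p q U "v i" "r i" using single_letter[OF i] .
    obtain f where f: "err f \<le> 2 / (c * \<rho>) * (kl / l + l + 2 * tv)"
      using exists_estimator[OF c \<rho>] l by blast
    also have "\<dots> \<le> 2 / (c * \<rho>) * (kl / l + l + 2 * dist)"
      using tv_le_dist[OF i] c \<rho> by (intro mult_left_mono) auto
    finally show ?thesis by blast
  qed
  then obtain f where f: "\<And>i. i < n \<Longrightarrow> err_at i (f i) \<le> 2 / (c * \<rho>) * (kl_at i / l + l + 2 * dist)"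
    by metis
  have "total_err f \<le> (\<Sum>i<n. 2 / (c * \<rho>) * (kl_at i / l + l + 2 * dist))"
    unfolding total_err_def using f by (intro sum_mono) auto
  also have "\<dots> = 2 / (c * \<rho>) * (\<Sum>i<n. kl_at i / l + l + 2 * dist)"
    by (rule sum_distrib_left[symmetric])
  also have "(\<Sum>i<n. kl_at i / l + l + 2 * dist)
     = (\<Sum>i<n. kl_at i) / l + real n * l + real n * (2 * dist)"
    by (simp only: sum.distrib sum_divide_distrib[symmetric] sum_constant card_lessThan)
  finally show ?thesis by blast
qed

end

context source_channel
begin

lemma ln_card_msgs_le:
  assumes "real (card (msgs n R)) \<ge> 1"
  shows "ln (real (card (msgs n R))) \<le> real n * (R * ln 2)"
proof -
  have "real (card (msgs n R)) \<le> 2 powr (real n * R)" by (simp add: msgs_def of_nat_nat)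
  then have "ln (real (card (msgs n R))) \<le> ln (2 powr (real n * R))"
    using assms by (subst ln_le_cancel_iff) auto
  then show ?thesis by (simp add: ln_powr)
qed

lemma is_code_block_code: "is_code (Suc N) R enc dec \<Longrightarrow> block_code p q N (msgs (Suc N) R) enc dec"
  by unfold_locales (auto simp: is_code_def msgs_def)

lemma is_code_dist:
  assumes "is_code (Suc N) R enc dec"
  shows "block_code.dist p q N (msgs (Suc N) R) enc dec
    = 2 * tv_dist (seqs (Suc N) \<times> seqs (Suc N) \<times> seqs (Suc N))
        (\<lambda>(xs, ys, zs). code_out p (Suc N) R enc dec xs ys zs) (\<lambda>(xs, ys, zs). target_n p q (Suc N) xs ys zs)"
proof -
  interpret block_code p q N "msgs (Suc N) R" enc dec using is_code_block_code[OF assms] .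
  have "dist = (\<Sum>ys\<in>seqs n. \<Sum>zs\<in>seqs n. \<Sum>xs\<in>seqs n. \<bar>code_out p n R enc dec xs ys zs - target_n p q n xs ys zs\<bar>)"
    unfolding dist_def Out_def A_def code_out_def code_joint_def ..
  also have "\<dots> = (\<Sum>xs\<in>seqs n. \<Sum>ys\<in>seqs n. \<Sum>zs\<in>seqs n. \<bar>code_out p n R enc dec xs ys zs - target_n p q n xs ys zs\<bar>)"
    unfolding sum.cartesian_product
    by (rule sum.reindex_bij_witness[of _ "\<lambda>(xs, ys, zs). (ys, zs, xs)" "\<lambda>(ys, zs, xs). (xs, ys, zs)"]) auto
  finally show ?thesis unfolding tv_dist_def sum.cartesian_product' by simp
qed

text \<open>Both the independence of the class law from \<open>y\<close> and the lower bound on the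
  rate use the secure codes only through this statement.\<close>

lemma vanishing_error:
  assumes R: "achievable p q R" and \<eta>: "\<eta> > 0"
  shows "\<forall>\<^sub>F N in sequentially. \<exists>enc dec f. block_code p q N (msgs (Suc N) R) enc dec
      \<and> block_code.dist p q N (msgs (Suc N) R) enc dec \<le> \<eta>
      \<and> block_code.total_err p q N (msgs (Suc N) R) enc dec f \<le> real (Suc N) * \<eta>"
proof -
  obtain enc dec where code: "\<And>n. is_code n R (enc n) (dec n)"
    and lim: "\<And>\<epsilon>. \<epsilon> > 0 \<Longrightarrow> \<forall>\<^sub>F n in sequentially.
            tv_dist (seqs n \<times> seqs n \<times> seqs n)
              (\<lambda>(xs, ys, zs). code_out p n R (enc n) (dec n) xs ys zs)
              (\<lambda>(xs, ys, zs). target_n p q n xs ys zs) \<le> \<epsilon> \<and>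
            code_leak p n R (enc n) (dec n) \<le> real n * \<epsilon>"
    using R unfolding achievable_def by blast
  obtain c where c: "c > 0" "\<And>x y. c \<le> p x y" using p_lower_bound by blast
  obtain \<rho> where \<rho>: "\<rho> > 0" "\<rho> \<le> 1" "\<And>a b. a \<in> cols q \<Longrightarrow> b \<in> cols q \<Longrightarrow> a \<noteq> b \<Longrightarrow> 2 * \<rho> \<le> (\<Sum>x\<in>UNIV. \<bar>a x - b x\<bar>)"
    using exists_gap[of "cols q"] by auto
  \<comment> \<open>Error budget: four terms of at most \<eta> / 4 per letter. \<open>l\<close>
    makes C times l small, then \<tau> the smoothing term, whose weight grows with 1 / l;
    \<open>L\<close> is the resulting coefficient of \<epsilon>; the constant 2 * C / l is absorbed
    by large \<open>N\<close>. The cap \<eta> / 2 on \<epsilon> is there because \<open>dist\<close>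
    is twice \<open>tv_dist\<close>.\<close>
  define C where "C = 2 / (c * \<rho>)"
  define K where "K = real (card (UNIV :: ('y \<times> 'z \<times> 'x) set))"
  define l where "l = \<eta> / (4 * C)"
  define \<tau> where "\<tau> = min (1 / 2) (\<eta> * l / (8 * C * K))"
  define L where "L = C * (ln 2 + 4 * ln (2 * K) + 4 * ln (1 / \<tau>)) / l + 4 * C"
  define \<epsilon> where "\<epsilon> = min (\<eta> / 2) (\<eta> / (4 * L))"
  have C: "C > 0" using c \<rho> by (simp add: C_def)
  have K: "K \<ge> 1" unfolding K_def by (simp add: Suc_le_eq card_gt_0_iff)
  have l: "l > 0" using \<eta> C by (simp add: l_def)
  have \<tau>: "0 < \<tau>" "\<tau> \<le> 1 / 2" "\<tau> \<le> \<eta> * l / (8 * C * K)" using \<eta> C K l by (auto simp: \<tau>_def)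
  have L: "L > 0" unfolding L_def using C K l \<tau> by (intro add_nonneg_pos divide_nonneg_pos mult_nonneg_nonneg) auto
  have \<epsilon>: "\<epsilon> > 0" "2 * \<epsilon> \<le> \<eta>" "\<epsilon> * L \<le> \<eta> / 4" using \<eta> L by (auto simp: \<epsilon>_def min_def field_simps)
  have Kt: "C * (2 * K * \<tau>) / l \<le> \<eta> / 4"
  proof -
    have "C * (2 * K * \<tau>) / l \<le> C * (2 * K * (\<eta> * l / (8 * C * K))) / l"
      using C K l \<tau> by (intro divide_right_mono mult_left_mono) auto
    also have "\<dots> = \<eta> / 4" using C K l by simp
    finally show ?thesis .
  qed
  have "\<forall>\<^sub>F N in sequentially. real N \<ge> 8 * C / (l * \<eta>)"
    by (rule eventually_compose_filterlim[OF eventually_ge_at_top filterlim_real_sequentially])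
  with eventually_sequentially_Suc[THEN iffD2, OF lim[OF \<epsilon>(1)]] show ?thesis
  proof eventually_elim
    case (elim N)
    interpret block_code p q N "msgs (Suc N) R" "enc (Suc N)" "dec (Suc N)"
      using is_code_block_code[OF code] .
    have dist: "dist \<le> 2 * \<epsilon>" using elim(1) is_code_dist[OF code, of N] by simp
    have leak: "leak \<le> real n * \<epsilon>" using elim(1) unfolding code_leak_def by simp
    obtain f where f: "total_err f \<le> C * ((\<Sum>i<n. kl_at i) / l + real n * l + real n * (2 * dist))"
      using exists_estimators[OF c \<rho> l] unfolding C_def by blast
    have ln_nn: "ln (2 * K) \<ge> 0" "ln (1 / \<tau>) \<ge> 0" using K \<tau> by auto
    have "(\<Sum>i<n. kl_at i)
       \<le> ln 2 * leak + 2 + real n * (2 * dist * ln (2 * K) + 2 * dist * ln (1 / \<tau>) + 2 * K * \<tau>)"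
      unfolding K_def using \<tau> by (intro sum_kl_le)
    also have "\<dots> \<le> ln 2 * (real n * \<epsilon>) + 2 + real n * (2 * (2 * \<epsilon>) * ln (2 * K) + 2 * (2 * \<epsilon>) * ln (1 / \<tau>) + 2 * K * \<tau>)"
      using dist leak ln_nn by (intro add_mono mult_left_mono mult_right_mono order.refl) auto
    finally have "total_err f \<le> C * ((ln 2 * (real n * \<epsilon>) + 2
         + real n * (2 * (2 * \<epsilon>) * ln (2 * K) + 2 * (2 * \<epsilon>) * ln (1 / \<tau>) + 2 * K * \<tau>)) / l + real n * l + real n * (2 * (2 * \<epsilon>)))"
      using f dist C l by (intro order.trans[OF f] mult_left_mono add_mono divide_right_mono order.refl) auto
    also have "\<dots> = real n * (\<epsilon> * L) + real n * (C * (2 * K * \<tau>) / l) + 2 * C / l + real n * (C * l)"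
      unfolding L_def by (simp add: algebra_simps add_divide_distrib del: of_nat_Suc)
    also have "\<dots> \<le> real n * (\<eta> / 4) + real n * (\<eta> / 4) + real n * (\<eta> / 4) + real n * (\<eta> / 4)"
    proof (intro add_mono mult_left_mono)
      show "C * l \<le> \<eta> / 4" using C by (simp add: l_def)
      have "2 * C / l = (8 * C / (l * \<eta>)) * (\<eta> / 4)" using \<eta> by simp
      also have "\<dots> \<le> real n * (\<eta> / 4)" using elim(2) \<eta> by (intro mult_right_mono) auto
      finally show "2 * C / l \<le> real n * (\<eta> / 4)" .
    qed (use \<epsilon> Kt in auto)
    also have "\<dots> = real n * \<eta>" by (simp only: distrib_left[symmetric]) simp
    finally have "total_err f \<le> real n * \<eta>" .
    moreover have "dist \<le> \<eta>" using dist \<epsilon> by linarith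
    ultimately show ?case using block_code_axioms by blast
  qed
qed

definition class_prob :: "'x \<Rightarrow> 'y \<Rightarrow> ('x \<Rightarrow> real) \<Rightarrow> real" where
  "class_prob x y j = (\<Sum>z\<in>UNIV. of_bool (col q y z = j) * q x y z)"

text \<open>The estimator does not see the current \<open>y\<close>, so neither can the law of the class given \<open>x\<close>.\<close>

lemma class_prob_indep:
  assumes R: "achievable p q R"
  shows "class_prob x y j = class_prob x y' j"
proof -
  obtain c where c: "c > 0" "\<And>x y. c \<le> p x y" using p_lower_bound by blast
  have close: "\<bar>class_prob x y j - class_prob x y' j\<bar> \<le> 0 + e" if e: "0 < e" for e
  proof -
    \<comment> \<open>\<open>class_probability\<close> is applied at \<open>y\<close> and at
      \<open>y'\<close>, each time with error \<eta> + \<eta> / c; together this is \<eta> * w =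
      e.\<close>
    define w where "w = 2 + 2 / c"
    define \<eta> where "\<eta> = e / w"
    have w: "w > 0" unfolding w_def using c by (simp add: add_pos_pos)
    have \<eta>: "\<eta> > 0" unfolding \<eta>_def using e w by (rule divide_pos_pos)
    obtain N enc dec f where "block_code p q N (msgs (Suc N) R) enc dec"
      and d: "block_code.dist p q N (msgs (Suc N) R) enc dec \<le> \<eta>"
      and err: "block_code.total_err p q N (msgs (Suc N) R) enc dec f \<le> real (Suc N) * \<eta>"
      using eventually_happens'[OF _ vanishing_error[OF R \<eta>]] by auto
    then interpret block_code p q N "msgs (Suc N) R" enc dec by simp
    \<comment> \<open>The errors average to at most \<eta>. One good coordinate suffices, as
      \<open>class_prob\<close> does not depend on the coordinate.\<close>
    have "\<exists>i<n. err_at i (f i) \<le> \<eta>"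
    proof (rule ccontr)
      assume "\<not> ?thesis"
      then have "(\<Sum>i<n. \<eta>) < (\<Sum>i<n. err_at i (f i))"
        by (intro sum_strict_mono) (auto simp: not_le)
      then show False using err unfolding total_err_def by simp
    qed
    then obtain i where i: "i \<le> N" "err_at i (f i) \<le> \<eta>" by (auto simp: less_Suc_eq_le)
    interpret test_channel p q U "v i" "r i" using single_letter[OF i(1)] .
    have tv: "tv / c \<le> \<eta> / c" using tv_le_dist[OF i(1)] d c by (intro divide_right_mono) auto
    have "\<bar>class_prob x y j - (\<Sum>u\<in>U. of_bool (f i u = j) * v i u x)\<bar> \<le> \<eta> + \<eta> / c" for y
      unfolding class_prob_def using class_probability[OF c, of y j x "f i"] i(2) tv by linarith
    note estimate = this
    define V where "V = (\<Sum>u\<in>U. of_bool (f i u = j) * v i u x)"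
    have "\<bar>class_prob x y j - class_prob x y' j\<bar> \<le> \<bar>class_prob x y j - V\<bar> + \<bar>class_prob x y' j - V\<bar>"
      using abs_triangle_ineq4[of "class_prob x y j - V" "class_prob x y' j - V"] by simp
    also have "\<dots> \<le> (\<eta> + \<eta> / c) + (\<eta> + \<eta> / c)"
      unfolding V_def by (rule add_mono[OF estimate[of y] estimate[of y']])
    also have "\<dots> = \<eta> * w" unfolding w_def distrib_left by simp
    also have "\<dots> = e" unfolding \<eta>_def using w by simp
    finally show ?thesis by simp
  qed
  have "\<bar>class_prob x y j - class_prob x y' j\<bar> \<le> 0" using close by (rule field_le_epsilon)
  then show ?thesis by simp
qed

subsection \<open>Converse\<close>

definition pY :: "'y \<Rightarrow> real" where "pY y = (\<Sum>x\<in>UNIV. p x y)"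

definition pWY :: "('x \<Rightarrow> real) \<Rightarrow> 'y \<Rightarrow> real" where
  "pWY j y = (\<Sum>z\<in>UNIV. of_bool (col q y z = j) * margin y z)"

text \<open>H(W|Y) in nats, summed over the columns themselves as labels, so that the classes need
  no numbering before \<open>secure_rate_eq\<close>.\<close>

definition cond_entropy :: real where
  "cond_entropy = - (\<Sum>y\<in>UNIV. \<Sum>j\<in>cols q. pWY j y * ln (pWY j y / pY y))"

lemma pY_pos: "pY y > 0"
  unfolding pY_def by (intro sum_pos) (auto simp: p_pos)

lemma pWY_nonneg: "pWY j y \<ge> 0"
  unfolding pWY_def by (intro sum_nonneg) (auto simp: margin_nonneg)

lemma margin_le_pWY: "margin y z \<le> pWY (col q y z) y"
  using member_le_sum[of z UNIV "\<lambda>z'. of_bool (col q y z' = col q y z) * margin y z'"]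
  by (simp add: pWY_def margin_nonneg)

lemma margin_outside: "col q y z \<notin> cols q \<Longrightarrow> margin y z = 0"
  by (cases "z \<in> Zsupp q y") (auto simp: cols_def margin_def not_in_Zsupp)

lemma sum_margin_by_class: 
  "(\<Sum>z\<in>UNIV. margin y z * h (col q y z)) = (\<Sum>j\<in>cols q. pWY j y * h j)"
proof -
  have "(\<Sum>j\<in>cols q. pWY j y * h j) = (\<Sum>z\<in>UNIV. \<Sum>j\<in>cols q. if j = col q y z then margin y z * h j else 0)"
    unfolding pWY_def sum_distrib_right by (subst sum.swap) (auto intro!: sum.cong)
  also have "\<dots> = (\<Sum>z\<in>UNIV. margin y z * h (col q y z))"
    by (intro sum.cong refl) (simp add: margin_outside)
  finally show ?thesis by simp
qed

lemma cond_entropy_eq: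
  "cond_entropy = - (\<Sum>y\<in>UNIV. \<Sum>z\<in>UNIV. \<Sum>x\<in>UNIV. p x y * q x y z * ln (pWY (col q y z) y / pY y))"
  unfolding cond_entropy_def sum_margin_by_class[symmetric] margin_def sum_distrib_right ..

end

context block_code
begin

text \<open>The true weight of \<open>(u, y)\<close> is \<open>t u y\<close>, and p x y \<le> 1
  bounds it by \<open>s u\<close>, the weight in \<open>err\<close>.\<close>

lemma letter_error:
  assumes i: "i \<le> N"
  shows "(\<Sum>ys\<in>seqs n. \<Sum>zs\<in>seqs n. \<Sum>xs\<in>seqs n. \<Sum>m\<in>Msg.
      A m ys xs * dec m ys zs * of_bool (col q (ys ! i) (zs ! i) \<noteq> f (m, del i ys)))
    \<le> err_at i f"
proof -
  interpret test_channel p q U "v i" "r i" using single_letter[OF i] .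
  have "(\<Sum>ys\<in>seqs n. \<Sum>zs\<in>seqs n. \<Sum>xs\<in>seqs n. \<Sum>m\<in>Msg.
      A m ys xs * dec m ys zs * of_bool (col q (ys ! i) (zs ! i) \<noteq> f (m, del i ys)))
    = (\<Sum>y\<in>UNIV. \<Sum>z\<in>UNIV. \<Sum>u\<in>U. \<Sum>x\<in>UNIV. p x y * v i u x * r i u y z * of_bool (col q y z \<noteq> f u))"
    by (rule letter_sum[OF i, of "\<lambda>u x y z. of_bool (col q y z \<noteq> f u)"])
  also have "\<dots> = (\<Sum>y\<in>UNIV. \<Sum>z\<in>UNIV. \<Sum>u\<in>U. t u y * (r i u y z * of_bool (col q y z \<noteq> f u)))"
    unfolding t_def sum_distrib_right by (simp only: mult.assoc)
  also have "\<dots> \<le> (\<Sum>y\<in>UNIV. \<Sum>z\<in>UNIV. \<Sum>u\<in>U. s u * (r i u y z * of_bool (col q y z \<noteq> f u)))"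
    by (intro sum_mono mult_right_mono t_le_s) (auto simp: r_nonneg)
  also have "\<dots> = err f" unfolding err_def by (simp only: mult.assoc)
  finally show ?thesis .
qed

text \<open>Given \<open>(M,Y)\<close>, every class is estimated correctly up to a small fraction of errors, so mixing the
  product laws \<open>G m\<close> around the estimates over the messages yields a test law \<open>T\<close> whose code length on
  the class sequence exceeds \<open>ln (card Msg)\<close> only slightly. It is bounded below, hence the
  comparison survives the passage from the code to the target.\<close>

lemma converse:
  assumes \<tau>: "0 < \<tau>" "\<tau> < 1"
  defines "\<kappa> \<equiv> ln (real (card (cols q)) / \<tau>)"
  shows "real n * cond_entropy \<le> ln (real (card Msg)) - real n * ln (1 - \<tau>) + total_err f * \<kappa> + real n * dist * \<kappa>"
proof -
  let ?S = "\<lambda>F. \<Sum>ys\<in>seqs n. \<Sum>zs\<in>seqs n. \<Sum>xs\<in>seqs n. F ys zs xs"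
  let ?j = "\<lambda>i ys zs. col q (ys ! i) (zs ! i)" and ?mu = "\<lambda>i ys zs. margin (ys ! i) (zs ! i)" and ?f = "\<lambda>i m ys. f i (m, del i ys)"
  define k where "k = real (card (cols q))"
  have k: "k \<ge> 1" unfolding k_def using cols_nonempty by (simp add: Suc_le_eq card_gt_0_iff)
  have \<kappa>: "\<kappa> = ln (k / \<tau>)" "\<kappa> \<ge> 0" using k \<tau> by (auto simp: \<kappa>_def k_def[symmetric])
  \<comment> \<open>A point mass at the estimate \<open>j'\<close>, mixed with weight \<tau> with
    the uniform law on the labels (a subprobability if \<open>j'\<close> is not a label). A correct
    label costs at most -ln (1 - \<tau>), a wrong one \<kappa>, and no label more than
    \<kappa>.\<close>
  define g :: "('x \<Rightarrow> real) \<Rightarrow> ('x \<Rightarrow> real) \<Rightarrow> real" where "g j j' = (1 - \<tau>) * of_bool (j = j') + \<tau> / k" for j j'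
  have g_ge: "\<tau> / k \<le> g j j'" and g_pos: "g j j' > 0" for j j'
    using \<tau> k by (auto simp: g_def intro: add_nonneg_pos)
  have g_le: "g j j' \<le> 1" for j j'
  proof -
    have "\<tau> / k \<le> \<tau>" using \<tau> k by (simp add: field_simps)
    then show ?thesis using \<tau> by (auto simp: g_def of_bool_def)
  qed
  have g_sum: "(\<Sum>j\<in>cols q. g j j') \<le> 1" for j'
  proof -
    have "(\<Sum>j\<in>cols q. g j j') = (1 - \<tau>) * (\<Sum>j\<in>cols q. of_bool (j = j')) + \<tau>"
      using k cols_nonempty by (simp add: g_def sum.distrib sum_distrib_left k_def)
    also have "(\<Sum>j\<in>cols q. of_bool (j = j')) \<le> (1 :: real)"
      by (cases "j' \<in> cols q") (auto simp: of_bool_def)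
    finally show ?thesis using \<tau> by simp
  qed
  have ln_g: "- ln (g j j') \<le> - ln (1 - \<tau>) + \<kappa> * of_bool (j \<noteq> j')" for j j'
  proof (cases "j = j'")
    case True
    have "1 - \<tau> \<le> g j j'" using True \<tau> k by (simp add: g_def)
    then show ?thesis using True \<tau> g_pos[of j j'] by simp
  next
    case False
    have "- ln (g j j') = \<kappa>" using False \<tau> k unfolding \<kappa> by (simp add: g_def ln_divide_pos)
    moreover have "ln (1 - \<tau>) \<le> 0" using \<tau> by simp
    ultimately show ?thesis using False by simp
  qed
  define M where "M = real (card Msg)"
  have M: "M \<ge> 1" unfolding M_def by (rule card_Msg_ge_1)
  then have "Msg \<noteq> {}" by (auto simp: M_def)
  define G where "G m ys zs = (\<Prod>i<n. g (?j i ys zs) (?f i m ys))" for m ys zs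
  define T where "T ys zs = (\<Sum>m\<in>Msg. G m ys zs / M)" for ys zs
  have G_pos: "G m ys zs > 0" and G_le: "G m ys zs \<le> 1" and G_ge: "(\<tau> / k) ^ n \<le> G m ys zs" for m ys zs
  proof -
    show "G m ys zs > 0" unfolding G_def using g_pos by (intro prod_pos) auto
    show "G m ys zs \<le> 1" unfolding G_def using g_le g_pos by (intro prod_le_1) (auto simp: less_imp_le)
    have "(\<Prod>i<n. \<tau> / k) \<le> G m ys zs" unfolding G_def using g_ge \<tau> k by (intro prod_mono) auto
    then show "(\<tau> / k) ^ n \<le> G m ys zs" by (simp del: power_Suc)
  qed
  have T_pos: "T ys zs > 0" for ys zs
    unfolding T_def using \<open>Msg \<noteq> {}\<close> finite_Msg G_pos M by (intro sum_pos) auto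
  have T_ge_G: "G m ys zs / M \<le> T ys zs" if "m \<in> Msg" for m ys zs
    unfolding T_def using that finite_Msg G_pos M by (intro member_le_sum[of m Msg "\<lambda>m. G m ys zs / M"]) (auto simp: less_imp_le)
  have T_le: "T ys zs \<le> 1" for ys zs
  proof -
    have "T ys zs \<le> (\<Sum>m\<in>Msg. 1 / M)" unfolding T_def using G_le M by (intro sum_mono divide_right_mono) auto
    then show ?thesis using M by (simp add: M_def)
  qed
  have T_ge: "(\<tau> / k) ^ n \<le> T ys zs" for ys zs
  proof -
    have "(\<Sum>m\<in>Msg. (\<tau> / k) ^ n / M) \<le> T ys zs" unfolding T_def using G_ge M by (intro sum_mono divide_right_mono) auto
    then show ?thesis using M by (simp add: M_def)
  qed
  have ln_T: "- ln (T ys zs) \<le> real n * \<kappa>" "- ln (T ys zs) \<ge> 0" for ys zs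
  proof -
    have "ln ((\<tau> / k) ^ n) \<le> ln (T ys zs)" using T_ge[of ys zs] T_pos[of ys zs] \<tau> k by (subst ln_le_cancel_iff) auto
    moreover have "ln ((\<tau> / k) ^ n) = - (real n * \<kappa>)"
      using \<tau> k by (subst ln_realpow) (auto simp: \<kappa> ln_divide_pos algebra_simps)
    ultimately show "- ln (T ys zs) \<le> real n * \<kappa>" by linarith
    show "- ln (T ys zs) \<ge> 0" using T_le[of ys zs] T_pos[of ys zs] by simp
  qed
  \<comment> \<open>The conditional probability of the class of \<open>z\<close> given
    \<open>y\<close>, so that -ln \<Omega> has mean \<open>real n * cond_entropy\<close> under the
    target.\<close>
  define \<omega> where "\<omega> y z = pWY (col q y z) y / pY y" for y z
  define \<Omega> where "\<Omega> ys zs = (\<Prod>i<n. \<omega> (ys ! i) (zs ! i))" for ys zs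
  define Q where "Q ys zs xs = target_n p q n xs ys zs" for ys zs xs
  have Q_nonneg: "Q ys zs xs \<ge> 0" for ys zs xs by (simp add: Q_def target_nonneg)
  have \<omega>_nonneg: "\<omega> y z \<ge> 0" for y z unfolding \<omega>_def using pWY_nonneg pY_pos by (simp add: less_imp_le)
  have \<omega>_pos: "\<omega> (ys ! i) (zs ! i) > 0" if "Q ys zs xs > 0" "i < n" for ys zs xs i
  proof -
    have "p (xs ! i) (ys ! i) * q (xs ! i) (ys ! i) (zs ! i) \<noteq> 0"
    proof
      assume "p (xs ! i) (ys ! i) * q (xs ! i) (ys ! i) (zs ! i) = 0"
      then have "Q ys zs xs = 0"
        unfolding Q_def target_eq_prod using that(2) by (intro prod_zero) auto
      then show False using that(1) by simp
    qed
    then have "0 < p (xs ! i) (ys ! i) * q (xs ! i) (ys ! i) (zs ! i)"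
      by (simp add: less_le p_nonneg q_nonneg)
    also have "\<dots> \<le> ?mu i ys zs"
      unfolding margin_def by (intro member_le_sum) (auto simp: p_nonneg q_nonneg)
    also have "\<dots> \<le> pWY (?j i ys zs) (ys ! i)" by (rule margin_le_pWY)
    finally show ?thesis unfolding \<omega>_def using pY_pos by simp
  qed
  have \<Omega>_pos: "\<Omega> ys zs > 0" if "Q ys zs xs > 0" for ys zs xs
    unfolding \<Omega>_def using \<omega>_pos[OF that] by (intro prod_pos) auto
  define S where "S = (seqs n :: 'y list set) \<times> (seqs n :: 'z list set) \<times> (seqs n :: 'x list set)"
  \<comment> \<open>Multiplying by T / \<Omega> exchanges the true law of the class sequence given
    \<open>ys\<close> for the test law, so the mass stays at most 1. The estimates use
    \<open>m\<close> and \<open>ys\<close> but not \<open>zs\<close>; hence for fixed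
    \<open>m\<close> and \<open>ys\<close> the sum over \<open>zs\<close> factorises.\<close>
  have b_sum: "?S (\<lambda>ys zs xs. Q ys zs xs * (T ys zs / \<Omega> ys zs)) \<le> 1"
  proof -
    have "?S (\<lambda>ys zs xs. Q ys zs xs * (T ys zs / \<Omega> ys zs))
      = (\<Sum>ys\<in>seqs n. \<Sum>zs\<in>seqs n. \<Sum>m\<in>Msg. (\<Prod>i<n. ?mu i ys zs) * G m ys zs / \<Omega> ys zs / M)"
      unfolding sum_distrib_right[symmetric] Q_def sum_target_x
      by (intro sum.cong refl) (simp add: T_def sum_divide_distrib sum_distrib_left sum_distrib_right mult_ac
          del: prod.lessThan_Suc)
    also have "\<dots> = (\<Sum>ys\<in>seqs n. \<Sum>m\<in>Msg. \<Sum>zs\<in>seqs n. (\<Prod>i<n. ?mu i ys zs) * G m ys zs / \<Omega> ys zs / M)"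
      by (intro sum.cong refl sum.swap)
    also have "\<dots> = (\<Sum>ys\<in>seqs n. \<Sum>m\<in>Msg. (\<Sum>zs\<in>seqs n. (\<Prod>i<n. ?mu i ys zs) * G m ys zs / \<Omega> ys zs) / M)"
      by (simp only: sum_divide_distrib)
    also have "\<dots> \<le> (\<Sum>ys\<in>seqs n. \<Sum>m\<in>Msg. (\<Prod>i<n. pY (ys ! i)) / M)"
    proof (intro sum_mono divide_right_mono)
      fix ys :: "'y list" and m
      have "(\<Sum>zs\<in>seqs n. (\<Prod>i<n. ?mu i ys zs) * G m ys zs / \<Omega> ys zs)
        = (\<Sum>zs\<in>seqs n. \<Prod>i<n. ?mu i ys zs * g (?j i ys zs) (?f i m ys) / \<omega> (ys ! i) (zs ! i))"
        unfolding G_def \<Omega>_def prod.distrib prod_dividef ..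
      also have "\<dots> = (\<Prod>i<n. \<Sum>z\<in>UNIV. margin (ys ! i) z * g (col q (ys ! i) z) (?f i m ys) / \<omega> (ys ! i) z)"
        by (rule sum_prod_seqs)
      also have "\<dots> \<le> (\<Prod>i<n. pY (ys ! i))"
      proof (intro prod_mono conjI)
        fix i
        define y j' where "y = ys ! i" and "j' = ?f i m ys"
        show "0 \<le> (\<Sum>z\<in>UNIV. margin (ys ! i) z * g (col q (ys ! i) z) (?f i m ys) / \<omega> (ys ! i) z)"
          using g_pos by (intro sum_nonneg divide_nonneg_nonneg mult_nonneg_nonneg margin_nonneg \<omega>_nonneg) (auto simp: less_imp_le)
        have "(\<Sum>z\<in>UNIV. margin y z * g (col q y z) j' / \<omega> y z)
          = (\<Sum>z\<in>UNIV. margin y z * (g (col q y z) j' / (pWY (col q y z) y / pY y)))"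
          unfolding \<omega>_def by (simp only: times_divide_eq_right)
        also have "\<dots> = (\<Sum>j\<in>cols q. pWY j y * (g j j' / (pWY j y / pY y)))"
          by (rule sum_margin_by_class)
        \<comment> \<open>Termwise an equality, except that the left summand is 0 where
          \<open>pWY j y\<close> is 0.\<close>
        also have "\<dots> \<le> (\<Sum>j\<in>cols q. pY y * g j j')"
          using pY_pos[of y] g_pos by (intro sum_mono) (auto simp: less_imp_le)
        also have "\<dots> \<le> pY y"
          unfolding sum_distrib_left[symmetric] using g_sum pY_pos[of y] by (simp add: mult_left_le)
        finally show "(\<Sum>z\<in>UNIV. margin (ys ! i) z * g (col q (ys ! i) z) (?f i m ys) / \<omega> (ys ! i) z) \<le> pY (ys ! i)"
          unfolding y_def j'_def .
      qed
      finally show "(\<Sum>zs\<in>seqs n. (\<Prod>i<n. ?mu i ys zs) * G m ys zs / \<Omega> ys zs) \<le> (\<Prod>i<n. pY (ys ! i))" .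
    qed (use M in auto)
    also have "\<dots> = (\<Sum>ys\<in>seqs n. (\<Prod>i<n. pY (ys ! i)))"
      using M by (simp add: M_def)
    also have "\<dots> = (\<Prod>i<n. \<Sum>y\<in>UNIV. pY y)" by (rule sum_prod_seqs)
    also have "\<dots> = 1" unfolding pY_def p_sum' by simp
    finally show ?thesis .
  qed
  have "(\<Sum>w\<in>S. (\<lambda>(ys, zs, xs). Q ys zs xs) w * ln ((\<lambda>(ys, zs, xs). Q ys zs xs * (T ys zs / \<Omega> ys zs)) w))
    \<le> (\<Sum>w\<in>S. (\<lambda>(ys, zs, xs). Q ys zs xs) w * ln ((\<lambda>(ys, zs, xs). Q ys zs xs) w))
     + (\<Sum>w\<in>S. (\<lambda>(ys, zs, xs). Q ys zs xs * (T ys zs / \<Omega> ys zs)) w) - (\<Sum>w\<in>S. (\<lambda>(ys, zs, xs). Q ys zs xs) w)"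
  proof (rule gibbs_inequality)
    fix w assume "w \<in> S"
    obtain ys zs xs where w: "w = (ys, zs, xs)" by (cases w)
    show "0 \<le> (\<lambda>(ys, zs, xs). Q ys zs xs) w" using w Q_nonneg by simp
    have "\<Omega> ys zs \<ge> 0" unfolding \<Omega>_def using \<omega>_nonneg by (intro prod_nonneg) auto
    then show "0 \<le> (\<lambda>(ys, zs, xs). Q ys zs xs * (T ys zs / \<Omega> ys zs)) w" using w Q_nonneg T_pos by (simp add: less_imp_le)
    assume "0 < (\<lambda>(ys, zs, xs). Q ys zs xs) w"
    then show "0 < (\<lambda>(ys, zs, xs). Q ys zs xs * (T ys zs / \<Omega> ys zs)) w" using w T_pos \<Omega>_pos by simp
  qed
  \<comment> \<open>The reweighted law has mass at most 1 and the target mass 1, so the mass terms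
    drop. Once the terms in ln Q cancel, this says that -ln T has at least the target mean of -ln
    \<Omega>.\<close>
  then have gibbs: "?S (\<lambda>ys zs xs. Q ys zs xs * ln (Q ys zs xs * (T ys zs / \<Omega> ys zs)))
      \<le> ?S (\<lambda>ys zs xs. Q ys zs xs * ln (Q ys zs xs))"
    using b_sum sum_target[of n] unfolding S_def sum.cartesian_product' split Q_def by linarith
  have "Q ys zs xs * ln (Q ys zs xs * (T ys zs / \<Omega> ys zs))
      = Q ys zs xs * ln (Q ys zs xs) + Q ys zs xs * ln (T ys zs) - Q ys zs xs * (\<Sum>i<n. ln (\<omega> (ys ! i) (zs ! i)))" for ys zs xs
  proof (cases "Q ys zs xs > 0")
    case True
    have "ln (\<Omega> ys zs) = (\<Sum>i<n. ln (\<omega> (ys ! i) (zs ! i)))"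
      unfolding \<Omega>_def by (rule ln_prod) (use \<omega>_pos[OF True] in fastforce)+
    moreover have "ln (Q ys zs xs * (T ys zs / \<Omega> ys zs)) = ln (Q ys zs xs) + (ln (T ys zs) - ln (\<Omega> ys zs))"
      using True \<Omega>_pos[OF True] T_pos[of ys zs]
      by (simp add: ln_mult ln_divide_pos del: times_divide_eq_right)
    ultimately show ?thesis by (simp only: distrib_left right_diff_distrib)
  next
    case False
    then show ?thesis using Q_nonneg[of ys zs xs] by simp
  qed
  note gibbs[unfolded this sum.distrib sum_subtractf]
  moreover have "?S (\<lambda>ys zs xs. Q ys zs xs * (\<Sum>i<n. ln (\<omega> (ys ! i) (zs ! i)))) = - (real n * cond_entropy)"
    using target_sum_additive[of n "\<lambda>y z. ln (\<omega> y z)"] unfolding Q_def cond_entropy_eq \<omega>_def by simp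
  ultimately have 1: "real n * cond_entropy \<le> ?S (\<lambda>ys zs xs. Q ys zs xs * - ln (T ys zs))"
    by (simp add: sum_negf)
  have "?S (\<lambda>ys zs xs. Q ys zs xs * - ln (T ys zs))
    \<le> ?S (\<lambda>ys zs xs. Out ys zs xs * - ln (T ys zs) + \<bar>Out ys zs xs - Q ys zs xs\<bar> * (real n * \<kappa>))"
  proof (intro sum_mono)
    fix ys zs xs
    have "(Q ys zs xs - Out ys zs xs) * - ln (T ys zs) \<le> \<bar>Out ys zs xs - Q ys zs xs\<bar> * (real n * \<kappa>)"
      using ln_T[of ys zs] by (intro mult_mono) auto
    then show "Q ys zs xs * - ln (T ys zs) \<le> Out ys zs xs * - ln (T ys zs) + \<bar>Out ys zs xs - Q ys zs xs\<bar> * (real n * \<kappa>)"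
      unfolding left_diff_distrib by linarith
  qed
  also have "\<dots> = ?S (\<lambda>ys zs xs. Out ys zs xs * - ln (T ys zs)) + dist * (real n * \<kappa>)"
    unfolding sum.distrib sum_distrib_right[symmetric] dist_def Q_def ..
  finally have 2: "?S (\<lambda>ys zs xs. Q ys zs xs * - ln (T ys zs))
    \<le> ?S (\<lambda>ys zs xs. Out ys zs xs * - ln (T ys zs)) + dist * (real n * \<kappa>)" .
  define c0 where "c0 = ln M - real n * ln (1 - \<tau>)"
  have "?S (\<lambda>ys zs xs. Out ys zs xs * - ln (T ys zs))
     = ?S (\<lambda>ys zs xs. \<Sum>m\<in>Msg. A m ys xs * dec m ys zs * - ln (T ys zs))"
    unfolding Out_def sum_distrib_right ..
  also have "\<dots> \<le> ?S (\<lambda>ys zs xs. \<Sum>m\<in>Msg. A m ys xs * dec m ys zs * c0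
      + (\<Sum>i<n. A m ys xs * dec m ys zs * of_bool (?j i ys zs \<noteq> ?f i m ys)) * \<kappa>)"
  proof (intro sum_mono)
    fix ys :: "'y list" and zs :: "'z list" and xs :: "'x list" and m
    assume *: "ys \<in> seqs n" "zs \<in> seqs n" "xs \<in> seqs n" "m \<in> Msg"
    \<comment> \<open>The component of the message actually sent has weight 1 / M in the mixture;
      this is where the size of the message set enters.\<close>
    have "ln (G m ys zs / M) \<le> ln (T ys zs)"
      using T_ge_G[OF *(4)] G_pos M T_pos by (subst ln_le_cancel_iff) auto
    then have "- ln (T ys zs) \<le> ln M - ln (G m ys zs)" using G_pos[of m ys zs] M by (simp add: ln_divide_pos)
    also have "ln (G m ys zs) = (\<Sum>i<n. ln (g (?j i ys zs) (?f i m ys)))"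
      unfolding G_def by (rule ln_prod) (use g_pos in \<open>auto simp: less_imp_neq[symmetric]\<close>)
    also have "ln M - \<dots> = ln M + (\<Sum>i<n. - ln (g (?j i ys zs) (?f i m ys)))"
      by (simp add: sum_negf)
    also have "\<dots> \<le> ln M + (\<Sum>i<n. - ln (1 - \<tau>) + \<kappa> * of_bool (?j i ys zs \<noteq> ?f i m ys))"
      using ln_g by (intro add_left_mono sum_mono)
    also have "\<dots> = c0 + (\<Sum>i<n. of_bool (?j i ys zs \<noteq> ?f i m ys)) * \<kappa>"
      unfolding c0_def sum.distrib sum_constant sum_distrib_right card_lessThan
      by (simp add: mult.commute[of \<kappa>] del: sum.lessThan_Suc of_nat_Suc)
    finally have "A m ys xs * dec m ys zs * - ln (T ys zs)
       \<le> A m ys xs * dec m ys zs * (c0 + (\<Sum>i<n. of_bool (?j i ys zs \<noteq> ?f i m ys)) * \<kappa>)"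
      using * by (intro mult_left_mono mult_nonneg_nonneg A_nonneg dec_nonneg)
    then show "A m ys xs * dec m ys zs * - ln (T ys zs) \<le> A m ys xs * dec m ys zs * c0
      + (\<Sum>i<n. A m ys xs * dec m ys zs * of_bool (?j i ys zs \<noteq> ?f i m ys)) * \<kappa>"
      by (simp only: distrib_left sum_distrib_left[symmetric] mult.assoc)
  qed
  also have "\<dots> = c0 + (\<Sum>i<n. \<Sum>ys\<in>seqs n. \<Sum>zs\<in>seqs n. \<Sum>xs\<in>seqs n. \<Sum>m\<in>Msg.
      A m ys xs * dec m ys zs * of_bool (?j i ys zs \<noteq> ?f i m ys)) * \<kappa>"
    unfolding sum.distrib sum_distrib_right[symmetric] Out_def[symmetric] sum_Out
    by (simp only: sum.swap[of _ _ "{..<n}"])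
  also have "\<dots> \<le> c0 + total_err f * \<kappa>"
    unfolding total_err_def using \<kappa>(2) by (intro add_left_mono mult_right_mono sum_mono letter_error) auto
  finally show ?thesis using 1 2 unfolding c0_def M_def by (simp only: mult_ac)
qed

end

context source_channel
begin

lemma converse_rate:
  assumes R: "achievable p q R"
  shows "cond_entropy / ln 2 \<le> R"
proof -
  have "cond_entropy \<le> R * ln 2 + e" if e: "e > 0" for e
  proof -
    \<comment> \<open>Splits \<open>e\<close> into e / 2 for -ln (1 - \<tau>) and e / 4 for each of
      the two terms with \<kappa>; \<eta> is fixed after \<kappa>, which depends on \<tau>.\<close>
    define \<tau> where "\<tau> = 1 - exp (- (e / 2))"
    have \<tau>: "0 < \<tau>" "\<tau> < 1" using e by (auto simp: \<tau>_def)
    have ln\<tau>: "- ln (1 - \<tau>) = e / 2" by (simp add: \<tau>_def)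
    define \<kappa> where "\<kappa> = ln (real (card (cols q)) / \<tau>)"
    have "real (card (cols q)) \<ge> 1" using cols_nonempty by (simp add: Suc_le_eq card_gt_0_iff)
    then have \<kappa>: "\<kappa> \<ge> 0" using \<tau> by (simp add: \<kappa>_def)
    define \<eta> where "\<eta> = e / 4 / (\<kappa> + 1)"
    have \<eta>: "\<eta> > 0" using e \<kappa> by (simp add: \<eta>_def)
    have \<eta>\<kappa>: "\<eta> * \<kappa> \<le> e / 4"
    proof -
      have "\<eta> * \<kappa> \<le> \<eta> * (\<kappa> + 1)" using \<eta> by (intro mult_left_mono) auto
      also have "\<dots> = e / 4" using \<kappa> nonzero_eq_divide_eq[of "\<kappa> + 1" \<eta> "e / 4"] by (simp only: \<eta>_def) simp
      finally show ?thesis .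
    qed
    obtain N enc dec f where "block_code p q N (msgs (Suc N) R) enc dec"
      and d: "block_code.dist p q N (msgs (Suc N) R) enc dec \<le> \<eta>"
      and err: "block_code.total_err p q N (msgs (Suc N) R) enc dec f \<le> real (Suc N) * \<eta>"
      using eventually_happens'[OF _ vanishing_error[OF R \<eta>]] by auto
    then interpret block_code p q N "msgs (Suc N) R" enc dec by simp
    have "ln (real (card (msgs n R))) \<le> real n * (R * ln 2)"
      by (rule ln_card_msgs_le[OF card_Msg_ge_1])
    moreover have "total_err f * \<kappa> \<le> real n * (\<eta> * \<kappa>)"
      using mult_right_mono[OF err \<kappa>] by (simp add: mult.assoc)
    moreover have "real n * dist * \<kappa> \<le> real n * (\<eta> * \<kappa>)"
      using mult_left_mono[OF mult_right_mono[OF d \<kappa>], of "real n"] by (simp add: mult.assoc)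
    moreover have "real n * (\<eta> * \<kappa>) \<le> real n * (e / 4)" using \<eta>\<kappa> by (intro mult_left_mono) auto
    moreover have "- real n * ln (1 - \<tau>) = real n * (e / 2)" using ln\<tau> by (simp only: mult_minus_left mult_minus_right[symmetric])
    moreover note converse[OF \<tau>, of f, folded \<kappa>_def]
    ultimately have "real n * cond_entropy \<le> real n * (R * ln 2) + real n * (e / 2) + real n * (e / 4) + real n * (e / 4)"
      by linarith
    also have "\<dots> = real n * (R * ln 2 + e)" by (simp only: distrib_left[symmetric]) simp
    finally show ?thesis by (simp del: of_nat_Suc)
  qed
  then have "cond_entropy \<le> R * ln 2" by (rule field_le_epsilon)
  then show ?thesis by (simp add: field_simps)
qed

end

subsection \<open>Achievability\<close>

text \<open>Binning by the method of conditional expectations: each new point goes to the bin in which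
  it causes the least collision cost, which is at most the average over all bins.\<close>

lemma exists_binning:
  fixes c :: "'a \<Rightarrow> 'a \<Rightarrow> real"
  assumes "finite S" and M: "finite M" "M \<noteq> {}" and "\<And>w. c w w = 0"
  shows "\<exists>B. (\<forall>w. B w \<in> M) \<and>
    (\<Sum>w\<in>S. \<Sum>w'\<in>S. c w w' * of_bool (B w = B w')) \<le> (\<Sum>w\<in>S. \<Sum>w'\<in>S. c w w') / real (card M)"
  using assms(1)
proof (induction S)
  case empty
  obtain m where "m \<in> M" using M by blast
  then show ?case by (intro exI[of _ "\<lambda>_. m"]) simp
next
  case (insert a S)
  then obtain B where B: "\<And>w. B w \<in> M"
    "(\<Sum>w\<in>S. \<Sum>w'\<in>S. c w w' * of_bool (B w = B w')) \<le> (\<Sum>w\<in>S. \<Sum>w'\<in>S. c w w') / real (card M)"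
    by blast
  \<comment> \<open>\<open>F m\<close> is the cost that placing \<open>a\<close> in bin
    \<open>m\<close> adds. Each earlier point lies in exactly one bin, so over all bins these costs
    add up to the sum of \<open>d\<close>.\<close>
  define d where "d w = c a w + c w a" for w
  define F where "F m = (\<Sum>w\<in>S. d w * of_bool (B w = m))" for m
  have cM: "real (card M) > 0" using M by (simp add: card_gt_0_iff)
  have "(\<Sum>m\<in>M. F m) = (\<Sum>w\<in>S. \<Sum>m\<in>M. if m = B w then d w else 0)"
    unfolding F_def by (subst sum.swap, intro sum.cong refl) auto
  also have "\<dots> = (\<Sum>w\<in>S. d w)" using M B by simp
  finally have avg: "(\<Sum>m\<in>M. F m) = (\<Sum>w\<in>S. d w)" .
  have "\<exists>m\<in>M. F m \<le> (\<Sum>w\<in>S. d w) / real (card M)"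
  proof (rule ccontr)
    assume "\<not> ?thesis"
    then have "(\<Sum>m\<in>M. (\<Sum>w\<in>S. d w) / real (card M)) < (\<Sum>m\<in>M. F m)"
      using M by (intro sum_strict_mono) (auto simp: not_le)
    then show False using avg cM by simp
  qed
  then obtain m where m: "m \<in> M" "F m \<le> (\<Sum>w\<in>S. d w) / real (card M)" by blast
  define B' where "B' = B(a := m)"
  have B'_S: "B' w = B w" if "w \<in> S" for w
    unfolding B'_def using that insert.hyps(2) by (metis fun_upd_other)
  have B'_a: "B' a = m" by (simp add: B'_def)
  have split: "(\<Sum>w\<in>insert a S. \<Sum>w'\<in>insert a S. h w w') = h a a + (\<Sum>w\<in>S. h a w + h w a) + (\<Sum>w\<in>S. \<Sum>w'\<in>S. h w w')"
    for h :: "'a \<Rightarrow> 'a \<Rightarrow> real"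
    using insert.hyps by (simp add: sum.distrib)
  have "(\<Sum>w\<in>insert a S. \<Sum>w'\<in>insert a S. c w w' * of_bool (B' w = B' w'))
      = F m + (\<Sum>w\<in>S. \<Sum>w'\<in>S. c w w' * of_bool (B w = B w'))"
  proof -
    have "(\<Sum>w\<in>S. c a w * of_bool (B' a = B' w) + c w a * of_bool (B' w = B' a)) = F m"
      unfolding F_def d_def by (intro sum.cong refl) (simp add: B'_S B'_a of_bool_def eq_commute[of m])
    moreover have "(\<Sum>w\<in>S. \<Sum>w'\<in>S. c w w' * of_bool (B' w = B' w')) = (\<Sum>w\<in>S. \<Sum>w'\<in>S. c w w' * of_bool (B w = B w'))"
      by (intro sum.cong refl) (simp only: B'_S)
    ultimately show ?thesis unfolding split assms(4) by simp
  qed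
  also have "\<dots> \<le> (\<Sum>w\<in>S. d w) / real (card M) + (\<Sum>w\<in>S. \<Sum>w'\<in>S. c w w') / real (card M)"
    using m B by (intro add_mono)
  also have "\<dots> = (\<Sum>w\<in>insert a S. \<Sum>w'\<in>insert a S. c w w') / real (card M)"
    unfolding split assms(4) d_def by (simp add: add_divide_distrib)
  finally show ?case using B m by (intro exI[of _ B']) (auto simp: B'_def)
qed

context block_code
begin

text \<open>The leakage is at most \<open>H(M|Y,Z)\<close>, which Fano's inequality bounds when \<open>M\<close> can be guessed.\<close>

lemma leak_le_fano:
  "ln 2 * leak \<le> ln 2 + (\<Sum>ys\<in>seqs n. \<Sum>zs\<in>seqs n. \<Sum>xs\<in>seqs n. \<Sum>m\<in>Msg.
      A m ys xs * dec m ys zs * of_bool (m \<noteq> guess ys zs)) * ln (real (card Msg))"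
proof -
  define J where "J m ys zs = B m ys * dec m ys zs" for m ys zs
  define M where "M = real (card Msg)"
  \<comment> \<open>Half of the mass on the guess and half uniform on \<open>Msg\<close>: a correct
    guess costs at most ln 2, a wrong one ln 2 + ln M.\<close>
  define g where "g m ys zs = of_bool (m = guess ys zs) / 2 + 1 / (2 * M)" for m ys zs
  define S where "S = Msg \<times> (seqs n :: 'y list set) \<times> (seqs n :: 'z list set)"
  have M: "M \<ge> 1" unfolding M_def by (rule card_Msg_ge_1)
  have g_pos: "g m ys zs > 0" for m ys zs unfolding g_def using M by (simp add: add_nonneg_pos)
  have ln_g: "- ln (g m ys zs) \<le> ln 2 + of_bool (m \<noteq> guess ys zs) * ln M" for m ys zs
  proof (cases "m = guess ys zs")
    case True
    have "1 / 2 \<le> g m ys zs" using True M by (simp add: g_def)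
    then have "ln (1 / 2) \<le> ln (g m ys zs)" using g_pos[of m ys zs] by (subst ln_le_cancel_iff) auto
    then show ?thesis using True by (simp add: ln_divide_pos)
  next
    case False
    then have "ln (g m ys zs) = - (ln 2 + ln M)" using M by (simp add: g_def ln_divide_pos ln_mult)
    then show ?thesis using False by simp
  qed
  have J_nonneg: "J m ys zs \<ge> 0" if "m \<in> Msg" "ys \<in> seqs n" "zs \<in> seqs n" for m ys zs
    unfolding J_def using that by (intro mult_nonneg_nonneg B_nonneg dec_nonneg)
  have J_sum: "(\<Sum>xs\<in>seqs n. A m ys xs * dec m ys zs) = J m ys zs" for m ys zs
    unfolding J_def B_def sum_distrib_right ..
  have Out2: "Out2 ys zs = (\<Sum>m\<in>Msg. J m ys zs)" for ys zs
    unfolding Out2_def Out_def J_sum[symmetric] by (rule sum.swap)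
  have J_le: "J m ys zs \<le> Out2 ys zs" if "m \<in> Msg" "ys \<in> seqs n" "zs \<in> seqs n" for m ys zs
    unfolding Out2 using that finite_Msg J_nonneg by (intro member_le_sum[of m Msg "\<lambda>m. J m ys zs"]) auto
  have J_total: "(\<Sum>ys\<in>seqs n. \<Sum>zs\<in>seqs n. \<Sum>m\<in>Msg. J m ys zs) = 1"
    using sum_Out unfolding Out2[symmetric] Out2_def .
  have "ln 2 * leak \<le> (\<Sum>m\<in>Msg. \<Sum>xs\<in>seqs n. \<Sum>ys\<in>seqs n. \<Sum>zs\<in>seqs n.
      A m ys xs * dec m ys zs * ln (Out2 ys zs / J m ys zs))"
    unfolding leak_expand sum_distrib_left
  proof (intro sum_mono)
    fix m :: nat and xs :: "'x list" and ys :: "'y list" and zs :: "'z list"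
    assume *: "m \<in> Msg" "xs \<in> seqs n" "ys \<in> seqs n" "zs \<in> seqs n"
    show "ln 2 * (if 0 < A m ys xs * dec m ys zs then A m ys xs * dec m ys zs *
           log 2 (density m xs ys zs) else 0)
        \<le> A m ys xs * dec m ys zs * ln (Out2 ys zs / J m ys zs)"
    proof (cases "0 < A m ys xs * dec m ys zs")
      case True
      have AO: "A m ys xs * dec m ys zs \<le> Out ys zs xs" unfolding Out_def
        using * finite_Msg by (intro member_le_sum) (auto intro!: mult_nonneg_nonneg A_nonneg dec_nonneg)
      have O: "Out ys zs xs > 0" using AO True by linarith
      have "A m ys xs * dec m ys zs \<le> J m ys zs" unfolding J_def
        using * by (intro mult_right_mono A_le_B dec_nonneg)
      then have J: "J m ys zs > 0" using True by linarith
      then have O2: "Out2 ys zs > 0" using J_le[OF *(1,3,4)] by linarith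
      have "density m xs ys zs
         = (A m ys xs * dec m ys zs / Out ys zs xs) * (Out2 ys zs / J m ys zs)" unfolding J_def by simp
      \<comment> \<open>The first factor is the probability of the message given (X,Y,Z); bounding
        it by 1 drops H(M|X,Y,Z) from the leakage.\<close>
      also have "\<dots> \<le> 1 * (Out2 ys zs / J m ys zs)"
        using AO O O2 J by (intro mult_right_mono) auto
      finally have "ln (density m xs ys zs) \<le> ln (Out2 ys zs / J m ys zs)"
        using True O O2 J by (subst ln_le_cancel_iff) (auto simp: J_def[symmetric])
      then have "A m ys xs * dec m ys zs * ln (density m xs ys zs)
         \<le> A m ys xs * dec m ys zs * ln (Out2 ys zs / J m ys zs)" using True by (intro mult_left_mono) auto
      then show ?thesis using True by (simp add: log_def)
    next
      case False
      then have "A m ys xs * dec m ys zs = 0"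
        using A_nonneg[OF *(1,2), of ys] dec_nonneg[OF *(1,3,4)] by (metis mult_nonneg_nonneg order.not_eq_order_implies_strict)
      then show ?thesis by auto
    qed
  qed
  also have "\<dots> = (\<Sum>m\<in>Msg. \<Sum>ys\<in>seqs n. \<Sum>zs\<in>seqs n. \<Sum>xs\<in>seqs n. A m ys xs * dec m ys zs * ln (Out2 ys zs / J m ys zs))"
    unfolding sum.cartesian_product
    by (rule sum.reindex_bij_witness[of _ "\<lambda>(m, ys, zs, xs). (m, xs, ys, zs)" "\<lambda>(m, xs, ys, zs). (m, ys, zs, xs)"]) auto
  also have "\<dots> = (\<Sum>m\<in>Msg. \<Sum>ys\<in>seqs n. \<Sum>zs\<in>seqs n. J m ys zs * ln (Out2 ys zs / J m ys zs))"
    unfolding J_sum[symmetric] sum_distrib_right ..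
  also have "\<dots> \<le> (\<Sum>m\<in>Msg. \<Sum>ys\<in>seqs n. \<Sum>zs\<in>seqs n. J m ys zs * - ln (g m ys zs))"
  proof -
    have "(\<Sum>w\<in>S. (\<lambda>(m, ys, zs). J m ys zs) w * ln ((\<lambda>(m, ys, zs). Out2 ys zs * g m ys zs) w))
      \<le> (\<Sum>w\<in>S. (\<lambda>(m, ys, zs). J m ys zs) w * ln ((\<lambda>(m, ys, zs). J m ys zs) w))
       + (\<Sum>w\<in>S. (\<lambda>(m, ys, zs). Out2 ys zs * g m ys zs) w) - (\<Sum>w\<in>S. (\<lambda>(m, ys, zs). J m ys zs) w)"
    proof (rule gibbs_inequality)
      fix w assume "w \<in> S"
      then obtain m ys zs where w: "w = (m, ys, zs)" "m \<in> Msg" "ys \<in> seqs n" "zs \<in> seqs n" by (auto simp: S_def)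
      show "0 \<le> (\<lambda>(m, ys, zs). J m ys zs) w" using w J_nonneg by simp
      show "0 \<le> (\<lambda>(m, ys, zs). Out2 ys zs * g m ys zs) w" using w g_pos Out2_nonneg by (simp add: less_imp_le)
      assume "0 < (\<lambda>(m, ys, zs). J m ys zs) w"
      then have "Out2 ys zs > 0" using J_le[OF w(2-4)] w(1) by auto
      then show "0 < (\<lambda>(m, ys, zs). Out2 ys zs * g m ys zs) w" using w g_pos by simp
    qed
    moreover have "(\<Sum>w\<in>S. (\<lambda>(m, ys, zs). J m ys zs) w) = 1"
      using J_total unfolding S_def sum.cartesian_product' split by (simp only: sum.swap[of _ Msg])
    moreover have "(\<Sum>w\<in>S. (\<lambda>(m, ys, zs). Out2 ys zs * g m ys zs) w) \<le> 1"
    proof -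
      have gs: "(\<Sum>m\<in>Msg. g m ys zs) \<le> 1" for ys zs
      proof -
        have "(\<Sum>m\<in>Msg. g m ys zs) = (\<Sum>m\<in>Msg. of_bool (m = guess ys zs)) / 2 + 1 / 2"
          unfolding g_def using M by (simp add: sum.distrib sum_divide_distrib M_def)
        also have "(\<Sum>m\<in>Msg. of_bool (m = guess ys zs)) \<le> (1 :: real)"
          using finite_Msg by (cases "guess ys zs \<in> Msg") (auto simp: of_bool_def)
        finally show ?thesis by simp
      qed
      have "(\<Sum>w\<in>S. (\<lambda>(m, ys, zs). Out2 ys zs * g m ys zs) w) = (\<Sum>ys\<in>seqs n. \<Sum>zs\<in>seqs n. Out2 ys zs * (\<Sum>m\<in>Msg. g m ys zs))"
        unfolding S_def sum.cartesian_product' split sum_distrib_left by (simp only: sum.swap[of _ Msg])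
      also have "\<dots> \<le> (\<Sum>ys\<in>seqs n. \<Sum>zs\<in>seqs n. Out2 ys zs)"
        using gs Out2_nonneg by (intro sum_mono mult_left_le) auto
      also have "\<dots> = 1" using J_total unfolding Out2[symmetric] .
      finally show ?thesis .
    qed
    ultimately have "(\<Sum>w\<in>S. (\<lambda>(m, ys, zs). J m ys zs) w * ln ((\<lambda>(m, ys, zs). Out2 ys zs * g m ys zs) w))
      \<le> (\<Sum>w\<in>S. (\<lambda>(m, ys, zs). J m ys zs) w * ln ((\<lambda>(m, ys, zs). J m ys zs) w))" by linarith
    then have le: "(\<Sum>m\<in>Msg. \<Sum>ys\<in>seqs n. \<Sum>zs\<in>seqs n. J m ys zs * ln (Out2 ys zs * g m ys zs))
      \<le> (\<Sum>m\<in>Msg. \<Sum>ys\<in>seqs n. \<Sum>zs\<in>seqs n. J m ys zs * ln (J m ys zs))"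
      unfolding S_def sum.cartesian_product' split .
    have "(\<Sum>m\<in>Msg. \<Sum>ys\<in>seqs n. \<Sum>zs\<in>seqs n. J m ys zs * ln (Out2 ys zs / J m ys zs))
       = (\<Sum>m\<in>Msg. \<Sum>ys\<in>seqs n. \<Sum>zs\<in>seqs n. J m ys zs * ln (Out2 ys zs * g m ys zs) + J m ys zs * - ln (g m ys zs) - J m ys zs * ln (J m ys zs))"
    proof (intro sum.cong refl)
      fix m :: nat and ys :: "'y list" and zs :: "'z list"
      assume *: "m \<in> Msg" "ys \<in> seqs n" "zs \<in> seqs n"
      show "J m ys zs * ln (Out2 ys zs / J m ys zs)
         = J m ys zs * ln (Out2 ys zs * g m ys zs) + J m ys zs * - ln (g m ys zs) - J m ys zs * ln (J m ys zs)"
      proof (cases "J m ys zs > 0")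
        case True
        then have O2: "Out2 ys zs > 0" using J_le[OF *] by linarith
        have "ln (Out2 ys zs / J m ys zs) = ln (Out2 ys zs) - ln (J m ys zs)" using O2 True by (rule ln_divide_pos)
        moreover have "ln (Out2 ys zs * g m ys zs) = ln (Out2 ys zs) + ln (g m ys zs)"
          using O2 g_pos[of m ys zs] by (simp add: ln_mult)
        ultimately show ?thesis by (simp only: right_diff_distrib distrib_left mult_minus_right, simp?)
      next
        case False
        then show ?thesis using J_nonneg[OF *] by simp
      qed
    qed
    then show ?thesis using le unfolding sum.distrib sum_subtractf by linarith
  qed
  also have "\<dots> \<le> (\<Sum>m\<in>Msg. \<Sum>ys\<in>seqs n. \<Sum>zs\<in>seqs n. J m ys zs * (ln 2 + of_bool (m \<noteq> guess ys zs) * ln M))"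
    using ln_g by (intro sum_mono mult_left_mono J_nonneg)
  also have "\<dots> = (\<Sum>ys\<in>seqs n. \<Sum>zs\<in>seqs n. \<Sum>m\<in>Msg. J m ys zs) * ln 2
      + (\<Sum>m\<in>Msg. \<Sum>ys\<in>seqs n. \<Sum>zs\<in>seqs n. J m ys zs * of_bool (m \<noteq> guess ys zs)) * ln M"
    unfolding distrib_left sum.distrib sum_distrib_right by (simp only: sum.swap[of _ Msg] mult.assoc)
  also have "(\<Sum>m\<in>Msg. \<Sum>ys\<in>seqs n. \<Sum>zs\<in>seqs n. J m ys zs * of_bool (m \<noteq> guess ys zs))
     = (\<Sum>ys\<in>seqs n. \<Sum>zs\<in>seqs n. \<Sum>xs\<in>seqs n. \<Sum>m\<in>Msg. A m ys xs * dec m ys zs * of_bool (m \<noteq> guess ys zs))"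
    unfolding J_sum[symmetric] sum_distrib_right by (simp only: sum.swap[of _ Msg])
  finally show ?thesis unfolding J_total M_def by simp
qed

end

text \<open>A channel run through an auxiliary letter \<open>w\<close>: Alice draws it from
  \<open>x\<close> by \<open>a\<close>, Bob draws \<open>z\<close> from \<open>(w, y)\<close> by
  \<open>b\<close>, and \<open>cl\<close> reads it off \<open>(y, z)\<close>, so that it is no
  secret from the output. Achievability is proved for any such factorisation;
  \<open>direct_rate\<close> supplies the one given by the classes.\<close>

locale latent_channel = source_channel p q
  for p :: "'x::finite \<Rightarrow> 'y::finite \<Rightarrow> real" and q :: "'x \<Rightarrow> 'y \<Rightarrow> 'z::finite \<Rightarrow> real" +
  fixes a :: "'x \<Rightarrow> 'w::finite \<Rightarrow> real" and b :: "'w \<Rightarrow> 'y \<Rightarrow> 'z \<Rightarrow> real" and cl :: "'y \<Rightarrow> 'z \<Rightarrow> 'w"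
  assumes a_nonneg: "a x w \<ge> 0" and a_sum: "(\<Sum>w\<in>UNIV. a x w) = 1"
    and b_nonneg: "b w y z \<ge> 0" and b_sum: "(\<Sum>z\<in>UNIV. b w y z) = 1"
    and q_decomp: "q x y z = (\<Sum>w\<in>UNIV. a x w * b w y z)"
    and cl: "a x w > 0 \<Longrightarrow> b w y z > 0 \<Longrightarrow> cl y z = w"
begin

definition pw :: "'w \<Rightarrow> 'y \<Rightarrow> real" where "pw w y = (\<Sum>x\<in>UNIV. p x y * a x w)"

definition latent_entropy :: real where
  "latent_entropy = - (\<Sum>w\<in>UNIV. \<Sum>y\<in>UNIV. pw w y * ln (pw w y / pY y))"

definition pwn :: "nat \<Rightarrow> 'w list \<Rightarrow> 'y list \<Rightarrow> real" where
  "pwn n ws ys = (\<Prod>i<n. pw (ws ! i) (ys ! i))"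

text \<open>The conditional law of W^n given Y^n; \<open>pwn\<close> is their joint law.\<close>

definition cn :: "nat \<Rightarrow> 'w list \<Rightarrow> 'y list \<Rightarrow> real" where
  "cn n ws ys = (\<Prod>i<n. pw (ws ! i) (ys ! i) / pY (ys ! i))"

definition an :: "nat \<Rightarrow> 'x list \<Rightarrow> 'w list \<Rightarrow> real" where
  "an n xs ws = (\<Prod>i<n. a (xs ! i) (ws ! i))"

definition bn :: "nat \<Rightarrow> 'w list \<Rightarrow> 'y list \<Rightarrow> 'z list \<Rightarrow> real" where
  "bn n ws ys zs = (\<Prod>i<n. b (ws ! i) (ys ! i) (zs ! i))"

lemma pw_nonneg: "pw w y \<ge> 0"
  unfolding pw_def by (intro sum_nonneg mult_nonneg_nonneg p_nonneg a_nonneg)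

lemma sum_pw: "(\<Sum>w\<in>UNIV. pw w y) = pY y"
  unfolding pw_def pY_def by (subst sum.swap) (simp add: sum_distrib_left[symmetric] a_sum)

lemma pw_le: "pw w y \<le> pY y"
  unfolding sum_pw[symmetric] by (intro member_le_sum pw_nonneg) auto

lemma latent_entropy_nonneg: "latent_entropy \<ge> 0"
proof -
  have "pw w y * ln (pw w y / pY y) \<le> 0" for w y
    using pw_nonneg[of w y] pw_le[of w y] pY_pos[of y]
    by (cases "pw w y = 0") (auto intro!: mult_nonneg_nonpos)
  then show ?thesis unfolding latent_entropy_def by (simp add: sum_nonpos)
qed

lemma pwn_nonneg: "pwn n ws ys \<ge> 0" and cn_nonneg: "cn n ws ys \<ge> 0"
  and an_nonneg: "an n xs ws \<ge> 0" and bn_nonneg: "bn n ws ys zs \<ge> 0"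
  unfolding pwn_def cn_def an_def bn_def using pY_pos
  by (auto intro!: prod_nonneg divide_nonneg_nonneg pw_nonneg a_nonneg b_nonneg simp: less_imp_le)

lemma sum_an: "(\<Sum>ws\<in>seqs n. an n xs ws) = 1"
  unfolding an_def by (subst sum_prod_seqs) (simp add: a_sum)

lemma sum_bn: "(\<Sum>zs\<in>seqs n. bn n ws ys zs) = 1"
  unfolding bn_def by (subst sum_prod_seqs) (simp add: b_sum)

lemma sum_cn: "(\<Sum>ws\<in>seqs n. cn n ws ys) = 1"
proof -
  have "(\<Sum>w\<in>UNIV. pw w y / pY y) = 1" for y
    using pY_pos[of y] by (simp add: sum_divide_distrib[symmetric] sum_pw)
  then show ?thesis unfolding cn_def
    by (subst sum_prod_seqs[of "\<lambda>i w. pw w (ys ! i) / pY (ys ! i)"]) simp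
qed

lemma sum_src_an: "(\<Sum>xs\<in>seqs n. src_n p n xs ys * an n xs ws) = pwn n ws ys"
  unfolding src_n_def an_def prod.distrib[symmetric] pwn_def pw_def
  by (rule sum_prod_seqs[of "\<lambda>i x. p x (ys ! i) * a x (ws ! i)"])

lemma sum_pwn: "(\<Sum>ys\<in>seqs n. \<Sum>ws\<in>seqs n. pwn n ws ys) = 1"
proof -
  have "(\<Sum>ws\<in>seqs n. pwn n ws ys) = (\<Prod>i<n. pY (ys ! i))" for ys
    unfolding pwn_def by (subst sum_prod_seqs[of "\<lambda>i w. pw w (ys ! i)"]) (simp add: sum_pw)
  moreover have "(\<Sum>y\<in>UNIV. pY y) = 1" unfolding pY_def by (rule p_sum')
  ultimately show ?thesis using sum_prod_seqs[of "\<lambda>i y. pY y" n] by simp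
qed

lemma target_decomp: "target_n p q n xs ys zs = src_n p n xs ys * (\<Sum>ws\<in>seqs n. an n xs ws * bn n ws ys zs)"
  unfolding target_n_def q_decomp an_def bn_def prod.distrib[symmetric]
  by (subst sum_prod_seqs[of "\<lambda>i w. a (xs ! i) w * b w (ys ! i) (zs ! i)"]) simp

text \<open>One-sided typicality: the lower bound on the conditional probability limits the number
  of candidates (\<open>card_typical\<close>), and words violating it are rare
  (\<open>atypical_bound\<close>).\<close>

definition typical :: "nat \<Rightarrow> real \<Rightarrow> 'y list \<Rightarrow> 'w list set" where
  "typical n h ys = {ws \<in> seqs n. exp (- (real n * h)) \<le> cn n ws ys}"

lemma card_typical: "real (card (typical n h ys)) \<le> exp (real n * h)"
proof -
  have "real (card (typical n h ys)) * exp (- (real n * h)) = (\<Sum>ws\<in>typical n h ys. exp (- (real n * h)))" by simp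
  also have "\<dots> \<le> (\<Sum>ws\<in>typical n h ys. cn n ws ys)" by (intro sum_mono) (auto simp: typical_def)
  also have "\<dots> \<le> (\<Sum>ws\<in>seqs n. cn n ws ys)"
    using cn_nonneg by (intro sum_mono2) (auto simp: typical_def)
  also have "\<dots> = 1" by (rule sum_cn)
  finally show ?thesis by (simp add: exp_minus field_simps)
qed

definition variance :: real where
  "variance = (\<Sum>w\<in>UNIV. \<Sum>y\<in>UNIV. pw w y * (- ln (pw w y / pY y) - latent_entropy)\<^sup>2)"

text \<open>Chebyshev's inequality for the sum of the -ln p(w|y), whose mean per letter is
  \<open>latent_entropy\<close>.\<close>

lemma atypical_bound:
  assumes h: "h > latent_entropy" and n: "n > 0"
  shows "(\<Sum>ys\<in>seqs n. \<Sum>ws\<in>seqs n. pwn n ws ys * of_bool (ws \<notin> typical n h ys))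
    \<le> variance / (real n * (h - latent_entropy)\<^sup>2)"
proof -
  define Q where "Q = (\<lambda>(w, y). pw w y)"
  define \<phi> where "\<phi> = (\<lambda>(w, y). - ln (pw w y / pY y) - latent_entropy)"
  define D where "D = h - latent_entropy"
  have D: "D > 0" using h by (simp add: D_def)
  have tot: "(\<Sum>t\<in>UNIV. Q t) = 1"
  proof -
    have "(\<Sum>t\<in>UNIV. Q t) = (\<Sum>w\<in>UNIV. \<Sum>y\<in>UNIV. pw w y)"
      unfolding UNIV_Times_UNIV[symmetric] sum.cartesian_product' Q_def by simp
    also have "\<dots> = (\<Sum>y\<in>UNIV. pY y)" by (subst sum.swap) (simp add: sum_pw)
    also have "\<dots> = 1" unfolding pY_def by (rule p_sum')
    finally show ?thesis .
  qed
  have mean: "(\<Sum>t\<in>UNIV. Q t * \<phi> t) = 0"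
  proof -
    have "(\<Sum>t\<in>UNIV. Q t * \<phi> t) = - (\<Sum>w\<in>UNIV. \<Sum>y\<in>UNIV. pw w y * ln (pw w y / pY y)) - (\<Sum>t\<in>UNIV. Q t) * latent_entropy"
      unfolding UNIV_Times_UNIV[symmetric] sum.cartesian_product' Q_def \<phi>_def
      by (simp add: right_diff_distrib sum_subtractf sum_negf sum_distrib_right)
    then show ?thesis unfolding tot latent_entropy_def by simp
  qed
  have var: "(\<Sum>t\<in>UNIV. Q t * (\<phi> t)\<^sup>2) = variance"
    unfolding UNIV_Times_UNIV[symmetric] sum.cartesian_product' Q_def \<phi>_def variance_def by simp
  define T where "T ws ys = (\<Sum>i<n. - ln (pw (ws ! i) (ys ! i) / pY (ys ! i)) - latent_entropy)" for ws ys
  have cheb: "pwn n ws ys * of_bool (ws \<notin> typical n h ys) \<le> pwn n ws ys * (T ws ys)\<^sup>2 / (real n * D)\<^sup>2"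
    if ws: "ws \<in> seqs n" for ws ys
  proof (cases "pwn n ws ys > 0 \<and> ws \<notin> typical n h ys")
    case True
    then have pos: "pw (ws ! i) (ys ! i) > 0" if "i < n" for i
      using that pw_nonneg[of "ws ! i" "ys ! i"] unfolding pwn_def
      by (metis finite_lessThan lessThan_iff less_le less_irrefl prod_zero)
    have "cn n ws ys > 0" unfolding cn_def using pos pY_pos by (intro prod_pos) auto
    moreover have "cn n ws ys < exp (- (real n * h))" using True ws by (auto simp: typical_def)
    ultimately have "ln (cn n ws ys) < - (real n * h)" by (metis ln_exp exp_gt_zero ln_less_cancel_iff)
    moreover have "ln (cn n ws ys) = (\<Sum>i<n. ln (pw (ws ! i) (ys ! i) / pY (ys ! i)))"
      unfolding cn_def using pos pY_pos by (intro ln_prod) (auto simp: less_imp_neq[symmetric])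
    moreover have "T ws ys = - (\<Sum>i<n. ln (pw (ws ! i) (ys ! i) / pY (ys ! i))) - real n * latent_entropy"
      unfolding T_def by (simp add: sum_subtractf sum_negf)
    ultimately have "real n * D \<le> T ws ys" unfolding D_def by (simp add: right_diff_distrib)
    then have "(real n * D)\<^sup>2 \<le> (T ws ys)\<^sup>2" using n D by (intro power_mono) auto
    then have "1 \<le> (T ws ys)\<^sup>2 / (real n * D)\<^sup>2" using n D by simp
    then have "pwn n ws ys * 1 \<le> pwn n ws ys * ((T ws ys)\<^sup>2 / (real n * D)\<^sup>2)"
      using pwn_nonneg by (rule mult_left_mono)
    then show ?thesis using True by simp
  next
    case False
    then have "pwn n ws ys * of_bool (ws \<notin> typical n h ys) = 0" using pwn_nonneg[of n ws ys] by auto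
    also have "0 \<le> pwn n ws ys * (T ws ys)\<^sup>2 / (real n * D)\<^sup>2" using pwn_nonneg[of n ws ys] by simp
    finally show ?thesis .
  qed
  have "(\<Sum>ys\<in>seqs n. \<Sum>ws\<in>seqs n. pwn n ws ys * of_bool (ws \<notin> typical n h ys))
    \<le> (\<Sum>ys\<in>seqs n. \<Sum>ws\<in>seqs n. pwn n ws ys * (T ws ys)\<^sup>2 / (real n * D)\<^sup>2)"
    using cheb by (intro sum_mono)
  also have "\<dots> = (\<Sum>ws\<in>seqs n. \<Sum>ys\<in>seqs n. pwn n ws ys * (T ws ys)\<^sup>2) / (real n * D)\<^sup>2"
    unfolding sum_divide_distrib by (rule sum.swap)
  also have "(\<Sum>ws\<in>seqs n. \<Sum>ys\<in>seqs n. pwn n ws ys * (T ws ys)\<^sup>2)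
     = (\<Sum>ts\<in>seqs n. (\<Prod>i<n. Q (ts ! i)) * (\<Sum>i<n. \<phi> (ts ! i))\<^sup>2)"
    unfolding sum_seqs_pair[of "\<lambda>ws ys. pwn n ws ys * (T ws ys)\<^sup>2" n, symmetric]
    by (intro sum.cong refl) (simp add: pwn_def T_def Q_def \<phi>_def length_seqs case_prod_unfold)
  also have "\<dots> = real n * variance" unfolding variance_sum_seqs[OF tot mean] var ..
  also have "real n * variance / (real n * D)\<^sup>2 = variance / (real n * D\<^sup>2)"
    using n by (simp add: power2_eq_square)
  finally show ?thesis unfolding D_def .
qed

text \<open>Bob picks a typical word in the received bin. He errs only if \<open>ws\<close> is
  atypical or another typical word shares its bin. With at most exp (n h) candidates, the average
  over random bins of the second event is at most exp (n h) / card M, and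
  \<open>exists_binning\<close> does no worse.\<close>

lemma exists_slepian_wolf_code:
  assumes h: "h > latent_entropy" and n: "n > 0" and M: "finite M" "M \<noteq> {}"
  shows "\<exists>B \<delta>. (\<forall>ws. B ws \<in> M) \<and> (\<forall>m ys. \<delta> m ys \<in> seqs n) \<and>
    (\<Sum>ys\<in>seqs n. \<Sum>ws\<in>seqs n. pwn n ws ys * of_bool (\<delta> (B ws) ys \<noteq> ws))
      \<le> variance / (real n * (h - latent_entropy)\<^sup>2) + exp (real n * h) / real (card M)"
proof -
  \<comment> \<open>The probability that \<open>w\<close> occurs while the different word
    \<open>w'\<close> is a typical competitor. It does not depend on the binning, as
    \<open>exists_binning\<close> requires.\<close>
  define c where "c w w' = of_bool (w \<noteq> w') * (\<Sum>ys\<in>seqs n. pwn n w ys * of_bool (w' \<in> typical n h ys))" for w w'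
  have cM: "real (card M) > 0" using M by (simp add: card_gt_0_iff)
  obtain B where B: "\<And>w. B w \<in> M"
    "(\<Sum>w\<in>seqs n. \<Sum>w'\<in>seqs n. c w w' * of_bool (B w = B w')) \<le> (\<Sum>w\<in>seqs n. \<Sum>w'\<in>seqs n. c w w') / real (card M)"
    using exists_binning[of "seqs n" M c] M by (auto simp: c_def)
  have "(\<Sum>w\<in>seqs n. \<Sum>w'\<in>seqs n. c w w') \<le> (\<Sum>w\<in>seqs n. \<Sum>w'\<in>seqs n. \<Sum>ys\<in>seqs n. pwn n w ys * of_bool (w' \<in> typical n h ys))"
    unfolding c_def using pwn_nonneg by (intro sum_mono mult_left_le_one_le sum_nonneg) auto
  also have "\<dots> = (\<Sum>ys\<in>seqs n. \<Sum>w\<in>seqs n. \<Sum>w'\<in>seqs n. pwn n w ys * of_bool (w' \<in> typical n h ys))"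
    unfolding sum.cartesian_product
    by (rule sum.reindex_bij_witness[of _ "\<lambda>(ys, w, w'). (w, w', ys)" "\<lambda>(w, w', ys). (ys, w, w')"]) auto
  also have "\<dots> = (\<Sum>ys\<in>seqs n. \<Sum>w\<in>seqs n. pwn n w ys * real (card (typical n h ys)))"
  proof (intro sum.cong refl)
    fix ys :: "'y list" and w :: "'w list"
    have "(\<Sum>w'\<in>seqs n. of_bool (w' \<in> typical n h ys)) = real (card (seqs n \<inter> typical n h ys))"
      by (simp add: of_bool_def sum.If_cases Int_def)
    also have "seqs n \<inter> typical n h ys = typical n h ys" by (auto simp: typical_def)
    finally show "(\<Sum>w'\<in>seqs n. pwn n w ys * of_bool (w' \<in> typical n h ys)) = pwn n w ys * real (card (typical n h ys))"
      by (simp only: sum_distrib_left[symmetric])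
  qed
  also have "\<dots> \<le> (\<Sum>ys\<in>seqs n. \<Sum>w\<in>seqs n. pwn n w ys * exp (real n * h))"
    using card_typical pwn_nonneg by (intro sum_mono mult_left_mono)
  also have "\<dots> = exp (real n * h)" unfolding sum_distrib_right[symmetric] sum_pwn by simp
  finally have collisions: "(\<Sum>w\<in>seqs n. \<Sum>w'\<in>seqs n. c w w' * of_bool (B w = B w')) \<le> exp (real n * h) / real (card M)"
    using B(2) cM by (meson divide_right_mono less_imp_le order.trans)
  \<comment> \<open>For an empty candidate list an arbitrary word of length \<open>n\<close> is
    returned, so that the decoder stays within \<open>seqs n\<close>.\<close>
  define \<delta> where "\<delta> m ys = (if \<exists>w\<in>typical n h ys. B w = m then SOME w. w \<in> typical n h ys \<and> B w = m else replicate n undefined)" for m ys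
  have \<delta>: "\<delta> m ys \<in> typical n h ys \<and> B (\<delta> m ys) = m" if "w \<in> typical n h ys" "B w = m" for w m ys
  proof -
    have "\<exists>w. w \<in> typical n h ys \<and> B w = m" using that by blast
    from someI_ex[OF this] show ?thesis using that unfolding \<delta>_def by auto
  qed
  have \<delta>_seqs: "\<delta> m ys \<in> seqs n" for m ys
  proof (cases "\<exists>w\<in>typical n h ys. B w = m")
    case True
    then show ?thesis using \<delta> by (auto simp: typical_def)
  next
    case False
    then have "\<delta> m ys = replicate n undefined" unfolding \<delta>_def by (rule if_not_P)
    then show ?thesis by (simp add: seqs_def)
  qed
  have err: "of_bool (\<delta> (B ws) ys \<noteq> ws) \<le> of_bool (ws \<notin> typical n h ys)
      + (\<Sum>w'\<in>seqs n. of_bool (ws \<noteq> w') * of_bool (w' \<in> typical n h ys) * of_bool (B ws = B w') :: real)" (is "_ \<le> _ + sum ?e _") for ws ys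
  proof -
    have nn: "sum ?e (seqs n) \<ge> 0" by (intro sum_nonneg) auto
    show ?thesis
    proof (cases "ws \<in> typical n h ys \<and> \<delta> (B ws) ys \<noteq> ws")
      case True
      then have d: "\<delta> (B ws) ys \<in> typical n h ys" "B (\<delta> (B ws) ys) = B ws" using \<delta> by auto
      have "?e (\<delta> (B ws) ys) \<le> sum ?e (seqs n)" using \<delta>_seqs by (intro member_le_sum) auto
      moreover have "?e (\<delta> (B ws) ys) = 1" using d True by (metis of_bool_eq(2) mult_1)
      ultimately show ?thesis using True by simp
    next
      case False
      then show ?thesis using nn by auto
    qed
  qed
  have "(\<Sum>ys\<in>seqs n. \<Sum>ws\<in>seqs n. pwn n ws ys * of_bool (\<delta> (B ws) ys \<noteq> ws))
    \<le> (\<Sum>ys\<in>seqs n. \<Sum>ws\<in>seqs n. pwn n ws ys * (of_bool (ws \<notin> typical n h ys)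
      + (\<Sum>w'\<in>seqs n. of_bool (ws \<noteq> w') * of_bool (w' \<in> typical n h ys) * of_bool (B ws = B w'))))"
    using err pwn_nonneg by (intro sum_mono mult_left_mono)
  also have "\<dots> = (\<Sum>ys\<in>seqs n. \<Sum>ws\<in>seqs n. pwn n ws ys * of_bool (ws \<notin> typical n h ys))
     + (\<Sum>ys\<in>seqs n. \<Sum>w\<in>seqs n. \<Sum>w'\<in>seqs n. pwn n w ys * (of_bool (w \<noteq> w') * of_bool (w' \<in> typical n h ys) * of_bool (B w = B w')))"
    unfolding distrib_left sum.distrib sum_distrib_left ..
  also have "(\<Sum>ys\<in>seqs n. \<Sum>w\<in>seqs n. \<Sum>w'\<in>seqs n. pwn n w ys * (of_bool (w \<noteq> w') * of_bool (w' \<in> typical n h ys) * of_bool (B w = B w')))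
     = (\<Sum>w\<in>seqs n. \<Sum>w'\<in>seqs n. \<Sum>ys\<in>seqs n. pwn n w ys * (of_bool (w \<noteq> w') * of_bool (w' \<in> typical n h ys) * of_bool (B w = B w')))"
    unfolding sum.cartesian_product
    by (rule sum.reindex_bij_witness[of _ "\<lambda>(w, w', ys). (ys, w, w')" "\<lambda>(ys, w, w'). (w, w', ys)"]) auto
  also have "\<dots> = (\<Sum>w\<in>seqs n. \<Sum>w'\<in>seqs n. c w w' * of_bool (B w = B w'))"
    unfolding c_def sum_distrib_left sum_distrib_right by (simp only: mult_ac)
  finally show ?thesis using collisions atypical_bound[OF h n] B(1) \<delta>_seqs
    by (intro exI[of _ B] exI[of _ \<delta>]) (auto intro: order.trans[OF _ add_mono])
qed

end

text \<open>Rounding down at most halves a number that is at least 1.\<close>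

lemma msgs_card_ge:
  assumes "R \<ge> 0" shows "2 powr (real n * R) \<le> 2 * real (card (msgs n R))" "msgs n R \<noteq> {}"
proof -
  have "1 \<le> 2 powr (real n * R)" using assms by (intro ge_one_powr_ge_zero) auto
  then have f: "1 \<le> \<lfloor>2 powr (real n * R)\<rfloor>" by simp
  have "2 powr (real n * R) \<le> \<lfloor>2 powr (real n * R)\<rfloor> + 1" by linarith
  also have "\<dots> \<le> 2 * real_of_int \<lfloor>2 powr (real n * R)\<rfloor>" using f by linarith
  also have "\<dots> = 2 * real (card (msgs n R))" using f by (simp add: msgs_def of_nat_nat)
  finally show "2 powr (real n * R) \<le> 2 * real (card (msgs n R))" .
  have "1 \<le> nat \<lfloor>2 powr (real n * R)\<rfloor>" using f by linarith
  then show "msgs n R \<noteq> {}" unfolding msgs_def by (metis atLeastAtMost_iff empty_iff order_refl)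
qed

section \<open>Binning codes for a latent channel\<close>

context latent_channel
begin

definition bin_enc :: "nat \<Rightarrow> ('w list \<Rightarrow> nat) \<Rightarrow> 'x list \<Rightarrow> nat \<Rightarrow> real" where
  "bin_enc n B xs m = (\<Sum>ws\<in>seqs n. an n xs ws * of_bool (B ws = m))"

definition bin_dec :: "nat \<Rightarrow> (nat \<Rightarrow> 'y list \<Rightarrow> 'w list) \<Rightarrow> nat \<Rightarrow> 'y list \<Rightarrow> 'z list \<Rightarrow> real" where
  "bin_dec n \<delta> m ys zs = bn n (\<delta> m ys) ys zs"

lemma sum_bin_enc:
  assumes "\<And>ws. B ws \<in> M" "finite M"
  shows "(\<Sum>m\<in>M. bin_enc n B xs m * h m) = (\<Sum>ws\<in>seqs n. an n xs ws * h (B ws))"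
proof -
  have "(\<Sum>m\<in>M. bin_enc n B xs m * h m) = (\<Sum>ws\<in>seqs n. \<Sum>m\<in>M. if m = B ws then an n xs ws * h m else 0)"
    unfolding bin_enc_def sum_distrib_right by (subst sum.swap, intro sum.cong refl) auto
  then show ?thesis using assms by simp
qed

lemma is_code_bin:
  assumes "\<And>ws. B ws \<in> msgs n R"
  shows "is_code n R (bin_enc n B) (bin_dec n \<delta>)"
proof -
  have "finite (msgs n R)" by (simp add: msgs_def)
  then have "(\<Sum>m\<in>msgs n R. bin_enc n B xs m) = 1" for xs
    using sum_bin_enc[of B "msgs n R" n xs "\<lambda>_. 1"] assms by (simp add: sum_an)
  then show ?thesis unfolding is_code_def
    by (auto simp: bin_enc_def bin_dec_def bn_nonneg sum_bn intro!: sum_nonneg mult_nonneg_nonneg an_nonneg)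
qed

text \<open>When Bob decodes \<open>ws\<close> correctly, his output has exactly the target's
  conditional law. Both bounds are therefore driven by the decoding error \<open>Pe\<close>: the
  distance directly, the leakage through Fano's inequality.\<close>

lemma binning_performance:
  fixes B :: "'w list \<Rightarrow> nat" and \<delta> :: "nat \<Rightarrow> 'y list \<Rightarrow> 'w list"
  assumes B: "\<And>ws. B ws \<in> msgs (Suc N) R" and \<delta>: "\<And>m ys. \<delta> m ys \<in> seqs (Suc N)"
  defines "enc \<equiv> bin_enc (Suc N) B" and "dec \<equiv> bin_dec (Suc N) \<delta>"
  defines "Pe \<equiv> (\<Sum>ys\<in>seqs (Suc N). \<Sum>ws\<in>seqs (Suc N). pwn (Suc N) ws ys * of_bool (\<delta> (B ws) ys \<noteq> ws))"
  shows "tv_dist (seqs (Suc N) \<times> seqs (Suc N) \<times> seqs (Suc N))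
        (\<lambda>(xs, ys, zs). code_out p (Suc N) R enc dec xs ys zs) (\<lambda>(xs, ys, zs). target_n p q (Suc N) xs ys zs) \<le> Pe"
    and "code_leak p (Suc N) R enc dec \<le> 1 + Pe * (real (Suc N) * R)"
proof -
  have code: "is_code (Suc N) R enc dec" unfolding enc_def dec_def by (rule is_code_bin[OF B])
  interpret block_code p q N "msgs (Suc N) R" enc dec using is_code_block_code[OF code] .
  have sum_A: "(\<Sum>m\<in>msgs n R. A m ys xs * h m) = src_n p n xs ys * (\<Sum>ws\<in>seqs n. an n xs ws * h (B ws))" for ys xs h
  proof -
    have "(\<Sum>m\<in>msgs n R. enc xs m * h m) = (\<Sum>ws\<in>seqs n. an n xs ws * h (B ws))"
      unfolding enc_def using B finite_Msg by (rule sum_bin_enc)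
    then show ?thesis unfolding A_def by (simp only: mult.assoc sum_distrib_left[symmetric])
  qed
  let ?S = "\<lambda>F. \<Sum>ys\<in>seqs n. \<Sum>zs\<in>seqs n. \<Sum>xs\<in>seqs n. F ys zs xs"
  let ?e = "\<lambda>ys xs ws. src_n p n xs ys * an n xs ws" and ?d = "\<lambda>ys zs ws. bn n (\<delta> (B ws) ys) ys zs"
    and ?w = "\<lambda>ys ws. of_bool (\<delta> (B ws) ys \<noteq> ws) :: real"
  have e_nonneg: "0 \<le> ?e ys xs ws" for xs ys ws
    by (intro mult_nonneg_nonneg an_nonneg less_imp_le[OF src_pos])
  have Pe: "(\<Sum>ys\<in>seqs n. \<Sum>xs\<in>seqs n. \<Sum>ws\<in>seqs n. ?e ys xs ws * ?w ys ws) = Pe"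
  proof -
    have "(\<Sum>xs\<in>seqs n. \<Sum>ws\<in>seqs n. ?e ys xs ws * ?w ys ws)
        = (\<Sum>ws\<in>seqs n. pwn n ws ys * ?w ys ws)" for ys
      by (subst sum.swap) (simp only: sum_distrib_right[symmetric] sum_src_an)
    then show ?thesis unfolding Pe_def by simp
  qed
  have "dist \<le> 2 * Pe"
  proof -
    have "dist \<le> ?S (\<lambda>ys zs xs. \<Sum>ws\<in>seqs n.
        ?e ys xs ws * ?w ys ws * (?d ys zs ws + bn n ws ys zs))"
      unfolding dist_def
    proof (intro sum_mono)
      fix ys :: "'y list" and zs :: "'z list" and xs :: "'x list"
      have "Out ys zs xs - target_n p q n xs ys zs
         = (\<Sum>ws\<in>seqs n. ?e ys xs ws * (?d ys zs ws - bn n ws ys zs))"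
      proof -
        have "Out ys zs xs = src_n p n xs ys * (\<Sum>ws\<in>seqs n. an n xs ws * ?d ys zs ws)"
          unfolding Out_def sum_A[of ys xs "\<lambda>m. dec m ys zs"] by (simp only: dec_def bin_dec_def)
        then show ?thesis unfolding target_decomp
          by (simp only: sum_distrib_left sum_subtractf right_diff_distrib mult.assoc)
      qed
      also have "\<bar>\<dots>\<bar> \<le> (\<Sum>ws\<in>seqs n. \<bar>?e ys xs ws * (?d ys zs ws - bn n ws ys zs)\<bar>)"
        by (rule sum_abs)
      also have "\<dots> \<le> (\<Sum>ws\<in>seqs n. ?e ys xs ws * ?w ys ws * (?d ys zs ws + bn n ws ys zs))"
      proof (intro sum_mono)
        fix ws :: "'w list"
        \<comment> \<open>The difference vanishes under correct decoding; otherwise each of the two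
          laws sums to 1 over \<open>zs\<close>, which gives 2 * Pe for \<open>dist\<close> and Pe
          for \<open>tv_dist\<close>.\<close>
        have "\<bar>?d ys zs ws - bn n ws ys zs\<bar> \<le> ?w ys ws * (?d ys zs ws + bn n ws ys zs)"
          using bn_nonneg[of n "\<delta> (B ws) ys" ys zs] bn_nonneg[of n ws ys zs] by (cases "\<delta> (B ws) ys = ws") auto
        from mult_left_mono[OF this e_nonneg[of xs ys ws]]
        show "\<bar>?e ys xs ws * (?d ys zs ws - bn n ws ys zs)\<bar>
          \<le> ?e ys xs ws * ?w ys ws * (?d ys zs ws + bn n ws ys zs)"
          unfolding abs_mult[of "src_n p n xs ys * an n xs ws"] abs_of_nonneg[OF e_nonneg] by (simp only: mult.assoc)
      qed
      finally show "\<bar>Out ys zs xs - target_n p q n xs ys zs\<bar> \<le> (\<Sum>ws\<in>seqs n.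
        ?e ys xs ws * ?w ys ws * (?d ys zs ws + bn n ws ys zs))" .
    qed
    also have "\<dots> = (\<Sum>ys\<in>seqs n. \<Sum>xs\<in>seqs n. \<Sum>ws\<in>seqs n. \<Sum>zs\<in>seqs n.
        ?e ys xs ws * ?w ys ws * (?d ys zs ws + bn n ws ys zs))"
      unfolding sum.cartesian_product
      by (rule sum.reindex_bij_witness[of _ "\<lambda>(ys, xs, ws, zs). (ys, zs, xs, ws)" "\<lambda>(ys, zs, xs, ws). (ys, xs, ws, zs)"]) auto
    also have "\<dots> = (\<Sum>ys\<in>seqs n. \<Sum>xs\<in>seqs n. \<Sum>ws\<in>seqs n. ?e ys xs ws * ?w ys ws * 2)"
      unfolding sum_distrib_left[symmetric] sum.distrib sum_bn by simp
    also have "\<dots> = Pe * 2" unfolding sum_distrib_right[symmetric] Pe ..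
    finally show ?thesis by simp
  qed
  then show "tv_dist (seqs (Suc N) \<times> seqs (Suc N) \<times> seqs (Suc N))
        (\<lambda>(xs, ys, zs). code_out p (Suc N) R enc dec xs ys zs) (\<lambda>(xs, ys, zs). target_n p q (Suc N) xs ys zs) \<le> Pe"
    using is_code_dist[OF code] by simp
  \<comment> \<open>\<open>cl\<close> applied letterwise recovers the word from which Bob generated
    \<open>zs\<close>; if that word is \<open>ws\<close>, its bin is the message.\<close>
  define guess where "guess ys zs = B (map2 cl ys zs)" for ys zs
  have "?S (\<lambda>ys zs xs. \<Sum>m\<in>msgs n R. A m ys xs * dec m ys zs * of_bool (m \<noteq> guess ys zs))
     = ?S (\<lambda>ys zs xs. \<Sum>ws\<in>seqs n.
         ?e ys xs ws * (?d ys zs ws * of_bool (B ws \<noteq> guess ys zs)))"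
    using sum_A[of _ _ "\<lambda>m. dec m ys zs * of_bool (m \<noteq> guess ys zs)" for ys zs]
    unfolding dec_def bin_dec_def by (simp only: mult.assoc sum_distrib_left)
  also have "\<dots> \<le> ?S (\<lambda>ys zs xs. \<Sum>ws\<in>seqs n.
         ?e ys xs ws * ?w ys ws * ?d ys zs ws)"
  proof (intro sum_mono)
    fix ys :: "'y list" and zs :: "'z list" and xs :: "'x list" and ws :: "'w list"
    assume *: "ys \<in> seqs n" "zs \<in> seqs n" "xs \<in> seqs n" "ws \<in> seqs n"
    show "?e ys xs ws * (?d ys zs ws * of_bool (B ws \<noteq> guess ys zs))
       \<le> ?e ys xs ws * ?w ys ws * ?d ys zs ws"
    proof (cases "\<delta> (B ws) ys \<noteq> ws \<or> an n xs ws = 0 \<or> ?d ys zs ws = 0")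
      case True
      have "?d ys zs ws * of_bool (B ws \<noteq> guess ys zs) \<le> ?d ys zs ws"
        using bn_nonneg by (intro mult_left_le) auto
      from mult_left_mono[OF this e_nonneg[of xs ys ws]] show ?thesis using True by auto
    next
      case False
      then have "an n xs ws \<noteq> 0" "bn n ws ys zs \<noteq> 0" by auto
      then have "a (xs ! i) (ws ! i) \<noteq> 0 \<and> b (ws ! i) (ys ! i) (zs ! i) \<noteq> 0" if "i < n" for i
        using that unfolding an_def bn_def by (metis finite_lessThan lessThan_iff prod_zero)
      then have "cl (ys ! i) (zs ! i) = ws ! i" if "i < n" for i
        using cl a_nonneg b_nonneg that by (metis less_le)
      then have "map2 cl ys zs = ws" using * by (intro nth_equalityI) (auto simp: seqs_def)
      then show ?thesis by (simp add: guess_def bn_nonneg e_nonneg)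
    qed
  qed
  also have "\<dots> = (\<Sum>ys\<in>seqs n. \<Sum>xs\<in>seqs n. \<Sum>ws\<in>seqs n. \<Sum>zs\<in>seqs n.
         ?e ys xs ws * ?w ys ws * ?d ys zs ws)"
    unfolding sum.cartesian_product
    by (rule sum.reindex_bij_witness[of _ "\<lambda>(ys, xs, ws, zs). (ys, zs, xs, ws)" "\<lambda>(ys, zs, xs, ws). (ys, xs, ws, zs)"]) auto
  also have "\<dots> = Pe" unfolding sum_distrib_left[symmetric] sum_bn by (simp only: mult_1_right Pe)
  finally have err: "?S (\<lambda>ys zs xs. \<Sum>m\<in>msgs n R. A m ys xs * dec m ys zs * of_bool (m \<noteq> guess ys zs)) \<le> Pe" .
  have Pe_nonneg: "Pe \<ge> 0" unfolding Pe_def using pwn_nonneg by (intro sum_nonneg mult_nonneg_nonneg) auto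
  note lnM = ln_card_msgs_le[OF card_Msg_ge_1]
  have "ln 2 * code_leak p n R enc dec \<le> ln 2 + ?S (\<lambda>ys zs xs. \<Sum>m\<in>msgs n R. A m ys xs * dec m ys zs * of_bool (m \<noteq> guess ys zs)) * ln (real (card (msgs n R)))"
    unfolding code_leak_def by (rule leak_le_fano)
  also have "\<dots> \<le> ln 2 + Pe * ln (real (card (msgs n R)))"
    using err card_Msg_ge_1 by (intro add_left_mono mult_right_mono) auto
  also have "\<dots> \<le> ln 2 + Pe * (real n * (R * ln 2))"
    using lnM Pe_nonneg by (intro add_left_mono mult_left_mono)
  also have "\<dots> = ln 2 * (1 + Pe * (real n * R))" by (simp only: distrib_left mult_1_right mult_ac)
  finally show "code_leak p (Suc N) R enc dec \<le> 1 + Pe * (real (Suc N) * R)" by simp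
qed

lemma achievable_latent:
  assumes R: "R * ln 2 > latent_entropy"
  shows "achievable p q R"
proof -
  \<comment> \<open>Any value strictly between entropy and rate: above the entropy atypical words
    are rare, below the rate collisions are.\<close>
  define h where "h = (latent_entropy + R * ln 2) / 2"
  have h: "h > latent_entropy" "h < R * ln 2" using R by (auto simp: h_def)
  have "0 < R * ln 2" using R latent_entropy_nonneg by linarith
  then have R0: "R > 0" by (simp add: zero_less_mult_iff)
  \<comment> \<open>Chebyshev term plus collision term; the 2 is the rounding loss of
    \<open>msgs_card_ge\<close>.\<close>
  define bound where "bound n = variance / (h - latent_entropy)\<^sup>2 / real n + 2 * exp (h - R * ln 2) ^ n" for n
  have "\<exists>enc dec. is_code n R enc dec \<and> (n > 0 \<longrightarrow>
      tv_dist (seqs n \<times> seqs n \<times> seqs n)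
              (\<lambda>(xs, ys, zs). code_out p n R enc dec xs ys zs)
              (\<lambda>(xs, ys, zs). target_n p q n xs ys zs) \<le> bound n \<and>
      code_leak p n R enc dec \<le> 1 + bound n * (real n * R))" for n
  proof (cases n)
    \<comment> \<open>A code is demanded at length 0 too, but no performance: a constant bin will
      do.\<close>
    case 0
    obtain m where "m \<in> msgs n R" using msgs_card_ge(2)[of R n] R0 by auto
    then show ?thesis using is_code_bin[of "\<lambda>_. m" n R] 0 by blast
  next
    case (Suc N)
    have fin: "finite (msgs n R)" by (simp add: msgs_def)
    obtain B \<delta> where B: "\<And>ws. B ws \<in> msgs n R" and \<delta>: "\<And>m ys. \<delta> m ys \<in> seqs n"
      and Pe: "(\<Sum>ys\<in>seqs n. \<Sum>ws\<in>seqs n. pwn n ws ys * of_bool (\<delta> (B ws) ys \<noteq> ws))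
        \<le> variance / (real n * (h - latent_entropy)\<^sup>2) + exp (real n * h) / real (card (msgs n R))"
      using exists_slepian_wolf_code[OF h(1) _ fin msgs_card_ge(2), of n] R0 Suc by auto
    have "exp (real n * h) / real (card (msgs n R)) \<le> exp (real n * h) / (2 powr (real n * R) / 2)"
      using msgs_card_ge[of R n] R0 by (intro divide_left_mono) (auto intro!: mult_pos_pos simp: card_gt_0_iff fin)
    also have "\<dots> = 2 * exp (real n * (h - R * ln 2))"
      by (simp add: powr_def exp_diff right_diff_distrib mult_ac)
    also have "exp (real n * (h - R * ln 2)) = exp (h - R * ln 2) ^ n" by (rule exp_of_nat_mult)
    finally have Pe_le: "(\<Sum>ys\<in>seqs n. \<Sum>ws\<in>seqs n. pwn n ws ys * of_bool (\<delta> (B ws) ys \<noteq> ws)) \<le> bound n"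
      using Pe unfolding bound_def by (simp add: mult.commute)
    note perf = binning_performance[of B N R \<delta>, folded Suc, OF B \<delta>]
    have "code_leak p n R (bin_enc n B) (bin_dec n \<delta>) \<le> 1 + bound n * (real n * R)"
      using Pe_le R0 by (intro order.trans[OF perf(2)] add_left_mono mult_right_mono) auto
    then show ?thesis using is_code_bin[of B n R \<delta>, OF B] order.trans[OF perf(1) Pe_le]
      by (intro exI[of _ "bin_enc n B"] exI[of _ "bin_dec n \<delta>"] conjI impI)
  qed
  then obtain enc dec where code: "\<And>n. is_code n R (enc n) (dec n)"
    and perf: "\<And>n. n > 0 \<Longrightarrow> tv_dist (seqs n \<times> seqs n \<times> seqs n)
              (\<lambda>(xs, ys, zs). code_out p n R (enc n) (dec n) xs ys zs)
              (\<lambda>(xs, ys, zs). target_n p q n xs ys zs) \<le> bound n"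
      "\<And>n. n > 0 \<Longrightarrow> code_leak p n R (enc n) (dec n) \<le> 1 + bound n * (real n * R)"
    by metis
  have "bound \<longlonglongrightarrow> 0 + 2 * 0" unfolding bound_def
    using h(2) by (intro tendsto_add tendsto_mult tendsto_const lim_const_over_n LIMSEQ_power_zero) auto
  then have lim: "bound \<longlonglongrightarrow> 0" by simp
  show ?thesis unfolding achievable_def
  proof (intro exI[of _ enc] exI[of _ dec] conjI allI impI)
    show "is_code n R (enc n) (dec n)" for n by (rule code)
    fix \<epsilon> :: real assume \<epsilon>: "\<epsilon> > 0"
    \<comment> \<open>Half of the leakage allowance is for \<open>bound n * (real n * R)\<close>;
      the other half, once n \<ge> 2 / \<epsilon>, is for the constant 1 from Fano's
      inequality.\<close>
    define \<epsilon>' where "\<epsilon>' = min \<epsilon> (\<epsilon> / (2 * R))"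
    have "\<epsilon>' > 0" using \<epsilon> R0 by (simp add: \<epsilon>'_def)
    then have "\<forall>\<^sub>F n in sequentially. bound n < \<epsilon>'" using lim by (rule order_tendstoD(2)[rotated])
    moreover have "\<forall>\<^sub>F n in sequentially. real n \<ge> 2 / \<epsilon>"
      by (rule eventually_compose_filterlim[OF eventually_ge_at_top filterlim_real_sequentially])
    moreover have "\<forall>\<^sub>F n in sequentially. n > (0 :: nat)" by (rule eventually_gt_at_top)
    ultimately show "\<forall>\<^sub>F n in sequentially.
            tv_dist (seqs n \<times> seqs n \<times> seqs n)
              (\<lambda>(xs, ys, zs). code_out p n R (enc n) (dec n) xs ys zs)
              (\<lambda>(xs, ys, zs). target_n p q n xs ys zs) \<le> \<epsilon> \<and>
            code_leak p n R (enc n) (dec n) \<le> real n * \<epsilon>"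
    proof eventually_elim
      case (elim n)
      have b: "bound n \<le> \<epsilon>" "bound n \<le> \<epsilon> / (2 * R)" using elim by (auto simp: \<epsilon>'_def)
      have "bound n * (real n * R) \<le> \<epsilon> / (2 * R) * (real n * R)" using b R0 by (intro mult_right_mono) auto
      also have "\<dots> = real n * \<epsilon> / 2" using R0 by simp
      finally have "bound n * (real n * R) \<le> real n * \<epsilon> / 2" .
      moreover have "1 \<le> real n * \<epsilon> / 2" using elim \<epsilon> by (simp add: field_simps)
      ultimately have "1 + bound n * (real n * R) \<le> real n * \<epsilon>" by simp
      then show ?case using perf[OF elim(3)] b by linarith
    qed
  qed
qed

end

section \<open>The classes as a latent variable, and the rate formula\<close>

context source_channel
begin

definition colsum :: "'y \<Rightarrow> 'z \<Rightarrow> real" where "colsum y z = (\<Sum>x\<in>UNIV. q x y z)"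

definition class_weight :: "('x \<Rightarrow> real) \<Rightarrow> 'y \<Rightarrow> real" where
  "class_weight j y = (\<Sum>z\<in>UNIV. of_bool (col q y z = j) * colsum y z)"

text \<open>All columns in class \<open>j\<close> are multiples of \<open>j\<close>, so given the
  class and \<open>y\<close> the output is independent of \<open>x\<close>: the factorisation behind
  \<open>a\<close> and \<open>b\<close> in \<open>direct_rate\<close>.\<close>

lemma class_prob_eq: "class_prob x y j = j x * class_weight j y"
proof -
  have "of_bool (col q y z = j) * q x y z = j x * (of_bool (col q y z = j) * colsum y z)" for z
    using q_eq_col[of x y z] by (cases "col q y z = j") (auto simp: colsum_def)
  then show ?thesis unfolding class_prob_def class_weight_def sum_distrib_left by (rule sum.cong[OF refl])
qed

lemma class_prob_nonneg: "class_prob x y j \<ge> 0"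
  unfolding class_prob_def by (intro sum_nonneg) (auto simp: q_nonneg)

lemma class_in_cols: "j \<in> cols q \<Longrightarrow> \<exists>x y. class_prob x y j > 0"
proof -
  assume "j \<in> cols q"
  then obtain y z x where *: "col q y z = j" "q x y z > 0" by (auto simp: cols_def Zsupp_def)
  have "of_bool (col q y z = j) * q x y z \<le> class_prob x y j"
    unfolding class_prob_def by (intro member_le_sum) (auto simp: q_nonneg)
  then show ?thesis using * by (intro exI[of _ x] exI[of _ y]) simp
qed

lemma col_in_cols: "z \<in> Zsupp q y \<Longrightarrow> col q y z \<in> cols q"
  by (auto simp: cols_def)

lemma sum_class_prob: "(\<Sum>j\<in>cols q. class_prob x y j) = 1"
proof -
  have "(\<Sum>j\<in>cols q. class_prob x y j) = (\<Sum>z\<in>UNIV. \<Sum>j\<in>cols q. if j = col q y z then q x y z else 0)"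
    unfolding class_prob_def by (subst sum.swap, intro sum.cong refl) auto
  also have "\<dots> = (\<Sum>z\<in>UNIV. q x y z)"
  proof (intro sum.cong refl)
    fix z
    show "(\<Sum>j\<in>cols q. if j = col q y z then q x y z else 0) = q x y z"
      by (cases "z \<in> Zsupp q y") (auto simp: col_in_cols not_in_Zsupp)
  qed
  finally show ?thesis by (simp add: q_sum)
qed

lemma pWY_eq: "pWY j y = (\<Sum>x\<in>UNIV. p x y * class_prob x y j)"
  unfolding pWY_def margin_def class_prob_def sum_distrib_left by (subst sum.swap) (simp only: mult_ac)

text \<open>The law of the class given \<open>x\<close> does not depend on \<open>y\<close>, so a
  class that occurs at one \<open>y\<close> occurs at all: this is why k(y) = k.\<close>

lemma class_occurs:
  assumes "achievable p q R" and j: "j \<in> cols q"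
  shows "\<exists>z\<in>Zsupp q y. col q y z = j"
proof -
  obtain x y' where "class_prob x y' j > 0" using class_in_cols[OF j] by blast
  then have "class_prob x y j > 0" using class_prob_indep[OF assms(1)] by metis
  then have "\<exists>z. of_bool (col q y z = j) * q x y z \<noteq> 0"
    unfolding class_prob_def by (metis (mono_tags, lifting) less_irrefl sum.neutral)
  then obtain z where "col q y z = j" "q x y z \<noteq> 0" by auto
  then show ?thesis using not_in_Zsupp by blast
qed

text \<open>The classes are represented inside the finite type of outputs, by elements of the support
  at one fixed \<open>y0\<close>; other outputs get a dummy conditional law.\<close>

lemma direct_rate:
  assumes R0: "achievable p q R0" and R: "R > cond_entropy / ln 2"
  shows "achievable p q R"
proof -
  fix y0 :: 'y
  define e where "e j = (SOME z. z \<in> Zsupp q y0 \<and> col q y0 z = j)" for j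
  have e: "e j \<in> Zsupp q y0" "col q y0 (e j) = j" if "j \<in> cols q" for j
    using someI_ex[of "\<lambda>z. z \<in> Zsupp q y0 \<and> col q y0 z = j"] class_occurs[OF R0 that, of y0]
    unfolding e_def by auto
  define W where "W = e ` cols q"
  have inj: "inj_on e (cols q)" using e(2) by (metis inj_onI)
  define cw where "cw = col q y0"
  have W: "w \<in> W \<Longrightarrow> cw w \<in> cols q" "w \<in> W \<Longrightarrow> e (cw w) = w" for w
    using e(2) by (auto simp: W_def cw_def)
  have weight_pos: "class_weight j y > 0" if j: "j \<in> cols q" for j y
  proof -
    obtain z where z: "z \<in> Zsupp q y" "col q y z = j" using class_occurs[OF R0 j] by blast
    have "0 < of_bool (col q y z = j) * colsum y z" using z colsum_pos by (simp add: colsum_def)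
    also have "\<dots> \<le> class_weight j y" unfolding class_weight_def
      by (intro member_le_sum) (auto simp: colsum_def q_nonneg sum_nonneg)
    finally show ?thesis .
  qed
  \<comment> \<open>\<open>a\<close> is read off at \<open>y0\<close>, which serves every
    \<open>y\<close> by \<open>class_prob_indep\<close>; \<open>b\<close> draws \<open>z\<close>
    within its class in proportion to the column sums. The point mass at \<open>undefined\<close>
    makes \<open>b\<close> a law for letters outside \<open>W\<close>, which \<open>a\<close> never
    produces.\<close>
  define a where "a x w = of_bool (w \<in> W) * class_prob x y0 (cw w)" for x w
  define b where "b w y z = (if w \<in> W then of_bool (col q y z = cw w) * colsum y z / class_weight (cw w) y
      else of_bool (z = undefined))" for w y z
  have sum_a: "(\<Sum>w\<in>UNIV. a x w * F w) = (\<Sum>j\<in>cols q. class_prob x y0 j * F (e j))" for x and F :: "'z \<Rightarrow> real"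
  proof -
    have "(\<Sum>w\<in>UNIV. a x w * F w) = (\<Sum>w\<in>W. class_prob x y0 (cw w) * F w)"
      by (rule sum.mono_neutral_cong_right) (auto simp: a_def)
    also have "\<dots> = (\<Sum>j\<in>cols q. class_prob x y0 j * F (e j))"
      unfolding W_def sum.reindex[OF inj] using e(2) by (simp add: cw_def)
    finally show ?thesis .
  qed
  interpret latent_channel p q a b "\<lambda>y z. e (col q y z)"
  proof
    fix x y z w
    show "0 \<le> a x w" by (simp add: a_def class_prob_nonneg)
    show "0 \<le> b w y z" using weight_pos[OF W(1), of w y] by (auto simp: b_def colsum_def q_nonneg sum_nonneg less_imp_le)
    show "(\<Sum>w\<in>UNIV. a x w) = 1" using sum_a[of x "\<lambda>_. 1"] by (simp add: sum_class_prob)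
    show "(\<Sum>z\<in>UNIV. b w y z) = 1"
      using weight_pos[OF W(1), of w y] by (cases "w \<in> W") (auto simp: b_def sum_divide_distrib[symmetric] class_weight_def[symmetric])
    show "e (col q y z) = w" if "0 < a x w" "0 < b w y z"
    proof -
      have w: "w \<in> W" using that(1) by (cases "w \<in> W") (auto simp: a_def)
      then have "col q y z = cw w" using that by (auto simp: b_def of_bool_def split: if_splits)
      then show ?thesis using W(2)[OF w] by simp
    qed
    have "(\<Sum>w\<in>UNIV. a x w * b w y z) = (\<Sum>j\<in>cols q. class_prob x y0 j * b (e j) y z)" by (rule sum_a)
    also have "\<dots> = (\<Sum>j\<in>cols q. if j = col q y z then q x y z else 0)"
    proof (intro sum.cong refl)
      fix j assume j: "j \<in> cols q"
      have "class_prob x y0 j = j x * class_weight j y"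
        using class_prob_indep[OF R0, of x y0 j y] by (simp add: class_prob_eq)
      then show "class_prob x y0 j * b (e j) y z = (if j = col q y z then q x y z else 0)"
        using weight_pos[OF j, of y] e(2)[OF j] j q_eq_col[of x y z] by (auto simp: b_def W_def cw_def colsum_def)
    qed
    also have "\<dots> = q x y z"
      by (cases "z \<in> Zsupp q y") (auto simp: col_in_cols not_in_Zsupp)
    finally show "q x y z = (\<Sum>w\<in>UNIV. a x w * b w y z)" by simp
  qed
  have pw: "pw w y = of_bool (w \<in> W) * pWY (cw w) y" for w y
    unfolding pw_def a_def pWY_eq sum_distrib_left
    using class_prob_indep[OF R0, of _ y0 "cw w" y] by (intro sum.cong refl) (simp add: mult_ac)
  have "latent_entropy = - (\<Sum>w\<in>W. \<Sum>y\<in>UNIV. pWY (cw w) y * ln (pWY (cw w) y / pY y))"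
    unfolding latent_entropy_def pw by (subst sum.mono_neutral_right[of UNIV W]) (auto intro!: sum.cong)
  also have "(\<Sum>w\<in>W. \<Sum>y\<in>UNIV. pWY (cw w) y * ln (pWY (cw w) y / pY y)) = (\<Sum>j\<in>cols q. \<Sum>y\<in>UNIV. pWY j y * ln (pWY j y / pY y))"
    unfolding W_def sum.reindex[OF inj] using e(2) by (simp add: cw_def)
  also have "\<dots> = (\<Sum>y\<in>UNIV. \<Sum>j\<in>cols q. pWY j y * ln (pWY j y / pY y))" by (rule sum.swap)
  finally have "latent_entropy = cond_entropy" unfolding cond_entropy_def .
  then show ?thesis using R by (intro achievable_latent) (simp add: field_simps)
qed

text \<open>Normalising removes the positive factor; conversely the ratio of the column sums is the
  factor.\<close>

lemma col_equiv_iff: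
  assumes "z \<in> Zsupp q y" "z' \<in> Zsupp q y"
  shows "col_equiv q y z z' \<longleftrightarrow> col q y z = col q y z'"
proof
  assume "col_equiv q y z z'"
  then obtain c where c: "c > 0" "\<And>x. q x y z = c * q x y z'" unfolding col_equiv_def by blast
  then show "col q y z = col q y z'" unfolding col_def by (simp add: sum_distrib_left[symmetric])
next
  assume eq: "col q y z = col q y z'"
  have pos: "colsum y z > 0" "colsum y z' > 0" using assms colsum_pos by (auto simp: colsum_def)
  have "q x y z = colsum y z / colsum y z' * q x y z'" for x
    using q_eq_col[of x y z] q_eq_col[of x y z'] eq pos by (simp add: colsum_def)
  then show "col_equiv q y z z'" unfolding col_equiv_def using pos by (intro exI[of _ "colsum y z / colsum y z'"]) simp
qed

lemma secure_rate_eq: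
  assumes "securely_computable p q"
  shows "\<exists>k cls \<alpha>. consistent_classes q k cls \<alpha> \<and> secure_rate p q = cond_entropy_W p q k cls"
proof -
  obtain R0 where R0: "achievable p q R0" using assms unfolding securely_computable_def by blast
  \<comment> \<open>The labels are already common to all \<open>y\<close>, so any enumeration of
    \<open>cols q\<close> is a consistent indexing.\<close>
  define k where "k = card (cols q)"
  obtain \<alpha> where \<alpha>: "bij_betw \<alpha> {..<k} (cols q)"
    using ex_bij_betw_nat_finite[OF finite_cols[of q]] unfolding k_def atLeast0LessThan by blast
  have \<alpha>_in: "\<alpha> i \<in> cols q" if "i < k" for i using \<alpha> that by (auto simp: bij_betw_def)
  define cls where "cls y i = {z \<in> Zsupp q y. col q y z = \<alpha> i}" for y i
  have cls_nonempty: "\<exists>z. z \<in> cls y i" if "i < k" for y i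
    using class_occurs[OF R0 \<alpha>_in[OF that], of y] by (auto simp: cls_def)
  have "consistent_classes q k cls \<alpha>"
    unfolding consistent_classes_def
  proof (intro conjI allI impI)
    fix y i assume i: "i < k"
    obtain z where z: "z \<in> cls y i" using cls_nonempty[OF i] by blast
    then show "\<exists>z\<in>Zsupp q y. cls y i = {z' \<in> Zsupp q y. col_equiv q y z z'}"
      by (intro bexI[of _ z]) (auto simp: cls_def col_equiv_iff)
    fix j assume j: "j < k" "i \<noteq> j"
    then have "\<alpha> i \<noteq> \<alpha> j" using \<alpha> i by (auto simp: bij_betw_def inj_on_def)
    then show "cls y i \<noteq> cls y j" using z by (auto simp: cls_def)
  next
    fix y
    have "\<exists>i<k. col q y z = \<alpha> i" if "z \<in> Zsupp q y" for z
    proof -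
      have "col q y z \<in> cols q" using that by (auto simp: cols_def)
      then show ?thesis using \<alpha> by (auto simp: bij_betw_def)
    qed
    then show "(\<Union>i<k. cls y i) = Zsupp q y" by (auto simp: cls_def)
  next
    fix i x assume i: "i < k"
    obtain y z where yz: "z \<in> Zsupp q y" "\<alpha> i = col q y z" using \<alpha>_in[OF i] by (auto simp: cols_def)
    show "0 \<le> \<alpha> i x" unfolding yz(2) by (rule col_nonneg)
    show "(\<Sum>x\<in>UNIV. \<alpha> i x) = 1" unfolding yz(2) by (rule col_sum[OF yz(1)])
  next
    fix y i assume i: "i < k"
    show "\<forall>z\<in>cls y i. \<exists>g>0. \<forall>x. q x y z = \<alpha> i x * g"
    proof
      fix z assume z: "z \<in> cls y i"
      then have "z \<in> Zsupp q y" and eq: "\<alpha> i = col q y z" by (auto simp: cls_def)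
      then show "\<exists>g>0. \<forall>x. q x y z = \<alpha> i x * g"
        unfolding eq by (intro exI[of _ "\<Sum>x\<in>UNIV. q x y z"] conjI allI colsum_pos q_eq_col)
    qed
  qed
  moreover have "secure_rate p q = cond_entropy / ln 2"
  proof -
    have "Inf {R. achievable p q R} = cond_entropy / ln 2"
    proof (rule antisym)
      show "cond_entropy / ln 2 \<le> Inf {R. achievable p q R}"
        using R0 converse_rate by (intro cInf_greatest) auto
      have bdd: "bdd_below {R. achievable p q R}" using converse_rate by (auto intro!: bdd_belowI)
      \<comment> \<open>\<open>direct_rate\<close> reaches only rates strictly above the entropy,
        hence the \<epsilon>.\<close>
      show "Inf {R. achievable p q R} \<le> cond_entropy / ln 2"
      proof (rule field_le_epsilon)
        fix \<epsilon> :: real assume "0 < \<epsilon>"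
        then have "achievable p q (cond_entropy / ln 2 + \<epsilon>)" using direct_rate[OF R0] by simp
        then show "Inf {R. achievable p q R} \<le> cond_entropy / ln 2 + \<epsilon>" by (intro cInf_lower bdd) simp
      qed
    qed
    then show ?thesis unfolding secure_rate_def .
  qed
  moreover have "cond_entropy_W p q k cls = cond_entropy / ln 2"
  proof -
    have pwy: "(\<Sum>x\<in>UNIV. \<Sum>z\<in>cls y i. p x y * q x y z) = pWY (\<alpha> i) y" for y i
    proof -
      have "(\<Sum>z\<in>cls y i. p x y * q x y z) = (\<Sum>z\<in>UNIV. of_bool (col q y z = \<alpha> i) * (p x y * q x y z))" for x
        by (rule sum.mono_neutral_cong_left) (use not_in_Zsupp in \<open>auto simp: cls_def\<close>)
      then show ?thesis unfolding pWY_def margin_def sum_distrib_left by (subst sum.swap) simp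
    qed
    have "cond_entropy_W p q k cls = (\<Sum>y\<in>UNIV. \<Sum>i<k. - (pWY (\<alpha> i) y * ln (pWY (\<alpha> i) y / pY y)) / ln 2)"
      unfolding cond_entropy_W_def Let_def pwy pY_def[symmetric]
    proof (intro sum.cong refl)
      fix y i
      show "(if 0 < pWY (\<alpha> i) y then - pWY (\<alpha> i) y * log 2 (pWY (\<alpha> i) y / pY y) else 0)
         = - (pWY (\<alpha> i) y * ln (pWY (\<alpha> i) y / pY y)) / ln 2"
        using pWY_nonneg[of "\<alpha> i" y] by (auto simp: log_def)
    qed
    also have "\<dots> = (\<Sum>y\<in>UNIV. \<Sum>j\<in>cols q. - (pWY j y * ln (pWY j y / pY y)) / ln 2)"
      by (intro sum.cong refl sum.reindex_bij_betw[OF \<alpha>])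
    also have "\<dots> = cond_entropy / ln 2"
      unfolding cond_entropy_def by (simp add: sum_negf sum_divide_distrib)
    finally show ?thesis .
  qed
  ultimately show ?thesis by metis
qed

end

theorem theorem4:
  fixes p :: "'x::finite \<Rightarrow> 'y::finite \<Rightarrow> real"
    and q :: "'x \<Rightarrow> 'y \<Rightarrow> 'z::finite \<Rightarrow> real"
  assumes "is_joint_pmf p"
    and "is_channel q"
    and "\<forall>x y. p x y > 0"
    and "securely_computable p q"
  shows "\<exists>k cls \<alpha>. consistent_classes q k cls \<alpha> \<and> secure_rate p q = cond_entropy_W p q k cls"
proof -
  interpret source_channel p q
    using assms(1-3) by unfold_locales (auto simp: is_joint_pmf_def is_channel_def)
  show ?thesis using assms(4) by (rule secure_rate_eq)
qed

end
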